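(* Suppose that $\mathbb{Q}$ is a spectrally decomposable probability measure on $\mathbf{F}$ with index $\alpha>0$ such that $\mathbb{Q}(\xi'(\mathbb{G})>0)=1$, and assume that $\xi$ is mass-stationary with respect to $\mathbb{Q}$. Then there exists a unique stationary tail measure $\nu$ such that $\nu_\xi=\mathbb{Q}$. This tail measure is given as follows. (a) For every measurable $G\colon\mathbb{G}\to(0,\infty)$ with $\int G\,d\lambda=1$, $$\nu=\mathbb{E}_{\mathbb{Q}^G}\int\mathbf 1\{uY\in\cdot,\,u>0\}\,\alpha u^{-\alpha-1}\,du,$$ where $\mathbb{Q}^G:=\mathbb{E}_{\mathbb{Q}}\int\mathbf 1\{J_G(\theta_{-s}W)^{-1/\alpha}\theta_{-s}W\in\cdot\}\,G(s)\,\lambda(ds)$ and $J_G(\omega):=\int|\omega(s)|^\alpha G(s)\,\lambda(ds)$. (b) For every measurable $H\colon\mathbf{F}\times\mathbb{G}\to[0,\infty]$ which is $0$-homogeneous in the first coordinate ($H(u\omega,s)=H(\omega,s)$ for $u>0$) and satisfies $\int H(\theta_tW,s-t)\mathbf 1\{|W_s|>0\}\,\lambda(ds)=1$ for $\lambda$-a.e. $t$, $\mathbb{Q}$-a.s., $$\nu=\mathbb{E}_{\mathbb{Q}}\iint\mathbf 1\{u\theta_{-s}W\in\cdot\}\,H(\theta_{-s}W,s)\,\mathbf 1\{u>0\}\,\alpha u^{-\alpha-1}\,du\,\lambda(ds).$$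
   Context: $\mathbb{G}$ is a locally compact Hausdorff Abelian group (additive, neutral element $0$) with Borel $\sigma$-field $\mathcal{G}$ and non-trivial Haar measure $\lambda$. $\mathbb{H}$ is a non-empty Polish space with Borel $\sigma$-field $\mathcal{H}$ which is a measurable cone: there is a measurable map $(u,x)\mapsto ux$ from $(0,\infty)\times\mathbb{H}$ to $\mathbb{H}$ with $1x=x$, $u(vx)=(uv)x$. $|\cdot|\colon\mathbb{H}\to[0,\infty)$ is measurable with $|ux|=u|x|$ for $u>0$; $x_0\in\mathbb{H}$ is a fixed element with $|x_0|=1$. For $\omega\in\mathbb{H}^{\mathbb{G}}$ let $\theta_s\omega:=\omega(\cdot+s)$ and $(u\omega)(s):=u\,\omega(s)$. $\mathbf{F}\subset\mathbb{H}^{\mathbb{G}}$ is a set of functions closed under all $\theta_s$ and under multiplication by $u\in(0,\infty)$, with a $\sigma$-field $\mathcal{F}$ such that $(\omega,s)\mapsto(\theta_s\omega,\omega(0))$ (on $\mathbf{F}\times\mathbb{G}$) and $(\omega,u)\mapsto u\omega$ (on $\mathbf{F}\times(0,\infty)$) are measurable. If $\mathbb{G}$ is discrete, $\mathbf{F}=\mathbb{H}^{\mathbb{G}}$ with the product $\sigma$-field. $Y_s(\omega):=\omega(s)$, and $Y=(Y_s)_{s\in\mathbb{G}}$ is the identity on $\mathbf{F}$. $W_s:=|Y_0|^{-1}Y_s$ if $|Y_0|>0$ and $W_s:=x_0$ otherwise; $W=(W_s)_{s\in\mathbb{G}}$. $\mathbb{E}_\mu$ denotes integration with respect to $\mu$.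 $\mathbb{Q}$ is spectrally decomposable with index $\alpha>0$ if there is a probability measure $\mathbb{Q}'$ on $\mathbf{F}$ with $\mathbb{Q}'(|Y_0|=1)=1$ and $\mathbb{Q}=\iint\mathbf 1\{u\omega\in\cdot,\,u>1\}\,\alpha u^{-\alpha-1}\,\mathbb{Q}'(d\omega)\,du$. Let $\xi:=\int\mathbf 1\{s\in\cdot,\,|Y_s|>1\}\,\lambda(ds)$ and $\xi':=\int\mathbf 1\{s\in\cdot,\,|Y_s|>0\}\,\lambda(ds)$. $\xi$ is mass-stationary with respect to $\mathbb{Q}$ if $\mathbb{E}_{\mathbb{Q}}\int g(\theta_sY,-s)\,\xi(ds)=\mathbb{E}_{\mathbb{Q}}\int g(Y,s)\,\xi(ds)$ for all measurable $g\colon\mathbf{F}\times\mathbb{G}\to[0,\infty]$. A measure $\nu$ on $\mathbf{F}$ is a tail measure with index $\alpha>0$ if: $\xi'(\mathbb{G})>0$ $\nu$-a.e.; $\mathbb{E}_\nu\xi(B)<\infty$ for all compact $B\in\mathcal{G}$; and $\nu(uY\in\cdot)=u^\alpha\nu(Y\in\cdot)$ for all $u>0$. It is stationary if it is invariant under all shifts $\theta_s$; a stationary tail measure is always assumed normalized by $\nu(|Y_0|>1)=1$ (equivalently $\mathbb{E}_\nu\xi(B)=\lambda(B)$, $B\in\mathcal{G}$). For a $\sigma$-finite stationary measure $\nu$, the Palm measure of $\xi$ with respect to $\nu$ is $\nu_\xi(A):=\lambda(B)^{-1}\mathbb{E}_\nu\int\mathbf 1\{\theta_sY\in A\}\mathbf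 1_B(s)\,\xi(ds)$ for any $B\in\mathcal{G}$ with $0<\lambda(B)<\infty$; one has $\nu_\xi=\nu(\cdot\cap\{|Y_0|>1\})$.
   Formalization: The Haar measure λ is additionally assumed σ-finite; without this the existence of a unique stationary tail measure can fail (e.g. for 𝔾 = ℝ with the discrete topology times ℝ), and the G in (a) exists only if λ is σ-finite. *)

theory Defs
  imports "HOL-Probability.Probability"
begin

text \<open>
  Functions \<open>\<omega> : \<G> \<rightarrow> \<H>\<close> have type \<open>'g \<Rightarrow> 'h\<close>. The function space \<open>F\<close> together with its
  sigma-field is a value \<open>F\<close> of type \<open>('g \<Rightarrow> 'h) measure\<close> of which only \<open>space F\<close> and \<open>sets F\<close>
  are used; a measure on it is a value \<open>nu\<close> with \<open>sets nu = sets F\<close>.  The cone multiplication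
  is \<open>scal\<close> (only its values for positive scalars matter) and \<open>nrm\<close> is the modulus on the cone.
\<close>

definition haar_measure :: "'g::{topological_ab_group_add, t2_space} measure \<Rightarrow> bool" where
  "haar_measure lam \<longleftrightarrow>
     sets lam = sets borel \<and>
     emeasure lam UNIV \<noteq> 0 \<and>
     (\<forall>K. compact K \<longrightarrow> emeasure lam K < \<infinity>) \<and>
     (\<forall>B\<in>sets borel. \<forall>t. emeasure lam ((\<lambda>s. s + t) ` B) = emeasure lam B) \<and>
     (\<forall>B\<in>sets borel. emeasure lam B = (INF U\<in>{U. open U \<and> B \<subseteq> U}. emeasure lam U)) \<and>
     (\<forall>U. open U \<longrightarrow> emeasure lam U = (SUP K\<in>{K. compact K \<and> K \<subseteq> U}. emeasure lam K))"

definition shift :: "'g \<Rightarrow> ('g::ab_group_add \<Rightarrow> 'h) \<Rightarrow> 'g \<Rightarrow> 'h" where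
  "shift s \<omega> = (\<lambda>t. \<omega> (t + s))"

definition scale :: "(real \<Rightarrow> 'h \<Rightarrow> 'h) \<Rightarrow> real \<Rightarrow> ('g \<Rightarrow> 'h) \<Rightarrow> 'g \<Rightarrow> 'h" where
  "scale scal u \<omega> = (\<lambda>s. scal u (\<omega> s))"

text \<open>
  The assumption that the Haar measure is sigma-finite is implied by the existence of a strictly
  positive function on the group with integral 1. Without it, uniqueness of the
  stationary tail measure fails in general.
\<close>

locale tail_setting =
  fixes lam :: "'g::{topological_ab_group_add, t2_space} measure"
    and F :: "('g \<Rightarrow> 'h::polish_space) measure"
    and scal :: "real \<Rightarrow> 'h \<Rightarrow> 'h"
    and nrm :: "'h \<Rightarrow> real"
    and x0 :: 'h
  assumes locally_compact: "locally_compact_space (euclidean :: 'g topology)"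
    and haar: "haar_measure lam"
    and sigma_finite: "sigma_finite_measure lam"
    and scal_measurable:
      "(\<lambda>(u, x). scal u x) \<in> measurable (restrict_space borel {0<..} \<Otimes>\<^sub>M borel) borel"
    and scal_one: "\<And>x. scal 1 x = x"
    and scal_scal: "\<And>u v x. 0 < u \<Longrightarrow> 0 < v \<Longrightarrow> scal u (scal v x) = scal (u * v) x"
    and nrm_measurable: "nrm \<in> borel_measurable borel"
    and nrm_nonneg: "\<And>x. 0 \<le> nrm x"
    and nrm_scal: "\<And>u x. 0 < u \<Longrightarrow> nrm (scal u x) = u * nrm x"
    and nrm_x0: "nrm x0 = 1"
    and shift_closed: "\<And>\<omega> s. \<omega> \<in> space F \<Longrightarrow> shift s \<omega> \<in> space F"
    and scale_closed: "\<And>\<omega> u. \<omega> \<in> space F \<Longrightarrow> 0 < u \<Longrightarrow> scale scal u \<omega> \<in> space F"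
    and shift_eval_measurable:
      "(\<lambda>(\<omega>, s). (shift s \<omega>, \<omega> 0)) \<in> measurable (F \<Otimes>\<^sub>M borel) (F \<Otimes>\<^sub>M borel)"
    and scale_measurable:
      "(\<lambda>(\<omega>, u). scale scal u \<omega>) \<in> measurable (F \<Otimes>\<^sub>M restrict_space borel {0<..}) F"
    and discrete:
      "(\<forall>s::'g. open {s}) \<Longrightarrow> sets F = sets (PiM (UNIV :: 'g set) (\<lambda>_. borel :: 'h measure))"

text \<open>
  The process \<open>W\<close>. The constant function \<open>x0\<close> need not belong to the function space, so \<open>W\<close> takes
  values in it only where \<open>nrm (\<omega> 0) > 0\<close>. Therefore measures built from \<open>W\<close> are written below
  as integrals of indicator functions rather than with \<open>distr\<close>.
\<close>

definition Wproc :: "(real \<Rightarrow> 'h \<Rightarrow> 'h) \<Rightarrow> ('h \<Rightarrow> real) \<Rightarrow> 'h \<Rightarrow> ('g::zero \<Rightarrow> 'h) \<Rightarrow> 'g \<Rightarrow> 'h" where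
  "Wproc scal nrm x0 \<omega> = (\<lambda>s. if 0 < nrm (\<omega> 0) then scal (inverse (nrm (\<omega> 0))) (\<omega> s) else x0)"

definition xi :: "'g measure \<Rightarrow> ('h \<Rightarrow> real) \<Rightarrow> ('g \<Rightarrow> 'h) \<Rightarrow> 'g measure" where
  "xi lam nrm \<omega> = density lam (indicator {s. 1 < nrm (\<omega> s)})"

definition xi' :: "'g measure \<Rightarrow> ('h \<Rightarrow> real) \<Rightarrow> ('g \<Rightarrow> 'h) \<Rightarrow> 'g measure" where
  "xi' lam nrm \<omega> = density lam (indicator {s. 0 < nrm (\<omega> s)})"

definition spectrally_decomposable ::
  "('g::zero \<Rightarrow> 'h) measure \<Rightarrow> (real \<Rightarrow> 'h \<Rightarrow> 'h) \<Rightarrow> ('h \<Rightarrow> real) \<Rightarrow> real \<Rightarrow> ('g \<Rightarrow> 'h) measure \<Rightarrow> bool"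
  where
  "spectrally_decomposable F scal nrm \<alpha> Q \<longleftrightarrow>
     sets Q = sets F \<and>
     (\<exists>Q'. prob_space Q' \<and> sets Q' = sets F \<and>
        emeasure Q' {\<omega> \<in> space F. nrm (\<omega> 0) = 1} = 1 \<and>
        (\<forall>A\<in>sets F. emeasure Q A =
           (\<integral>\<^sup>+\<omega>. (\<integral>\<^sup>+u\<in>{1<..}. indicator A (scale scal u \<omega>) * ennreal (\<alpha> * u powr (- \<alpha> - 1)) \<partial>lborel) \<partial>Q')))"

definition mass_stationary ::
  "'g::{topological_space, ab_group_add} measure \<Rightarrow> ('g \<Rightarrow> 'h) measure \<Rightarrow> ('h \<Rightarrow> real) \<Rightarrow>
   ('g \<Rightarrow> 'h) measure \<Rightarrow> bool" where
  "mass_stationary lam F nrm Q \<longleftrightarrow>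
     (\<forall>g :: ('g \<Rightarrow> 'h) \<times> 'g \<Rightarrow> ennreal. g \<in> borel_measurable (F \<Otimes>\<^sub>M borel) \<longrightarrow>
        (\<integral>\<^sup>+\<omega>. (\<integral>\<^sup>+s. g (shift s \<omega>, - s) \<partial>xi lam nrm \<omega>) \<partial>Q) =
        (\<integral>\<^sup>+\<omega>. (\<integral>\<^sup>+s. g (\<omega>, s) \<partial>xi lam nrm \<omega>) \<partial>Q))"

definition tail_measure ::
  "'g::topological_space measure \<Rightarrow> ('g \<Rightarrow> 'h) measure \<Rightarrow> (real \<Rightarrow> 'h \<Rightarrow> 'h) \<Rightarrow> ('h \<Rightarrow> real) \<Rightarrow>
   real \<Rightarrow> ('g \<Rightarrow> 'h) measure \<Rightarrow> bool" where
  "tail_measure lam F scal nrm \<alpha> nu \<longleftrightarrow>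
     sets nu = sets F \<and>
     (AE \<omega> in nu. 0 < emeasure (xi' lam nrm \<omega>) UNIV) \<and>
     (\<forall>B. compact B \<and> B \<in> sets borel \<longrightarrow> (\<integral>\<^sup>+\<omega>. emeasure (xi lam nrm \<omega>) B \<partial>nu) < \<infinity>) \<and>
     (\<forall>u>0. \<forall>A\<in>sets F.
        emeasure nu {\<omega> \<in> space F. scale scal u \<omega> \<in> A} = ennreal (u powr \<alpha>) * emeasure nu A)"

definition stationary ::
  "('g::ab_group_add \<Rightarrow> 'h) measure \<Rightarrow> ('g \<Rightarrow> 'h) measure \<Rightarrow> bool" where
  "stationary F nu \<longleftrightarrow>
     sets nu = sets F \<and>
     (\<forall>s. \<forall>A\<in>sets F. emeasure nu {\<omega> \<in> space F. shift s \<omega> \<in> A} = emeasure nu A)"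

definition stationary_tail_measure ::
  "'g::{topological_space, ab_group_add} measure \<Rightarrow> ('g \<Rightarrow> 'h) measure \<Rightarrow> (real \<Rightarrow> 'h \<Rightarrow> 'h) \<Rightarrow>
   ('h \<Rightarrow> real) \<Rightarrow> real \<Rightarrow> ('g \<Rightarrow> 'h) measure \<Rightarrow> bool" where
  "stationary_tail_measure lam F scal nrm \<alpha> nu \<longleftrightarrow>
     tail_measure lam F scal nrm \<alpha> nu \<and> stationary F nu \<and>
     emeasure nu {\<omega> \<in> space F. 1 < nrm (\<omega> 0)} = 1"

text \<open>
  \<open>P\<close> is the Palm measure of \<open>xi\<close> with respect to \<open>nu\<close>. The defining formula does not depend on
  the choice of \<open>B\<close> when \<open>nu\<close> is stationary, and is required for every admissible \<open>B\<close>.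
\<close>

definition is_palm_measure ::
  "'g::{topological_space, ab_group_add} measure \<Rightarrow> ('g \<Rightarrow> 'h) measure \<Rightarrow> ('h \<Rightarrow> real) \<Rightarrow>
   ('g \<Rightarrow> 'h) measure \<Rightarrow> ('g \<Rightarrow> 'h) measure \<Rightarrow> bool" where
  "is_palm_measure lam F nrm nu P \<longleftrightarrow>
     sets P = sets F \<and>
     (\<forall>B\<in>sets borel. 0 < emeasure lam B \<and> emeasure lam B < \<infinity> \<longrightarrow>
        (\<forall>A\<in>sets F. emeasure P A =
           (\<integral>\<^sup>+\<omega>. (\<integral>\<^sup>+s. indicator A (shift s \<omega>) * indicator B s \<partial>xi lam nrm \<omega>) \<partial>nu) / emeasure lam B))"

definition JG :: "'g measure \<Rightarrow> ('h \<Rightarrow> real) \<Rightarrow> real \<Rightarrow> ('g \<Rightarrow> real) \<Rightarrow> ('g \<Rightarrow> 'h) \<Rightarrow> ennreal" where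
  "JG lam nrm \<alpha> G \<omega> = (\<integral>\<^sup>+s. ennreal (nrm (\<omega> s) powr \<alpha> * G s) \<partial>lam)"

text \<open>
  The measure \<open>QG\<close>. The factor \<open>JG powr (-1/\<alpha>)\<close> is meaningful only where \<open>JG\<close> is positive and
  finite; elsewhere \<open>enn2real\<close> and \<open>powr\<close> return 0, a scalar for which \<open>scal\<close> is unspecified.
\<close>

definition QG ::
  "'g::ab_group_add measure \<Rightarrow> ('g \<Rightarrow> 'h) measure \<Rightarrow> (real \<Rightarrow> 'h \<Rightarrow> 'h) \<Rightarrow> ('h \<Rightarrow> real) \<Rightarrow> 'h \<Rightarrow>
   real \<Rightarrow> ('g \<Rightarrow> 'h) measure \<Rightarrow> ('g \<Rightarrow> real) \<Rightarrow> ('g \<Rightarrow> 'h) measure" where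
  "QG lam F scal nrm x0 \<alpha> Q G = measure_of (space F) (sets F)
     (\<lambda>A. \<integral>\<^sup>+\<omega>. (\<integral>\<^sup>+s.
        (let w = shift (- s) (Wproc scal nrm x0 \<omega>) in
           indicator A (scale scal (enn2real (JG lam nrm \<alpha> G w) powr (- 1 / \<alpha>)) w)) * ennreal (G s) \<partial>lam) \<partial>Q)"

end

theory Submission
  imports Defs
begin

text \<open>
  Let \<open>m\<close> be the law of \<open>u \<omega>\<close> under \<open>Q' \<otimes> \<alpha> u\<^sup>-\<^sup>\<alpha>\<^sup>-\<^sup>1 du\<close>. By homogeneity, mass-stationarity of \<open>Q\<close>
  extends to a mass transport formula for \<open>m\<close> in which \<open>1 < |Y\<^sub>s|\<close> is replaced by \<open>0 < |Y\<^sub>s|\<close>. For a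
  positive weight \<open>k\<close> with finite integral, let \<open>\<nu>\<close> be the integral of \<open>k(s) / p(\<theta>\<^sub>-\<^sub>s \<omega>)\<close> times
  the unit mass at \<open>\<theta>\<^sub>-\<^sub>s \<omega>\<close> with respect to \<open>m(d\<omega>) \<lambda>(ds)\<close>, where \<open>p(\<omega>)\<close> is the \<open>k\<close>-weighted
  mass of \<open>{s. 0 < |\<omega>(s)|}\<close>. The mass transport formula shows that \<open>\<nu>\<close> does not depend on \<open>k\<close>, hence
  is stationary, and, since \<open>\<lambda>\<close> is invariant under inversion, that \<open>\<nu>\<close> restricted to \<open>{0 < |Y\<^sub>0|}\<close>
  is \<open>m\<close>. Conversely, this restriction is forced for every stationary tail measure with Palm
  measure \<open>Q\<close>. Shifting it by \<open>s\<close> and integrating against \<open>H\<close> gives formula (b), which yields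
  uniqueness; formula (a) is the case \<open>H(\<omega>, s) = G(s) |\<omega>(s)|\<^sup>\<alpha> / J\<^sub>G(\<omega>)\<close>, where \<open>J\<^sub>G\<close> is finite
  because \<open>|W\<^sub>s|\<^sup>\<alpha>\<close> has expectation at most 1.
\<close>

subsection \<open>Haar measure on locally compact Abelian groups\<close>

text \<open>The weight \<open>k\<close> is there because \<open>{s. 0 < |\<omega>(s)|}\<close> may
  have infinite Haar measure, so the shifts of a path have no canonical average; positivity and
  integrability of \<open>k\<close> force \<open>0 < p < \<infinity>\<close> on paths for which this
  set is not null. Independence of \<open>k\<close> compares two weights through a double integral
  over the group in which \<open>k'(q + s)\<close> appears. Shifts and evaluations of paths are
  jointly measurable by assumption, but group addition need not be, and this shapes the topological
  preparation: sigma-finiteness and regularity make the group sigma-compact, compact sets are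
  enlarged to Borel sets whose preimage under addition lies in the product sigma-field, and both the
  weight and the proof of inversion invariance are built from such sets. For uniqueness, a competing
  tail measure is not known to be sigma-finite, so this is extracted from the Palm equation before
  any exchange of integrals. Under \<open>Q\<close> the process \<open>W\<close> has law
  \<open>Q'\<close>, and the computations are carried out under \<open>Q'\<close>, where the modulus
  at 0 is 1.\<close>

lemma zero_neighbourhood_halve:
  fixes V :: "'g::topological_ab_group_add set"
  assumes "open V" "0 \<in> V"
  obtains W where "open W" "0 \<in> W" "\<And>x. x \<in> W \<Longrightarrow> - x \<in> W" "\<And>x y. x \<in> W \<Longrightarrow> y \<in> W \<Longrightarrow> x + y \<in> V"
proof -
  have "open ((\<lambda>p::'g \<times> 'g. fst p + snd p) -` V)"
    by (intro open_vimage assms continuous_intros)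
  moreover have "(0, 0) \<in> ((\<lambda>p::'g \<times> 'g. fst p + snd p) -` V)"
    using assms by simp
  ultimately obtain A B where AB: "open A" "open B" "(0, 0) \<in> A \<times> B"
      "A \<times> B \<subseteq> (\<lambda>p. fst p + snd p) -` V"
    by (rule open_prod_elim)
  define D where "D = A \<inter> B"
  define W where "W = D \<inter> uminus -` D"
  have "open D" using AB by (auto simp: D_def)
  then have "open W" unfolding W_def
    by (intro open_Int open_vimage) (auto intro!: continuous_intros)
  moreover have "0 \<in> W" using AB by (auto simp: W_def D_def)
  moreover have "x + y \<in> V" if "x \<in> W" "y \<in> W" for x y
    using AB(4) that by (auto simp: W_def D_def)
  ultimately show ?thesis by (intro that[of W]) (auto simp: W_def)
qed

text \<open>Around each \<open>k\<close> in \<open>K\<close> there is room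
  \<open>k + W k + W k\<close> inside \<open>U\<close>. Half of it reaches the points
  \<open>x\<close> near \<open>k\<close>, the other half remains for \<open>v\<close>; by
  compactness finitely many \<open>k\<close> suffice, so the intersection of their
  \<open>W k\<close> is still open.\<close>

lemma compact_translates_in_open:
  fixes K U :: "'g::topological_ab_group_add set"
  assumes "compact K" "open U" "K \<subseteq> U"
  obtains V where "open V" "0 \<in> V" "\<And>x v. x \<in> K \<Longrightarrow> v \<in> V \<Longrightarrow> x + v \<in> U"
proof -
  have "\<exists>W. open W \<and> 0 \<in> W \<and> (\<forall>v\<in>W. \<forall>w\<in>W. k + (v + w) \<in> U)" if "k \<in> K" for k
  proof -
    have "open ((\<lambda>v. k + v) -` U)"
      by (intro open_vimage assms continuous_intros)
    moreover have "0 \<in> (\<lambda>v. k + v) -` U" using that assms by auto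
    ultimately obtain W where "open W" "0 \<in> W" "\<And>x y. x \<in> W \<Longrightarrow> y \<in> W \<Longrightarrow> x + y \<in> (\<lambda>v. k + v) -` U"
      by (rule zero_neighbourhood_halve) blast
    then show ?thesis by (intro exI[of _ W]) auto
  qed
  then obtain W where W: "\<And>k. k \<in> K \<Longrightarrow> open (W k)" "\<And>k. k \<in> K \<Longrightarrow> 0 \<in> W k"
      "\<And>k v w. k \<in> K \<Longrightarrow> v \<in> W k \<Longrightarrow> w \<in> W k \<Longrightarrow> k + (v + w) \<in> U"
    by metis
  have "\<exists>C'\<subseteq>K. finite C' \<and> K \<subseteq> (\<Union>k\<in>C'. (\<lambda>x. x - k) -` W k)"
  proof (rule compactE_image[OF assms(1)])
    show "open ((\<lambda>x. x - k) -` W k)" if "k \<in> K" for k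
      by (intro open_vimage W that continuous_intros)
    show "K \<subseteq> (\<Union>k\<in>K. (\<lambda>x. x - k) -` W k)" using W by auto
  qed blast
  then obtain C where C: "C \<subseteq> K" "finite C" "K \<subseteq> (\<Union>k\<in>C. (\<lambda>x. x - k) -` W k)" by blast
  show ?thesis
  proof (rule that[of "\<Inter>k\<in>C. W k"])
    show "open (\<Inter>k\<in>C. W k)" using C W by (intro open_INT) auto
    show "0 \<in> (\<Inter>k\<in>C. W k)" using C W by auto
    fix x v assume "x \<in> K" "v \<in> (\<Inter>k\<in>C. W k)"
    then obtain k where k: "k \<in> C" "x - k \<in> W k" "v \<in> W k" using C by auto
    then have "k + ((x - k) + v) \<in> U" using C W(3) by blast
    then show "x + v \<in> U" by (simp add: algebra_simps)
  qed
qed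

text \<open>
  Addition need not be measurable for the product of the Borel sigma-fields unless the group is
  second countable. Fubini's theorem is therefore applied only to sets \<open>B\<close> such as the ones
  produced here.
\<close>

lemma compact_open_sandwich:
  fixes K U :: "'g::topological_ab_group_add set" and L :: "nat \<Rightarrow> 'g set"
  assumes K: "compact K" "open U" "K \<subseteq> U"
    and L: "\<And>j. compact (L j)" "(\<Union>j. L j) = UNIV"
  obtains B where "B \<in> sets borel" "K \<subseteq> B" "B \<subseteq> U"
    "{p. fst p + snd p \<in> B} \<in> sets (borel \<Otimes>\<^sub>M borel)"
proof -
  obtain V0 where V0: "open V0" "0 \<in> V0" "\<And>x v. x \<in> K \<Longrightarrow> v \<in> V0 \<Longrightarrow> x + v \<in> U"
    by (rule compact_translates_in_open[OF K]) blast
  \<comment> \<open>Dependent choice yields symmetric neighbourhoods with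
    \<open>V (Suc n) + V (Suc n) \<subseteq> V n\<close>, so that their intersection is a subgroup.
    Starting at \<open>V0\<close> keeps the final set inside \<open>U\<close>.\<close>
  have "\<exists>V. \<forall>n. (open (V n) \<and> 0 \<in> V n \<and> (n = 0 \<longrightarrow> V n = V0)) \<and>
      (\<forall>x\<in>V (Suc n). - x \<in> V (Suc n) \<and> (\<forall>y\<in>V (Suc n). x + y \<in> V n))"
  proof (rule dependent_nat_choice)
    show "\<exists>V. open V \<and> 0 \<in> V \<and> ((0::nat) = 0 \<longrightarrow> V = V0)" using V0 by auto
  next
    fix V and n :: nat
    assume "open V \<and> 0 \<in> V \<and> (n = 0 \<longrightarrow> V = V0)"
    then obtain W where "open W" "0 \<in> W" "\<And>x. x \<in> W \<Longrightarrow> - x \<in> W"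
        "\<And>x y. x \<in> W \<Longrightarrow> y \<in> W \<Longrightarrow> x + y \<in> V"
      using zero_neighbourhood_halve[of V] by metis
    then show "\<exists>W. (open W \<and> 0 \<in> W \<and> (Suc n = 0 \<longrightarrow> W = V0)) \<and>
        (\<forall>x\<in>W. - x \<in> W \<and> (\<forall>y\<in>W. x + y \<in> V))" by (intro exI[of _ W]) auto
  qed
  then obtain V where V: "\<And>n. open (V n)" "\<And>n. 0 \<in> V n" "V 0 = V0"
      "\<And>n x. x \<in> V (Suc n) \<Longrightarrow> - x \<in> V (Suc n)"
      "\<And>n x y. x \<in> V (Suc n) \<Longrightarrow> y \<in> V (Suc n) \<Longrightarrow> x + y \<in> V n"
    by metis
  have V_mono: "V (Suc n) \<subseteq> V n" for n using V(2)[of "Suc n"] V(5)[of _ n 0] by auto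
  define N where "N n = (\<Union>k\<in>K. (\<lambda>x. x - k) -` V n)" for n
  have N_open: "open (N n)" for n unfolding N_def
    by (intro open_UN ballI open_vimage V continuous_intros)
  \<comment> \<open>With \<open>N n = K + V n\<close>, this set is invariant under the subgroup
    \<open>\<Inter>n. V n\<close>. Such invariance is what permits a countable description of its
    preimage under addition.\<close>
  define B where "B = (\<Inter>n. N n)"
  have "\<exists>Y\<subseteq>L j. finite Y \<and> L j \<subseteq> (\<Union>y\<in>Y. (\<lambda>z. z - y) -` V n)" for j n
  proof (rule compactE_image[OF L(1)[of j]])
    show "open ((\<lambda>z. z - y) -` V n)" for y by (intro open_vimage V continuous_intros)
    show "L j \<subseteq> (\<Union>y\<in>L j. (\<lambda>z. z - y) -` V n)" using V by auto
  qed blast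
  then obtain Y where Y: "\<And>j n. finite (Y j n)" "\<And>j n. L j \<subseteq> (\<Union>y\<in>Y j n. (\<lambda>z. z - y) -` V n)"
    by metis
  \<comment> \<open>\<open>E n\<close> is a countable union of rectangles lying between the
    preimages under addition of \<open>N (Suc (Suc n))\<close> and \<open>N n\<close>, so
    intersecting over \<open>n\<close> gives the preimage of \<open>B\<close>. The points
    \<open>y\<close> form a countable net of the group, and each of the two inclusions costs one
    halving.\<close>
  define E where "E n = (\<Union>j. \<Union>y\<in>Y j (Suc (Suc n)).
      ((\<lambda>x. x + y) -` N (Suc n)) \<times> ((\<lambda>z. z - y) -` V (Suc (Suc n))))" for n
  have "(\<Union>y\<in>Y j m. ((\<lambda>x. x + y) -` N n) \<times> ((\<lambda>z. z - y) -` V m)) \<in> sets (borel \<Otimes>\<^sub>M borel)" for j m n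
    by (rule sets.finite_UN[OF Y(1)])
      (intro pair_measureI borel_open open_vimage N_open V continuous_intros)
  then have "E n \<in> sets (borel \<Otimes>\<^sub>M borel)" for n unfolding E_def
    by (intro sets.countable_UN) auto
  then have "(\<Inter>n. E n) \<in> sets (borel \<Otimes>\<^sub>M borel)" by auto
  moreover have "(\<Inter>n. E n) = {p. fst p + snd p \<in> B}"
  proof (intro equalityI subsetI)
    fix p assume p: "p \<in> (\<Inter>n. E n)"
    have "fst p + snd p \<in> N n" for n
    proof -
      from p obtain y k where *: "k \<in> K" "fst p + y - k \<in> V (Suc n)" "snd p - y \<in> V (Suc (Suc n))"
        by (fastforce simp: E_def N_def)
      then have "(fst p + y - k) + (snd p - y) \<in> V n"
        using V_mono[of "Suc n"] by (intro V(5)) auto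
      then show ?thesis using * by (auto simp: N_def algebra_simps)
    qed
    then show "p \<in> {p. fst p + snd p \<in> B}" by (auto simp: B_def)
  next
    fix p assume p: "p \<in> {p. fst p + snd p \<in> B}"
    have "p \<in> E n" for n
    proof -
      obtain j where "snd p \<in> L j" using L(2) by blast
      with Y(2)[of j "Suc (Suc n)"] obtain y where y: "y \<in> Y j (Suc (Suc n))"
          "snd p - y \<in> V (Suc (Suc n))" by auto
      obtain k where k: "k \<in> K" "fst p + snd p - k \<in> V (Suc (Suc n))"
        using p by (auto simp: B_def N_def)
      have "(fst p + snd p - k) + - (snd p - y) \<in> V (Suc n)"
        by (intro V(5) V(4) k y)
      then have "fst p + y - k \<in> V (Suc n)" by (simp add: algebra_simps)
      then have "fst p + y \<in> N (Suc n)" using k by (auto simp: N_def)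
      then show ?thesis using y unfolding E_def
        by (intro UN_I[of j] UN_I[of y]) (auto simp: mem_Times_iff)
    qed
    then show "p \<in> (\<Inter>n. E n)" by auto
  qed
  ultimately have "{p. fst p + snd p \<in> B} \<in> sets (borel \<Otimes>\<^sub>M borel)" by simp
  moreover have "B \<in> sets borel" unfolding B_def using N_open by (intro sets.countable_INT) auto
  moreover have "K \<subseteq> B" using V(2) by (auto simp: B_def N_def)
  moreover have "B \<subseteq> U"
  proof
    fix x assume "x \<in> B"
    then have "x \<in> N 0" by (auto simp: B_def)
    then obtain k where "k \<in> K" "x - k \<in> V0" using V(3) by (auto simp: N_def)
    then have "k + (x - k) \<in> U" by (intro V0(3))
    then show "x \<in> U" by simp
  qed
  ultimately show ?thesis by (intro that[of B])
qed

section \<open>Regularity, sigma-compactness and inversion invariance of the Haar measure\<close>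

locale sigma_finite_haar = sigma_finite_measure lam
  for lam :: "'g::{topological_ab_group_add, t2_space} measure" +
  assumes lc: "locally_compact_space (euclidean :: 'g topology)"
    and haar_lam: "haar_measure lam"
begin

lemma
  shows sets_lam [measurable_cong, simp]: "sets lam = sets borel"
    and emeasure_UNIV: "emeasure lam UNIV \<noteq> 0"
    and compact_finite: "compact K \<Longrightarrow> emeasure lam K < \<infinity>"
    and translate: "B \<in> sets borel \<Longrightarrow> emeasure lam ((\<lambda>s. s + t) ` B) = emeasure lam B"
    and outer_regular:
      "B \<in> sets borel \<Longrightarrow> emeasure lam B = (INF U\<in>{U. open U \<and> B \<subseteq> U}. emeasure lam U)"
    and inner_regular:
      "open U \<Longrightarrow> emeasure lam U = (SUP K\<in>{K. compact K \<and> K \<subseteq> U}. emeasure lam K)"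
proof -
  note h1 = haar_lam[unfolded haar_measure_def]
  note h2 = h1[THEN conjunct2]
  note h3 = h2[THEN conjunct2]
  note h4 = h3[THEN conjunct2]
  note h5 = h4[THEN conjunct2]
  show "sets lam = sets borel" by (rule h1[THEN conjunct1])
  show "emeasure lam UNIV \<noteq> 0" by (rule h2[THEN conjunct1])
  show "emeasure lam K < \<infinity>" if "compact K"
    by (rule h3[THEN conjunct1, rule_format, OF that])
  show "emeasure lam ((\<lambda>s. s + t) ` B) = emeasure lam B" if "B \<in> sets borel"
    by (rule h4[THEN conjunct1, rule_format, OF that])
  show "emeasure lam B = (INF U\<in>{U. open U \<and> B \<subseteq> U}. emeasure lam U)" if "B \<in> sets borel"
    by (rule h5[THEN conjunct1, rule_format, OF that])
  show "emeasure lam U = (SUP K\<in>{K. compact K \<and> K \<subseteq> U}. emeasure lam K)" if "open U"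
    by (rule h5[THEN conjunct2, rule_format, OF that])
qed

lemma space_lam [simp]: "space lam = UNIV"
  using sets_eq_imp_space_eq[OF sets_lam] by simp

lemma add_right_measurable [measurable]: "(\<lambda>s::'g. s + t) \<in> borel_measurable borel"
  by (intro borel_measurable_continuous_onI continuous_intros)

lemma uminus_group_measurable [measurable]: "(uminus :: 'g \<Rightarrow> 'g) \<in> borel_measurable borel"
  by (intro borel_measurable_continuous_onI continuous_intros)

lemma distr_add: "distr lam borel (\<lambda>s. s + t) = lam"
proof (rule measure_eqI)
  fix B assume "B \<in> sets (distr lam borel (\<lambda>s. s + t))"
  then have B: "B \<in> sets borel" by simp
  have *: "(\<lambda>s. s + t) -` B = (\<lambda>s. s + (- t)) ` B"
    by (auto simp: image_iff intro!: bexI[of _ "_ + t"])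
  have "emeasure lam ((\<lambda>s. s + (- t)) ` B) = emeasure lam B"
    by (rule translate[OF B])
  then show "emeasure (distr lam borel (\<lambda>s. s + t)) B = emeasure lam B"
    unfolding *[symmetric] using B by (simp add: emeasure_distr)
qed simp

lemma nn_integral_add:
  assumes [measurable]: "f \<in> borel_measurable borel"
  shows "(\<integral>\<^sup>+s. f (s + t) \<partial>lam) = (\<integral>\<^sup>+s. f s \<partial>lam)"
proof -
  have "(\<integral>\<^sup>+s. f s \<partial>lam) = (\<integral>\<^sup>+s. f s \<partial>distr lam borel (\<lambda>s. s + t))"
    by (simp add: distr_add)
  also have "\<dots> = (\<integral>\<^sup>+s. f (s + t) \<partial>lam)" by (rule nn_integral_distr) auto
  finally show ?thesis ..
qed

lemma emeasure_add_vimage: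
  assumes [measurable]: "B \<in> sets borel"
  shows "emeasure lam ((\<lambda>s. s + t) -` B) = emeasure lam B"
proof -
  have "emeasure (distr lam borel (\<lambda>s. s + t)) B = emeasure lam ((\<lambda>s. s + t) -` B \<inter> space lam)"
    by (rule emeasure_distr) auto
  then show ?thesis unfolding distr_add by simp
qed

text \<open>Finitely many translates of a null open set would cover any given compact set. All
  compact sets would then be null, and inner regularity of the whole space would make
  \<open>lam\<close> trivial.\<close>

lemma open_positive:
  assumes "open U" "U \<noteq> {}"
  shows "0 < emeasure lam U"
proof (rule ccontr)
  assume "\<not> 0 < emeasure lam U"
  then have 0: "emeasure lam U = 0" by simp
  obtain u where u: "u \<in> U" using assms by auto
  have "emeasure lam K = 0" if K: "compact K" for K
  proof -
    have op: "open ((\<lambda>x. x + (u - k)) -` U)" for k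
      by (intro open_vimage assms continuous_intros)
    have "\<exists>C\<subseteq>K. finite C \<and> K \<subseteq> (\<Union>k\<in>C. (\<lambda>x. x + (u - k)) -` U)"
      by (rule compactE_image[OF K, of K "\<lambda>k. (\<lambda>x. x + (u - k)) -` U"]) (use op u in auto)
    then obtain C where C: "finite C" "K \<subseteq> (\<Union>k\<in>C. (\<lambda>x. x + (u - k)) -` U)" by blast
    have "(\<lambda>x. x + (u - k)) -` U \<in> null_sets lam" for k
    proof (rule null_setsI)
      have "emeasure lam ((\<lambda>x. x + (u - k)) -` U) = emeasure lam U"
        by (rule emeasure_add_vimage[OF borel_open[OF assms(1)]])
      then show "emeasure lam ((\<lambda>x. x + (u - k)) -` U) = 0" using 0 by (rule trans)
    qed (simp add: borel_open[OF op])
    then have "(\<Union>k\<in>C. (\<lambda>x. x + (u - k)) -` U) \<in> null_sets lam"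
      using C by (intro null_sets.finite_UN) auto
    moreover have "K \<in> sets lam"
      using borel_closed[OF compact_imp_closed[OF K]] by simp
    ultimately have "K \<in> null_sets lam" using C(2) by (rule null_sets_subset)
    then show ?thesis by (rule null_setsD1)
  qed
  then have "(SUP K\<in>{K::'g set. compact K \<and> K \<subseteq> UNIV}. emeasure lam K) \<le> 0"
    by (intro SUP_least) simp
  then have "emeasure lam UNIV = 0"
    using inner_regular[OF open_UNIV] by (simp only: le_zero_eq)
  then show False using emeasure_UNIV by contradiction
qed

lemma compact_zero_neighbourhood:
  obtains N C :: "'g set" where "open N" "compact C" "0 \<in> N" "N \<subseteq> C"
proof -
  have "\<exists>U K. openin euclidean U \<and> compactin euclidean K \<and> (0::'g) \<in> U \<and> U \<subseteq> K"
    using lc unfolding locally_compact_space_def by (rule bspec) simp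
  then show ?thesis using that by (auto simp del: sets_lam)
qed

text \<open>Outer regularity encloses a sigma-finite exhaustion in open sets \<open>U i\<close> of
  finite measure, and inner regularity fills each \<open>U i\<close> up to a null set by countably
  many compact sets. What is missed contains no nonempty open set, so adding a compact neighbourhood
  of 0 to the compact sets reaches every point.\<close>

lemma sigma_compact:
  obtains L :: "nat \<Rightarrow> 'g set" where "\<And>j. compact (L j)" "(\<Union>j. L j) = UNIV"
proof -
  obtain A :: "nat \<Rightarrow> 'g set" where A: "range A \<subseteq> sets lam" "(\<Union>i. A i) = space lam"
      "\<And>i. emeasure lam (A i) \<noteq> \<infinity>" by (rule sigma_finite) blast
  have "\<exists>U. open U \<and> A i \<subseteq> U \<and> emeasure lam U < \<infinity>" for i
  proof -
    have "(INF U\<in>{U. open U \<and> A i \<subseteq> U}. emeasure lam U) < \<infinity>"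
      using A by (subst outer_regular[symmetric]) (auto simp: less_top)
    then show ?thesis by (auto simp: INF_less_iff)
  qed
  then obtain U where U: "\<And>i. open (U i)" "\<And>i. A i \<subseteq> U i" "\<And>i. emeasure lam (U i) < \<infinity>" by metis
  have "\<exists>K. (\<forall>j::nat. compact (K j) \<and> K j \<subseteq> U i) \<and> emeasure lam (U i - (\<Union>j. K j)) = 0" for i
  proof -
    have "{K. compact K \<and> K \<subseteq> U i} \<noteq> {}" by (auto intro: exI[of _ "{}"])
    from ennreal_SUP_countable_SUP[OF this, of "emeasure lam"]
    obtain f :: "nat \<Rightarrow> ennreal" where f: "range f \<subseteq> emeasure lam ` {K. compact K \<and> K \<subseteq> U i}"
        "(SUP K\<in>{K. compact K \<and> K \<subseteq> U i}. emeasure lam K) = (SUP j. f j)" by auto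
    have "\<exists>K. compact K \<and> K \<subseteq> U i \<and> emeasure lam K = f j" for j
    proof -
      have "f j \<in> emeasure lam ` {K. compact K \<and> K \<subseteq> U i}" by (rule subsetD[OF f(1)]) simp
      then obtain K where "f j = emeasure lam K" "K \<in> {K. compact K \<and> K \<subseteq> U i}" by (rule imageE)
      then show ?thesis by (intro exI[of _ K]) simp
    qed
    then obtain K where K: "\<And>j. compact (K j)" "\<And>j. K j \<subseteq> U i" "\<And>j. emeasure lam (K j) = f j" by metis
    have Km: "K j \<in> sets borel" for j using K(1) by (intro borel_closed compact_imp_closed)
    have "emeasure lam (U i) = (SUP j. emeasure lam (K j))"
      using f K inner_regular[OF U(1)] by simp
    also have "\<dots> \<le> emeasure lam (\<Union>j. K j)"
      using Km by (intro SUP_least emeasure_mono) auto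
    finally have *: "emeasure lam (U i) \<le> emeasure lam (\<Union>j. K j)" .
    have "emeasure lam (\<Union>j. K j) \<le> emeasure lam (U i)"
      using K(2) borel_open[OF U(1)[of i]] by (intro emeasure_mono) auto
    then have "emeasure lam (\<Union>j. K j) < \<infinity>"
      by (rule le_less_trans) (rule U(3))
    then have fin: "emeasure lam (\<Union>j. K j) \<noteq> \<infinity>" by (rule less_imp_neq)
    have "emeasure lam (U i - (\<Union>j. K j)) = emeasure lam (U i) - emeasure lam (\<Union>j. K j)"
      using K U(1)[of i] Km fin by (intro emeasure_Diff) auto
    also have "\<dots> = 0" using * U(3)[of i] by (subst diff_eq_0_iff_ennreal) auto
    finally show ?thesis using K by blast
  qed
  then obtain K where K: "\<And>i j. compact (K i (j::nat))" "\<And>i j. K i j \<subseteq> U i"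
      "\<And>i. emeasure lam (U i - (\<Union>j. K i j)) = 0" by metis
  have Km: "K i j \<in> sets borel" for i j using K(1) by (intro borel_closed compact_imp_closed)
  obtain N C :: "'g set" where NC: "open N" "compact C" "0 \<in> N" "N \<subseteq> C"
    by (rule compact_zero_neighbourhood)
  define L where "L n = (\<lambda>p. fst p + snd p) ` (case prod_decode n of (i, j) \<Rightarrow> K i j \<times> C)" for n
  show ?thesis
  proof (rule that[of L])
    show "compact (L n)" for n unfolding L_def
      by (cases "prod_decode n")
        (auto intro!: compact_continuous_image continuous_intros compact_Times K NC)
    show "(\<Union>n. L n) = UNIV"
    proof (rule ccontr)
      assume "(\<Union>n. L n) \<noteq> UNIV"
      then obtain x where x: "\<And>n. x \<notin> L n" by blast
      \<comment> \<open>A point \<open>x\<close> outside every \<open>K i j + C\<close> makes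
        \<open>x - N\<close> an open set disjoint from all \<open>K i j\<close>, hence contained in
        the null residue.\<close>
      define V where "V = (\<lambda>y. x - y) -` N"
      have "open V" unfolding V_def by (intro open_vimage NC continuous_intros)
      moreover have "x \<in> V" using NC by (simp add: V_def)
      ultimately have pos: "0 < emeasure lam V" by (intro open_positive) auto
      have disj: "V \<inter> K i j = {}" for i j
      proof -
        have False if "y \<in> V" "y \<in> K i j" for y
        proof -
          have "x = fst (y, x - y) + snd (y, x - y)" "(y, x - y) \<in> K i j \<times> C"
            using that NC by (auto simp: V_def)
          then have "x \<in> L (prod_encode (i, j))" unfolding L_def prod_encode_inverse prod.case
            by (rule image_eqI)
          then show False using x by blast
        qed
        then show ?thesis by blast
      qed
      have "V \<subseteq> (\<Union>i. U i - (\<Union>j. K i j))"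
      proof
        fix y assume y: "y \<in> V"
        have "y \<in> (\<Union>i. A i)" using A(2) by simp
        then obtain i where "y \<in> A i" by (rule UN_E)
        then have "y \<in> U i" using U(2) by (rule subsetD[rotated])
        then show "y \<in> (\<Union>i. U i - (\<Union>j. K i j))"
          using y disj by (intro UN_I[of i]) auto
      qed
      moreover have null: "(\<Union>i. U i - (\<Union>j. K i j)) \<in> null_sets lam"
        using U(1) Km K(3) by (intro null_sets_UN null_setsI) auto
      ultimately have "emeasure lam V \<le> emeasure lam (\<Union>i. U i - (\<Union>j. K i j))"
        by (intro emeasure_mono null_setsD2)
      also have "\<dots> = 0" using null by (rule null_setsD1)
      finally have "emeasure lam V \<le> 0" .
      with pos show False by simp
    qed
  qed
qed

lemma sandwich:
  fixes K U :: "'g set"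
  assumes "compact K" "open U" "K \<subseteq> U"
  obtains B where "B \<in> sets borel" "K \<subseteq> B" "B \<subseteq> U"
    "{p. fst p + snd p \<in> B} \<in> sets (borel \<Otimes>\<^sub>M borel)"
proof -
  obtain L :: "nat \<Rightarrow> 'g set" where L: "\<And>j. compact (L j)" "(\<Union>j. L j) = UNIV"
    by (rule sigma_compact) blast
  show ?thesis
  proof (rule compact_open_sandwich[OF assms, of L])
    show "compact (L j)" for j by (rule L(1))
    show "(\<Union>j. L j) = UNIV" by (rule L(2))
  qed (rule that)
qed

text \<open>Outer regularity surrounds \<open>K\<close> by an open set of finite measure, below
  which the addition-compatible set is squeezed.\<close>

lemma finite_measure_sandwich:
  assumes "compact K"
  obtains B where "B \<in> sets borel" "K \<subseteq> B" "emeasure lam B < \<infinity>"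
    "{p. fst p + snd p \<in> B} \<in> sets (borel \<Otimes>\<^sub>M borel)"
proof -
  have "(INF U\<in>{U. open U \<and> K \<subseteq> U}. emeasure lam U) < \<infinity>"
    using compact_finite[OF assms] assms
    by (subst outer_regular[symmetric]) (auto simp: compact_imp_closed)
  then obtain U where U: "open U" "K \<subseteq> U" "emeasure lam U < \<infinity>" by (auto simp: INF_less_iff)
  obtain B where "B \<in> sets borel" "K \<subseteq> B" "B \<subseteq> U"
    "{p. fst p + snd p \<in> B} \<in> sets (borel \<Otimes>\<^sub>M borel)" by (rule sandwich[OF assms U(1,2)])
  moreover have "emeasure lam B \<le> emeasure lam U"
    using U \<open>B \<subseteq> U\<close> by (intro emeasure_mono) auto
  ultimately show ?thesis using U by (intro that[of B]) auto
qed

text \<open>Fubini takes the place of the uniqueness theorem for Haar measures: after translations,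
  the double integral of \<open>indicator L (- y) * indicator D (x + y)\<close> equals both
  \<open>lam D * lam (- L)\<close> and \<open>lam D * lam L\<close>. The exchange requires
  addition-compatible sets, so only these satisfy the identity directly. Sandwiching carries an
  inequality over to compact sets, inner regularity to open sets, outer regularity to Borel sets;
  applied to \<open>- B\<close> it gives the reverse inequality.\<close>

lemma emeasure_uminus:
  assumes "B \<in> sets borel"
  shows "emeasure lam (uminus -` B) = emeasure lam B"
proof -
  interpret pair_sigma_finite lam lam by unfold_locales
  obtain N C :: "'g set" where NC: "open N" "compact C" "0 \<in> N" "N \<subseteq> C"
    by (rule compact_zero_neighbourhood)
  \<comment> \<open>\<open>D\<close> is an auxiliary set: addition-compatible for Fubini, of
    positive finite measure so that it cancels at the end.\<close>
  obtain D where D: "D \<in> sets borel" "C \<subseteq> D" "emeasure lam D < \<infinity>"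
      "{p. fst p + snd p \<in> D} \<in> sets (borel \<Otimes>\<^sub>M borel)"
    by (rule finite_measure_sandwich[OF NC(2)])
  have D0: "0 < emeasure lam D"
    using open_positive[OF NC(1)] NC D emeasure_mono[of N D lam] by (force intro: less_le_trans)
  have nice: "emeasure lam (uminus -` L) = emeasure lam L"
    if [measurable]: "L \<in> sets borel" and L: "{p. fst p + snd p \<in> L} \<in> sets (borel \<Otimes>\<^sub>M borel)" for L
  proof -
    note [measurable] = D(1)
    have [measurable]: "Measurable.pred (borel \<Otimes>\<^sub>M borel) (\<lambda>p. fst p + snd p \<in> D)"
      using D(4) by (simp add: pred_def space_pair_measure)
    have L1: "Measurable.pred (borel \<Otimes>\<^sub>M borel) (\<lambda>p. fst p + snd p \<in> L)"
      using L by (simp add: pred_def space_pair_measure)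
    have "(\<lambda>p. (fst p, - snd p)) \<in> measurable (borel \<Otimes>\<^sub>M borel) (borel \<Otimes>\<^sub>M (borel :: 'g measure))"
      by measurable
    from measurable_compose[OF this L1]
    have [measurable]: "Measurable.pred (borel \<Otimes>\<^sub>M borel) (\<lambda>p. fst p - snd p \<in> L)" by simp
    define L' where "L' = uminus -` L"
    have [measurable]: "L' \<in> sets borel"
      using measurable_sets[OF uminus_group_measurable that(1)] by (simp add: L'_def)
    have "emeasure lam D * emeasure lam L' = (\<integral>\<^sup>+y. emeasure lam D * indicator L' y \<partial>lam)"
      by (simp add: nn_integral_cmult_indicator)
    also have "\<dots> = (\<integral>\<^sup>+y. (\<integral>\<^sup>+x. indicator L' y * indicator D (x + y) \<partial>lam) \<partial>lam)"
    proof (rule nn_integral_cong)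
      fix y
      have "(\<integral>\<^sup>+x. indicator L' y * indicator D (x + y) \<partial>lam) =
          indicator L' y * (\<integral>\<^sup>+x. indicator D (x + y) \<partial>lam)"
        by (intro nn_integral_cmult) measurable
      also have "(\<integral>\<^sup>+x. indicator D (x + y) \<partial>lam) = emeasure lam D"
        by (subst nn_integral_add) simp_all
      finally show "emeasure lam D * indicator L' y = (\<integral>\<^sup>+x. indicator L' y * indicator D (x + y) \<partial>lam)"
        by (simp add: mult.commute)
    qed
    also have "\<dots> = (\<integral>\<^sup>+x. (\<integral>\<^sup>+y. indicator L' y * indicator D (x + y) \<partial>lam) \<partial>lam)"
      by (rule Fubini') (simp add: split_beta', measurable)
    \<comment> \<open>Replacing \<open>y\<close> by \<open>y - x\<close> turns
      \<open>- y \<in> L\<close> into \<open>x - y \<in> L\<close> and frees the factor of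
      \<open>D\<close> from \<open>x\<close>.\<close>
    also have "\<dots> = (\<integral>\<^sup>+x. (\<integral>\<^sup>+y. indicator L (x - y) * indicator D y \<partial>lam) \<partial>lam)"
    proof (rule nn_integral_cong)
      fix x
      have "(\<integral>\<^sup>+y. indicator L' y * indicator D (x + y) \<partial>lam) =
          (\<integral>\<^sup>+y. indicator L' (y - x) * indicator D y \<partial>lam)"
        by (subst nn_integral_add[of _ "- x", symmetric]) (simp_all add: algebra_simps)
      then show "(\<integral>\<^sup>+y. indicator L' y * indicator D (x + y) \<partial>lam) =
          (\<integral>\<^sup>+y. indicator L (x - y) * indicator D y \<partial>lam)"
        by (simp add: L'_def indicator_def)
    qed
    also have "\<dots> = (\<integral>\<^sup>+y. (\<integral>\<^sup>+x. indicator L (x - y) * indicator D y \<partial>lam) \<partial>lam)"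
      by (rule Fubini'[symmetric]) (simp add: split_beta', measurable)
    also have "\<dots> = (\<integral>\<^sup>+y. emeasure lam L * indicator D y \<partial>lam)"
    proof (rule nn_integral_cong)
      fix y
      have "(\<integral>\<^sup>+x. indicator L (x - y) \<partial>lam) = (\<integral>\<^sup>+x. indicator L x \<partial>lam)"
        by (subst (2) nn_integral_add[of _ "- y", symmetric]) simp_all
      then show "(\<integral>\<^sup>+x. indicator L (x - y) * indicator D y \<partial>lam) = emeasure lam L * indicator D y"
        using add_right_measurable[of "- y"] by (subst nn_integral_multc) (simp_all add: measurable_compose)
    qed
    also have "\<dots> = emeasure lam D * emeasure lam L"
      by (subst nn_integral_cmult_indicator) (simp_all add: mult.commute)
    finally show ?thesis using D0 D(3) by (auto simp: ennreal_mult_cancel_left L'_def)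
  qed
  have vim: "uminus -` A \<in> sets borel" if "A \<in> sets borel" for A :: "'g set"
    using measurable_sets[OF uminus_group_measurable that] by simp
  have op: "open (uminus -` U)" if "open U" for U :: "'g set"
    by (intro open_vimage that continuous_intros)
  have comp: "compact (uminus -` K)" if "compact K" for K :: "'g set"
  proof -
    have "uminus -` K = uminus ` K" by (force simp: image_iff)
    then show ?thesis using that by (auto intro!: compact_continuous_image continuous_intros)
  qed
  have compact_le: "emeasure lam K \<le> emeasure lam (uminus -` K)" if K: "compact K" for K
  proof -
    have "emeasure lam K \<le> emeasure lam U" if U: "open U" "uminus -` K \<subseteq> U" for U
    proof -
      have "K \<subseteq> uminus -` U" using U by force
      then obtain L where L: "L \<in> sets borel" "K \<subseteq> L" "L \<subseteq> uminus -` U"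
        "{p. fst p + snd p \<in> L} \<in> sets (borel \<Otimes>\<^sub>M borel)" by (rule sandwich[OF K op[OF U(1)]])
      have "emeasure lam K \<le> emeasure lam L" using L by (intro emeasure_mono) auto
      also have "\<dots> = emeasure lam (uminus -` L)" using nice[OF L(1,4)] ..
      also have "\<dots> \<le> emeasure lam U" using L U by (intro emeasure_mono) auto
      finally show ?thesis .
    qed
    then show ?thesis
      using comp[OF K] by (subst outer_regular[of "uminus -` K"])
        (auto intro!: INF_greatest simp: compact_imp_closed)
  qed
  have open_le: "emeasure lam U \<le> emeasure lam (uminus -` U)" if U: "open U" for U
  proof -
    have "(SUP K\<in>{K. compact K \<and> K \<subseteq> U}. emeasure lam K) \<le> emeasure lam (uminus -` U)"
    proof (rule SUP_least)
      fix K assume "K \<in> {K. compact K \<and> K \<subseteq> U}"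
      then have K: "compact K" "K \<subseteq> U" by simp_all
      have "emeasure lam (uminus -` K) \<le> emeasure lam (uminus -` U)"
        using K(2) borel_open[OF op[OF U]] by (intro emeasure_mono) auto
      with compact_le[OF K(1)] show "emeasure lam K \<le> emeasure lam (uminus -` U)" by (rule order_trans)
    qed
    then show ?thesis by (subst inner_regular[OF U])
  qed
  have borel_le: "emeasure lam A \<le> emeasure lam (uminus -` A)" if A: "A \<in> sets borel" for A
  proof -
    have "emeasure lam A \<le> emeasure lam U" if U: "open U" "uminus -` A \<subseteq> U" for U
    proof -
      have "A \<subseteq> uminus -` U" using U(2) by force
      then have "emeasure lam A \<le> emeasure lam (uminus -` U)"
        using borel_open[OF op[OF U(1)]] by (intro emeasure_mono) auto
      also have "\<dots> \<le> emeasure lam (uminus -` (uminus -` U))" by (rule open_le[OF op[OF U(1)]])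
      also have "uminus -` (uminus -` U) = U" by auto
      finally show ?thesis .
    qed
    then have "emeasure lam A \<le> (INF U\<in>{U. open U \<and> uminus -` A \<subseteq> U}. emeasure lam U)"
      by (intro INF_greatest) simp
    then show ?thesis by (subst outer_regular[OF vim[OF A]])
  qed
  show ?thesis
  proof (rule antisym)
    have "uminus -` (uminus -` B) = B" by auto
    then show "emeasure lam (uminus -` B) \<le> emeasure lam B" using borel_le[OF vim[OF assms]] by simp
  qed (rule borel_le[OF assms])
qed

lemma distr_uminus: "distr lam borel uminus = lam"
  by (rule measure_eqI) (auto simp: emeasure_distr emeasure_uminus)

lemma nn_integral_uminus:
  assumes [measurable]: "f \<in> borel_measurable borel"
  shows "(\<integral>\<^sup>+s. f (- s) \<partial>lam) = (\<integral>\<^sup>+s. f s \<partial>lam)"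
proof -
  have "(\<integral>\<^sup>+s. f s \<partial>lam) = (\<integral>\<^sup>+s. f s \<partial>distr lam borel uminus)"
    by (simp add: distr_uminus)
  also have "\<dots> = (\<integral>\<^sup>+s. f (- s) \<partial>lam)" by (rule nn_integral_distr) auto
  finally show ?thesis ..
qed

text \<open>For an arbitrary positive integrable \<open>k\<close>, the function
  \<open>k (s + t)\<close> need not be measurable for the product sigma-field. A positive series of
  indicators of addition-compatible sets covering the group has this property by
  construction.\<close>

lemma positive_integrable_add_measurable:
  obtains k :: "'g \<Rightarrow> ennreal" where
    "k \<in> borel_measurable borel" "\<And>s. 0 < k s" "(\<integral>\<^sup>+s. k s \<partial>lam) < \<infinity>"
    "(\<lambda>p. k (fst p + snd p)) \<in> borel_measurable (borel \<Otimes>\<^sub>M borel)"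
proof -
  obtain L :: "nat \<Rightarrow> 'g set" where L: "\<And>j. compact (L j)" "(\<Union>j. L j) = UNIV"
    by (rule sigma_compact) blast
  have "\<exists>B. B \<in> sets borel \<and> L j \<subseteq> B \<and> emeasure lam B < \<infinity> \<and>
    {p. fst p + snd p \<in> B} \<in> sets (borel \<Otimes>\<^sub>M borel)" for j
    by (rule finite_measure_sandwich[OF L(1)[of j]]) blast
  then have "\<exists>B. \<forall>j. B j \<in> sets borel \<and> L j \<subseteq> B j \<and> emeasure lam (B j) < \<infinity> \<and>
      {p. fst p + snd p \<in> B j} \<in> sets (borel \<Otimes>\<^sub>M borel)"
    by (intro choice allI)
  then obtain B where B: "\<forall>j. B j \<in> sets borel \<and> L j \<subseteq> B j \<and> emeasure lam (B j) < \<infinity> \<and>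
      {p. fst p + snd p \<in> B j} \<in> sets (borel \<Otimes>\<^sub>M borel)"
    by (rule exE)
  have B_borel [measurable]: "B j \<in> sets borel" and LB: "L j \<subseteq> B j"
    and fin: "emeasure lam (B j) < \<infinity>"
    and add_B: "{p. fst p + snd p \<in> B j} \<in> sets (borel \<Otimes>\<^sub>M borel)" for j
    using spec[OF B, of j] by auto
  have [measurable]: "Measurable.pred (borel \<Otimes>\<^sub>M borel) (\<lambda>p. fst p + snd p \<in> B j)" for j
    using add_B[of j] by (simp add: pred_def space_pair_measure)
  \<comment> \<open>The factor \<open>c j\<close> bounds the integral of the \<open>j\<close>-th
    term by \<open>(1/2) ^ j\<close>; the summand 1 guards against a null set
    \<open>B j\<close>.\<close>
  define c where "c j = ennreal ((1/2) ^ j) / (1 + emeasure lam (B j))" for j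
  have c0: "0 < c j" for j
    using fin[of j] by (auto simp: c_def ennreal_zero_less_divide ennreal_add_eq_top)
  have c1: "c j * emeasure lam (B j) \<le> ennreal ((1/2) ^ j)" for j
  proof -
    have "c j * emeasure lam (B j) \<le> c j * (1 + emeasure lam (B j))"
      by (intro mult_left_mono) auto
    also have "\<dots> = ennreal ((1/2) ^ j)"
      using fin[of j] unfolding c_def
      by (subst mult.commute, subst ennreal_times_divide, subst mult.commute)
        (auto intro!: ennreal_mult_divide_eq simp: ennreal_add_eq_top)
    finally show ?thesis .
  qed
  define k where "k s = (\<Sum>j. c j * indicator (B j) s)" for s
  show ?thesis
  proof (rule that[of k])
    show "k \<in> borel_measurable borel" unfolding k_def by measurable
    show "(\<lambda>p. k (fst p + snd p)) \<in> borel_measurable (borel \<Otimes>\<^sub>M borel)"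
      unfolding k_def by measurable
    show "0 < k s" for s
    proof -
      obtain j where "s \<in> B j" using L(2) LB by blast
      then have "c j \<le> (\<Sum>i\<in>{j}. c i * indicator (B i) s)" by simp
      also have "\<dots> \<le> k s" unfolding k_def by (intro sum_le_suminf) auto
      finally show ?thesis using c0 less_le_trans by blast
    qed
    have "(\<integral>\<^sup>+s. k s \<partial>lam) = (\<Sum>j. c j * emeasure lam (B j))"
      unfolding k_def by (subst nn_integral_suminf) (auto simp: nn_integral_cmult)
    also have "\<dots> \<le> (\<Sum>j. ennreal ((1/2) ^ j))" by (intro suminf_le c1) auto
    also have "\<dots> = ennreal (\<Sum>j. (1/2) ^ j)"
      by (intro suminf_ennreal2) (auto intro: summable_geometric)
    finally show "(\<integral>\<^sup>+s. k s \<partial>lam) < \<infinity>" by (rule le_less_trans) simp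
  qed
qed

end

subsection \<open>The part of the tail measure where the process does not vanish at the origin\<close>

text \<open>The spectral measure \<open>Q'\<close> is a parameter. It turns out to be the law of the
  normalized process under \<open>Q\<close>, so fixing it involves no choice.\<close>

locale tail_spectral = tail_setting lam F scal nrm x0
  for lam :: "'g::{topological_ab_group_add, t2_space} measure"
    and F :: "('g \<Rightarrow> 'h::polish_space) measure"
    and scal :: "real \<Rightarrow> 'h \<Rightarrow> 'h"
    and nrm :: "'h \<Rightarrow> real"
    and x0 :: 'h +
  fixes \<alpha> :: real
    and Q Q' :: "('g \<Rightarrow> 'h) measure"
  assumes alpha: "0 < \<alpha>"
    and prob_Q: "prob_space Q"
    and sets_Q [measurable_cong, simp]: "sets Q = sets F"
    and prob_Q': "prob_space Q'"
    and sets_Q' [measurable_cong, simp]: "sets Q' = sets F"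
    and Q'_one: "emeasure Q' {\<omega> \<in> space F. nrm (\<omega> 0) = 1} = 1"
    and Q_decomp: "\<And>A. A \<in> sets F \<Longrightarrow> emeasure Q A =
      (\<integral>\<^sup>+\<omega>. (\<integral>\<^sup>+u\<in>{1<..}. indicator A (scale scal u \<omega>) * ennreal (\<alpha> * u powr (- \<alpha> - 1)) \<partial>lborel) \<partial>Q')"
    and nonzero: "emeasure Q {\<omega> \<in> space F. 0 < emeasure (xi' lam nrm \<omega>) UNIV} = 1"
    and mass_stat: "mass_stationary lam F nrm Q"
begin

sublocale haar: sigma_finite_haar lam
  using sigma_finite locally_compact haar
  by (simp add: sigma_finite_haar_def sigma_finite_haar_axioms_def)

sublocale Q: prob_space Q by (rule prob_Q)
sublocale Q': prob_space Q' by (rule prob_Q')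

lemma space_Q [simp]: "space Q = space F" by (rule sets_eq_imp_space_eq) simp
lemma space_Q' [simp]: "space Q' = space F" by (rule sets_eq_imp_space_eq) simp

section \<open>Shifts, scalings and evaluations on the function space\<close>

definition nv :: "('g \<Rightarrow> 'h) \<Rightarrow> 'g \<Rightarrow> real" where
  "nv \<omega> s = nrm (\<omega> s)"

text \<open>A total and jointly measurable variant of \<open>scale\<close>.\<close>

definition sc :: "real \<Rightarrow> ('g \<Rightarrow> 'h) \<Rightarrow> 'g \<Rightarrow> 'h" where
  "sc u \<omega> = scale scal (if 0 < u then u else 1) \<omega>"

lemma sc_pos: "0 < u \<Longrightarrow> sc u \<omega> = scale scal u \<omega>"
  by (simp add: sc_def)

lemma sc_space [simp]: "\<omega> \<in> space F \<Longrightarrow> sc u \<omega> \<in> space F"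
  by (simp add: sc_def scale_closed)

lemma shift_space [simp]: "\<omega> \<in> space F \<Longrightarrow> shift s \<omega> \<in> space F"
  by (rule shift_closed)

lemma sc_sc: "0 < u \<Longrightarrow> 0 < v \<Longrightarrow> sc u (sc v \<omega>) = sc (u * v) \<omega>"
  by (simp add: sc_def scale_def scal_scal)

lemma sc_one [simp]: "sc 1 \<omega> = \<omega>"
  by (simp add: sc_def scale_def scal_one)

lemma shift_shift: "shift s (shift t \<omega>) = shift (s + t) \<omega>"
  by (simp add: shift_def add.assoc add.commute add.left_commute)

lemma shift_sc: "shift s (sc u \<omega>) = sc u (shift s \<omega>)"
  by (simp add: shift_def sc_def scale_def)

lemma nv_shift: "nv (shift t \<omega>) s = nv \<omega> (s + t)"
  by (simp add: nv_def shift_def)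

lemma nv_sc: "0 < u \<Longrightarrow> nv (sc u \<omega>) s = u * nv \<omega> s"
  by (simp add: nv_def sc_def scale_def nrm_scal)

lemma nv_nonneg [simp]: "0 \<le> nv \<omega> s"
  by (simp add: nv_def nrm_nonneg)

lemma measurable_shift [measurable (raw)]:
  assumes [measurable]: "f \<in> measurable M F" "g \<in> measurable M borel"
  shows "(\<lambda>x. shift (g x) (f x)) \<in> measurable M F"
proof -
  have "(\<lambda>x. fst ((\<lambda>(\<omega>, s). (shift s \<omega>, \<omega> 0)) (f x, g x))) \<in> measurable M F"
    by (rule measurable_compose[OF measurable_compose[OF _ shift_eval_measurable] measurable_fst])
      measurable
  then show ?thesis by simp
qed

text \<open>Evaluation at \<open>s\<close> is evaluation at 0 after the shift by \<open>s\<close>,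
  and the setting provides measurability of exactly these two operations.\<close>

lemma measurable_nv [measurable (raw)]:
  assumes [measurable]: "f \<in> measurable M F" "g \<in> measurable M borel"
  shows "(\<lambda>x. nv (f x) (g x)) \<in> borel_measurable M"
proof -
  have "(\<lambda>x. snd ((\<lambda>(\<omega>, s). (shift s \<omega>, \<omega> 0)) (shift (g x) (f x), 0::'g))) \<in> measurable M borel"
    by (rule measurable_compose[OF measurable_compose[OF _ shift_eval_measurable] measurable_snd])
      measurable
  then have "(\<lambda>x. f x (g x)) \<in> measurable M borel" by (simp add: shift_def)
  from measurable_compose[OF this nrm_measurable] show ?thesis by (simp add: nv_def)
qed

lemma measurable_sc [measurable (raw)]:
  assumes [measurable]: "f \<in> measurable M F" "g \<in> borel_measurable M"
  shows "(\<lambda>x. sc (g x) (f x)) \<in> measurable M F"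
proof -
  have "(\<lambda>x. if 0 < g x then g x else 1) \<in> measurable M (restrict_space borel {0<..})"
    by (rule measurable_restrict_space2) auto
  then have "(\<lambda>x. (\<lambda>(\<omega>, u). scale scal u \<omega>) (f x, if 0 < g x then g x else 1)) \<in> measurable M F"
    by (intro measurable_compose[OF _ scale_measurable] measurable_Pair assms)
  then show ?thesis by (simp add: sc_def)
qed

section \<open>The power measure on the positive half-line\<close>

definition rho :: "real measure" where
  "rho = density lborel (\<lambda>u. indicator {0<..} u * ennreal (\<alpha> * u powr (- \<alpha> - 1)))"

lemma sets_rho [measurable_cong, simp]: "sets rho = sets borel"
  by (simp add: rho_def)

lemma space_rho [simp]: "space rho = UNIV"
  by (simp add: rho_def)

lemma nn_integral_rho:
  assumes [measurable]: "f \<in> borel_measurable borel"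
  shows "(\<integral>\<^sup>+u. f u \<partial>rho) = (\<integral>\<^sup>+u\<in>{0<..}. f u * ennreal (\<alpha> * u powr (- \<alpha> - 1)) \<partial>lborel)"
  unfolding rho_def by (subst nn_integral_density) (auto intro!: nn_integral_cong simp: mult_ac)

lemma AE_rho: "AE u in rho. 0 < u"
  unfolding rho_def by (subst AE_density) (auto simp: indicator_def)

text \<open>Under the substitution \<open>v = c * u\<close> the Jacobian and the exponent
  \<open>- \<alpha> - 1\<close> combine to \<open>c powr \<alpha>\<close>. The scaling factors of
  \<open>m\<close> and of the constructed tail measure originate here.\<close>

lemma nn_integral_rho_scale:
  assumes [measurable]: "f \<in> borel_measurable borel" and c: "0 < c"
  shows "(\<integral>\<^sup>+u. f (c * u) \<partial>rho) = ennreal (c powr \<alpha>) * (\<integral>\<^sup>+u. f u \<partial>rho)"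
proof -
  define g where "g u = f u * ennreal (\<alpha> * u powr (- \<alpha> - 1)) * indicator {0<..} u" for u
  have [measurable]: "g \<in> borel_measurable borel" unfolding g_def by measurable
  have "ennreal (c powr \<alpha>) * (\<integral>\<^sup>+u. f u \<partial>rho) = ennreal (c powr \<alpha>) * (ennreal \<bar>c\<bar> * (\<integral>\<^sup>+u. g (0 + c * u) \<partial>lborel))"
    using c by (subst nn_integral_rho, simp, subst nn_integral_real_affine[symmetric])
      (auto simp: g_def[abs_def])
  also have "\<dots> = (\<integral>\<^sup>+u. ennreal (c powr \<alpha>) * (ennreal \<bar>c\<bar> * g (0 + c * u)) \<partial>lborel)"
    by (simp add: nn_integral_cmult)
  also have "\<dots> = (\<integral>\<^sup>+u\<in>{0<..}. f (c * u) * ennreal (\<alpha> * u powr (- \<alpha> - 1)) \<partial>lborel)"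
  proof (rule nn_integral_cong)
    fix u :: real
    show "ennreal (c powr \<alpha>) * (ennreal \<bar>c\<bar> * g (0 + c * u)) =
      f (c * u) * ennreal (\<alpha> * u powr (- \<alpha> - 1)) * indicator {0<..} u"
    proof (cases "0 < u")
      case True
      have "c powr \<alpha> * (c * (\<alpha> * (c * u) powr (- \<alpha> - 1))) = \<alpha> * u powr (- \<alpha> - 1)"
        using c True by (simp add: powr_mult powr_diff powr_minus field_simps)
      then have *: "ennreal (c powr \<alpha>) * (ennreal \<bar>c\<bar> * ennreal (\<alpha> * (c * u) powr (- \<alpha> - 1))) =
          ennreal (\<alpha> * u powr (- \<alpha> - 1))"
        using c alpha by (simp add: ennreal_mult[symmetric])
      have "ennreal (c powr \<alpha>) * (ennreal \<bar>c\<bar> * g (0 + c * u)) =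
          f (c * u) * (ennreal (c powr \<alpha>) * (ennreal \<bar>c\<bar> * ennreal (\<alpha> * (c * u) powr (- \<alpha> - 1))))"
        using c True by (simp add: g_def mult_ac)
      then show ?thesis using True by (simp add: *)
    qed (use c in \<open>simp add: g_def zero_less_mult_iff\<close>)
  qed
  also have "\<dots> = (\<integral>\<^sup>+u. f (c * u) \<partial>rho)" by (subst nn_integral_rho) auto
  finally show ?thesis ..
qed

lemma AE_Q'_one: "AE \<omega> in Q'. nv \<omega> 0 = 1"
proof (rule Q'.AE_I_eq_1)
  show "emeasure Q' {\<omega> \<in> space Q'. nv \<omega> 0 = 1} = 1" using Q'_one by (simp add: nv_def)
qed measurable

lemma AE_Q': "(\<And>\<omega>. \<omega> \<in> space F \<Longrightarrow> nv \<omega> 0 = 1 \<Longrightarrow> P \<omega>) \<Longrightarrow> AE \<omega> in Q'. P \<omega>"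
  using AE_Q'_one AE_space[of Q'] by eventually_elim simp

text \<open>The integral is not evaluated: the total mass 1 of \<open>Q\<close>, read through its
  decomposition, is the mass of \<open>{1<..}\<close> averaged over the probability measure
  \<open>Q'\<close>.\<close>

lemma emeasure_rho_greater_one: "emeasure rho {1<..} = 1"
proof -
  have "1 = emeasure Q (space F)" using Q.emeasure_space_1 by simp
  also have "\<dots> = (\<integral>\<^sup>+\<omega>. emeasure rho {1<..} \<partial>Q')"
    unfolding Q_decomp[OF sets.top]
  proof (intro nn_integral_cong)
    fix \<omega> assume "\<omega> \<in> space Q'"
    then have "(\<integral>\<^sup>+u\<in>{1<..}. indicator (space F) (scale scal u \<omega>) * ennreal (\<alpha> * u powr (- \<alpha> - 1)) \<partial>lborel) =
       (\<integral>\<^sup>+u\<in>{0<..}. indicator {1<..} u * ennreal (\<alpha> * u powr (- \<alpha> - 1)) \<partial>lborel)"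
      by (intro nn_integral_cong) (auto simp: indicator_def scale_closed)
    then show "(\<integral>\<^sup>+u\<in>{1<..}. indicator (space F) (scale scal u \<omega>) * ennreal (\<alpha> * u powr (- \<alpha> - 1)) \<partial>lborel) =
       emeasure rho {1<..}"
      by (subst nn_integral_indicator[symmetric]) (auto simp: nn_integral_rho simp del: nn_integral_indicator)
  qed
  also have "\<dots> = emeasure rho {1<..}" by (simp add: Q'.emeasure_space_1[simplified])
  finally show ?thesis ..
qed

lemma sigma_finite_rho: "sigma_finite_measure rho"
  unfolding rho_def
  by (subst sigma_finite_measure.sigma_finite_iff_density_finite'[OF sigma_finite_lborel]) (auto simp: ennreal_mult_less_top less_top[symmetric] ennreal_mult_eq_top_iff split: split_indicator)

sublocale rho: sigma_finite_measure rho by (rule sigma_finite_rho)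

text \<open>The measure which any tail measure with Palm measure \<open>Q\<close> must induce on \<open>{0 < nrm (\<omega> 0)}\<close>.\<close>

definition m :: "('g \<Rightarrow> 'h) measure" where
  "m = distr (Q' \<Otimes>\<^sub>M rho) F (\<lambda>p. sc (snd p) (fst p))"

lemma sets_m [measurable_cong, simp]: "sets m = sets F"
  by (simp add: m_def)

lemma space_m [simp]: "space m = space F"
  by (simp add: m_def)

lemma nn_integral_m:
  assumes [measurable]: "f \<in> borel_measurable F"
  shows "(\<integral>\<^sup>+\<omega>. f \<omega> \<partial>m) = (\<integral>\<^sup>+\<omega>. (\<integral>\<^sup>+u. f (sc u \<omega>) \<partial>rho) \<partial>Q')"
  unfolding m_def by (simp add: nn_integral_distr rho.nn_integral_fst[symmetric])

lemma nn_integral_m_sc: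
  assumes [measurable]: "f \<in> borel_measurable F" and c: "0 < c"
  shows "(\<integral>\<^sup>+\<omega>. f (sc c \<omega>) \<partial>m) = ennreal (c powr \<alpha>) * (\<integral>\<^sup>+\<omega>. f \<omega> \<partial>m)"
proof -
  have "(\<integral>\<^sup>+\<omega>. f (sc c \<omega>) \<partial>m) = (\<integral>\<^sup>+\<omega>. (\<integral>\<^sup>+u. f (sc c (sc u \<omega>)) \<partial>rho) \<partial>Q')"
    by (rule nn_integral_m) measurable
  also have "\<dots> = (\<integral>\<^sup>+\<omega>. ennreal (c powr \<alpha>) * (\<integral>\<^sup>+u. f (sc u \<omega>) \<partial>rho) \<partial>Q')"
  proof (rule nn_integral_cong)
    fix \<omega> assume "\<omega> \<in> space Q'"
    then have [measurable]: "\<omega> \<in> space F" by simp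
    have "(\<integral>\<^sup>+u. f (sc c (sc u \<omega>)) \<partial>rho) = (\<integral>\<^sup>+u. f (sc (c * u) \<omega>) \<partial>rho)"
      using AE_rho by (intro nn_integral_cong_AE, eventually_elim) (simp add: sc_sc c)
    also have "\<dots> = ennreal (c powr \<alpha>) * (\<integral>\<^sup>+u. f (sc u \<omega>) \<partial>rho)"
      by (rule nn_integral_rho_scale[OF _ c]) measurable
    finally show "(\<integral>\<^sup>+u. f (sc c (sc u \<omega>)) \<partial>rho) = ennreal (c powr \<alpha>) * (\<integral>\<^sup>+u. f (sc u \<omega>) \<partial>rho)" .
  qed
  also have "\<dots> = ennreal (c powr \<alpha>) * (\<integral>\<^sup>+\<omega>. f \<omega> \<partial>m)"
    by (simp add: nn_integral_cmult nn_integral_m)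
  finally show ?thesis .
qed

text \<open>Under \<open>Q'\<close> the modulus at 0 is 1, so after multiplication by
  \<open>u\<close> it is \<open>u\<close>, and the restriction \<open>1 < u\<close> becomes an event
  of the path.\<close>

lemma Q_eq_density: "Q = density m (\<lambda>\<omega>. indicator {1<..} (nv \<omega> 0))"
proof (rule measure_eqI)
  fix A assume "A \<in> sets Q"
  then have [measurable]: "A \<in> sets F" by simp
  have "emeasure Q A = (\<integral>\<^sup>+\<omega>. (\<integral>\<^sup>+u. indicator {1<..} (nv (sc u \<omega>) 0) * indicator A (sc u \<omega>) \<partial>rho) \<partial>Q')"
    unfolding Q_decomp[OF \<open>A \<in> sets F\<close>]
  proof (rule nn_integral_cong_AE, rule AE_Q')
    fix \<omega> assume [measurable]: "\<omega> \<in> space F" and 1: "nv \<omega> 0 = 1"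
    have "(\<integral>\<^sup>+u. indicator {1<..} (nv (sc u \<omega>) 0) * indicator A (sc u \<omega>) \<partial>rho) =
       (\<integral>\<^sup>+u\<in>{0<..}. (indicator {1<..} (nv (sc u \<omega>) 0) * indicator A (sc u \<omega>)) * ennreal (\<alpha> * u powr (- \<alpha> - 1)) \<partial>lborel)"
      by (rule nn_integral_rho) measurable
    also have "\<dots> = (\<integral>\<^sup>+u\<in>{1<..}. indicator A (scale scal u \<omega>) * ennreal (\<alpha> * u powr (- \<alpha> - 1)) \<partial>lborel)"
      using 1 by (intro nn_integral_cong) (auto simp: indicator_def nv_sc sc_pos[symmetric])
    finally show "(\<integral>\<^sup>+u\<in>{1<..}. indicator A (scale scal u \<omega>) * ennreal (\<alpha> * u powr (- \<alpha> - 1)) \<partial>lborel) =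
      (\<integral>\<^sup>+u. indicator {1<..} (nv (sc u \<omega>) 0) * indicator A (sc u \<omega>) \<partial>rho)" ..
  qed
  also have "\<dots> = (\<integral>\<^sup>+\<omega>. indicator {1<..} (nv \<omega> 0) * indicator A \<omega> \<partial>m)"
    by (rule nn_integral_m[symmetric]) measurable
  also have "\<dots> = emeasure (density m (\<lambda>\<omega>. indicator {1<..} (nv \<omega> 0))) A"
    by (rule emeasure_density[symmetric]) measurable
  finally show "emeasure Q A = emeasure (density m (\<lambda>\<omega>. indicator {1<..} (nv \<omega> 0))) A" .
qed simp

lemma nn_integral_Q:
  assumes [measurable]: "f \<in> borel_measurable F"
  shows "(\<integral>\<^sup>+\<omega>. f \<omega> \<partial>Q) = (\<integral>\<^sup>+\<omega>. indicator {1<..} (nv \<omega> 0) * f \<omega> \<partial>m)"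
  by (subst Q_eq_density) (simp add: nn_integral_density)

lemma AE_m:
  assumes [measurable]: "Measurable.pred F P"
    and "AE \<omega> in Q'. AE u in rho. P (sc u \<omega>)"
  shows "AE \<omega> in m. P \<omega>"
proof -
  have "(\<integral>\<^sup>+\<omega>. (\<integral>\<^sup>+u. indicator {\<omega> \<in> space F. \<not> P \<omega>} (sc u \<omega>) \<partial>rho) \<partial>Q') = (\<integral>\<^sup>+\<omega>. 0 \<partial>Q')"
  proof (rule nn_integral_cong_AE)
    show "AE \<omega> in Q'. (\<integral>\<^sup>+u. indicator {\<omega> \<in> space F. \<not> P \<omega>} (sc u \<omega>) \<partial>rho) = 0"
      using assms(2) AE_space[of Q']
    proof eventually_elim
      case (elim \<omega>)
      have "(\<integral>\<^sup>+u. indicator {\<omega> \<in> space F. \<not> P \<omega>} (sc u \<omega>) \<partial>rho) = (\<integral>\<^sup>+u. 0 \<partial>rho)"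
        using elim(1) by (intro nn_integral_cong_AE, eventually_elim) simp
      then show ?case by simp
    qed
  qed
  then have "(\<integral>\<^sup>+\<omega>. indicator {\<omega> \<in> space F. \<not> P \<omega>} \<omega> \<partial>m) = 0"
    by (subst nn_integral_m) auto
  then have "emeasure m {\<omega> \<in> space F. \<not> P \<omega>} = 0" by simp
  then show ?thesis
    by (intro AE_I[of _ _ "{\<omega> \<in> space F. \<not> P \<omega>}"]) auto
qed

lemma AE_m_pos: "AE \<omega> in m. 0 < nv \<omega> 0"
proof (rule AE_m, measurable, rule AE_Q')
  fix \<omega> assume "nv \<omega> 0 = 1"
  show "AE u in rho. 0 < nv (sc u \<omega>) 0"
    using AE_rho by eventually_elim (simp add: nv_sc \<open>nv \<omega> 0 = 1\<close>)
qed

text \<open>Multiplication by \<open>1 / r\<close> reduces to level 1, where the mass is that of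
  \<open>Q\<close>. Finiteness at all positive levels makes \<open>m\<close> sigma-finite.\<close>

lemma emeasure_m_greater:
  assumes "0 < r"
  shows "emeasure m {\<omega> \<in> space F. r < nv \<omega> 0} = ennreal (r powr - \<alpha>)"
proof -
  have 1: "(\<integral>\<^sup>+\<omega>. indicator {1<..} (nv \<omega> 0) \<partial>m) = 1"
    using nn_integral_Q[of "\<lambda>_. 1"] Q.emeasure_space_1 by simp
  have "emeasure m {\<omega> \<in> space F. r < nv \<omega> 0} = (\<integral>\<^sup>+\<omega>. indicator {1<..} (nv (sc (inverse r) \<omega>) 0) \<partial>m)"
    using assms by (subst nn_integral_indicator[symmetric])
      (auto intro!: nn_integral_cong simp: nv_sc indicator_def field_simps simp del: nn_integral_indicator)
  also have "\<dots> = ennreal (inverse r powr \<alpha>) * 1"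
    using assms by (subst nn_integral_m_sc[of "\<lambda>\<omega>. indicator {1<..} (nv \<omega> 0)"]) (auto simp: 1)
  finally show ?thesis using assms by (simp add: powr_minus inverse_powr)
qed

lemma sigma_finite_m: "sigma_finite_measure m"
proof
  define A where "A n = {\<omega> \<in> space F. inverse (real (Suc n)) < nv \<omega> 0}" for n
  define Z where "Z = {\<omega> \<in> space F. \<not> 0 < nv \<omega> 0}"
  have [measurable]: "A n \<in> sets F" "Z \<in> sets F" for n by (simp_all add: A_def Z_def)
  have "emeasure m (A n) \<noteq> \<infinity>" for n
    unfolding A_def by (subst emeasure_m_greater) auto
  moreover have "emeasure m Z = 0"
    using AE_m_pos AE_iff_measurable[of Z m "\<lambda>\<omega>. 0 < nv \<omega> 0"] by (auto simp: Z_def)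
  moreover have "\<omega> \<in> Z \<union> (\<Union>n. A n)" if "\<omega> \<in> space F" for \<omega>
    using that reals_Archimedean[of "nv \<omega> 0"] by (auto simp: A_def Z_def)
  then have "\<Union> (insert Z (range A)) = space m" by (auto simp: A_def Z_def)
  ultimately show "\<exists>C. countable C \<and> C \<subseteq> sets m \<and> \<Union>C = space m \<and> (\<forall>a\<in>C. emeasure m a \<noteq> \<infinity>)"
    by (intro exI[of _ "insert Z (range A)"]) auto
qed

sublocale m: sigma_finite_measure m by (rule sigma_finite_m)


section \<open>Mass transport at positive levels and in the limit\<close>

lemma nn_integral_xi:
  assumes [measurable]: "\<omega> \<in> space F" "f \<in> borel_measurable borel"
  shows "(\<integral>\<^sup>+s. f s \<partial>xi lam nrm \<omega>) = (\<integral>\<^sup>+s. indicator {1<..} (nv \<omega> s) * f s \<partial>lam)"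
proof -
  have *: "indicator {s. 1 < nrm (\<omega> s)} = (\<lambda>s. indicator {1<..} (nv \<omega> s) :: ennreal)"
    by (auto simp: indicator_def nv_def)
  show ?thesis unfolding xi_def * by (rule nn_integral_density) measurable
qed

text \<open>Reading \<open>Q\<close> as a restriction of \<open>m\<close> and \<open>xi\<close> as a
  restriction of \<open>lam\<close> gives mass-stationarity two indicators of the same kind, at 0
  and at \<open>s\<close>. In this form it can be rescaled to other levels.\<close>

lemma mass_transport_unit_level:
  assumes [measurable]: "g \<in> borel_measurable (F \<Otimes>\<^sub>M borel)"
  shows "(\<integral>\<^sup>+\<omega>. (\<integral>\<^sup>+s. indicator {1<..} (nv \<omega> 0) * (indicator {1<..} (nv \<omega> s) * g (shift s \<omega>, - s)) \<partial>lam) \<partial>m) =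
    (\<integral>\<^sup>+\<omega>. (\<integral>\<^sup>+s. indicator {1<..} (nv \<omega> 0) * (indicator {1<..} (nv \<omega> s) * g (\<omega>, s)) \<partial>lam) \<partial>m)"
    (is "?L = ?R")
proof -
  have "?L = (\<integral>\<^sup>+\<omega>. (\<integral>\<^sup>+s. indicator {1<..} (nv \<omega> s) * g (shift s \<omega>, - s) \<partial>lam) \<partial>Q)"
    by (subst nn_integral_Q, measurable) (auto intro!: nn_integral_cong nn_integral_cmult)
  also have "\<dots> = (\<integral>\<^sup>+\<omega>. (\<integral>\<^sup>+s. g (shift s \<omega>, - s) \<partial>xi lam nrm \<omega>) \<partial>Q)"
    by (intro nn_integral_cong, subst nn_integral_xi) auto
  also have "\<dots> = (\<integral>\<^sup>+\<omega>. (\<integral>\<^sup>+s. g (\<omega>, s) \<partial>xi lam nrm \<omega>) \<partial>Q)"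
    using mass_stat assms unfolding mass_stationary_def by blast
  also have "\<dots> = (\<integral>\<^sup>+\<omega>. (\<integral>\<^sup>+s. indicator {1<..} (nv \<omega> s) * g (\<omega>, s) \<partial>lam) \<partial>Q)"
    by (intro nn_integral_cong, subst nn_integral_xi) auto
  also have "\<dots> = ?R"
    by (subst nn_integral_Q, measurable) (auto intro!: nn_integral_cong nn_integral_cmult[symmetric])
  finally show ?thesis .
qed

text \<open>The map \<open>sc r\<close> carries level 1 to level \<open>r\<close> and multiplies
  both sides by the same factor \<open>r powr \<alpha>\<close>; at level 1 mass transport is applied
  to \<open>g (sc r \<omega>, s)\<close>.\<close>

lemma mass_transport_level:
  assumes [measurable]: "g \<in> borel_measurable (F \<Otimes>\<^sub>M borel)" and r: "0 < r"
  shows "(\<integral>\<^sup>+\<omega>. (\<integral>\<^sup>+s. indicator {r<..} (nv \<omega> 0) * (indicator {r<..} (nv \<omega> s) * g (shift s \<omega>, - s)) \<partial>lam) \<partial>m) =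
    (\<integral>\<^sup>+\<omega>. (\<integral>\<^sup>+s. indicator {r<..} (nv \<omega> 0) * (indicator {r<..} (nv \<omega> s) * g (\<omega>, s)) \<partial>lam) \<partial>m)"
    (is "?L = ?R")
proof -
  have ind: "indicator {r<..} (nv (sc r \<omega>) s) = (indicator {1<..} (nv \<omega> s) :: ennreal)" for \<omega> s
    using r by (simp add: nv_sc indicator_def)
  have "ennreal (r powr \<alpha>) * ?L =
    (\<integral>\<^sup>+\<omega>. (\<integral>\<^sup>+s. indicator {r<..} (nv (sc r \<omega>) 0) * (indicator {r<..} (nv (sc r \<omega>) s) * g (shift s (sc r \<omega>), - s)) \<partial>lam) \<partial>m)"
    by (rule nn_integral_m_sc[OF _ r, symmetric]) measurable
  also have "\<dots> = (\<integral>\<^sup>+\<omega>. (\<integral>\<^sup>+s. indicator {r<..} (nv (sc r \<omega>) 0) * (indicator {r<..} (nv (sc r \<omega>) s) * g (sc r \<omega>, s)) \<partial>lam) \<partial>m)"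
    using mass_transport_unit_level[of "\<lambda>(\<omega>, s). g (sc r \<omega>, s)"] by (simp add: ind shift_sc)
  also have "\<dots> = ennreal (r powr \<alpha>) * ?R"
    by (rule nn_integral_m_sc[OF _ r]) measurable
  finally show ?thesis using r by (auto simp: ennreal_mult_cancel_left)
qed

lemma indicator_greater_mono: "r \<le> r' \<Longrightarrow> indicator {r'<..} a \<le> (indicator {r<..} (a::real) :: ennreal)"
  by (auto simp: indicator_def)

lemma SUP_indicator_greater:
  fixes a b :: real and c :: ennreal
  shows "(SUP n. indicator {inverse (real (Suc n))<..} a * (indicator {inverse (real (Suc n))<..} b * c)) =
    indicator {0<..} a * (indicator {0<..} b * c)" (is "(SUP n. ?f n) = ?g")
proof (rule antisym)
  show "(SUP n. ?f n) \<le> ?g"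
    by (intro SUP_least mult_mono indicator_greater_mono order_refl) simp_all
  show "?g \<le> (SUP n. ?f n)"
  proof (cases "0 < a \<and> 0 < b")
    case True
    then obtain n where "inverse (real (Suc n)) < min a b" using reals_Archimedean[of "min a b"] by auto
    then show ?thesis using True by (intro SUP_upper2[of n]) auto
  qed (auto simp: indicator_def)
qed

text \<open>Monotone convergence on the product space. The indicator at 0 disappears in the limit
  because \<open>m\<close> has no mass where the modulus at 0 is 0.\<close>

lemma nn_integral_level_SUP:
  assumes [measurable]: "f \<in> borel_measurable (F \<Otimes>\<^sub>M borel)"
  shows "(SUP n. \<integral>\<^sup>+\<omega>. (\<integral>\<^sup>+s. indicator {inverse (real (Suc n))<..} (nv \<omega> 0) *
      (indicator {inverse (real (Suc n))<..} (nv \<omega> s) * f (\<omega>, s)) \<partial>lam) \<partial>m) =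
    (\<integral>\<^sup>+\<omega>. (\<integral>\<^sup>+s. indicator {0<..} (nv \<omega> s) * f (\<omega>, s) \<partial>lam) \<partial>m)"
proof -
  let ?h = "\<lambda>n p. indicator {inverse (real (Suc n))<..} (nv (fst p) 0) *
      (indicator {inverse (real (Suc n))<..} (nv (fst p) (snd p)) * f p)"
  have "inverse (real (Suc (Suc n))) \<le> inverse (real (Suc n))" for n by simp
  then have "incseq ?h"
    by (intro incseq_SucI le_funI mult_mono indicator_greater_mono order_refl) simp_all
  have "(SUP n. \<integral>\<^sup>+\<omega>. (\<integral>\<^sup>+s. indicator {inverse (real (Suc n))<..} (nv \<omega> 0) *
      (indicator {inverse (real (Suc n))<..} (nv \<omega> s) * f (\<omega>, s)) \<partial>lam) \<partial>m) =
    (SUP n. \<integral>\<^sup>+p. ?h n p \<partial>(m \<Otimes>\<^sub>M lam))"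
    by (subst haar.nn_integral_fst[symmetric]) simp_all
  also have "\<dots> = (\<integral>\<^sup>+p. (SUP n. ?h n p) \<partial>(m \<Otimes>\<^sub>M lam))"
    by (rule nn_integral_monotone_convergence_SUP[symmetric, OF \<open>incseq ?h\<close>]) measurable
  also have "\<dots> = (\<integral>\<^sup>+p. indicator {0<..} (nv (fst p) 0) * (indicator {0<..} (nv (fst p) (snd p)) * f p) \<partial>(m \<Otimes>\<^sub>M lam))"
    by (simp only: SUP_indicator_greater)
  also have "\<dots> = (\<integral>\<^sup>+\<omega>. (\<integral>\<^sup>+s. indicator {0<..} (nv \<omega> 0) * (indicator {0<..} (nv \<omega> s) * f (\<omega>, s)) \<partial>lam) \<partial>m)"
    by (subst haar.nn_integral_fst[symmetric]) simp_all
  also have "\<dots> = (\<integral>\<^sup>+\<omega>. (\<integral>\<^sup>+s. indicator {0<..} (nv \<omega> s) * f (\<omega>, s) \<partial>lam) \<partial>m)"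
    using AE_m_pos by (intro nn_integral_cong_AE, eventually_elim) simp
  finally show ?thesis .
qed

lemma mass_transport:
  assumes [measurable]: "g \<in> borel_measurable (F \<Otimes>\<^sub>M borel)"
  shows "(\<integral>\<^sup>+\<omega>. (\<integral>\<^sup>+s. indicator {0<..} (nv \<omega> s) * g (shift s \<omega>, - s) \<partial>lam) \<partial>m) =
    (\<integral>\<^sup>+\<omega>. (\<integral>\<^sup>+s. indicator {0<..} (nv \<omega> s) * g (\<omega>, s) \<partial>lam) \<partial>m)"
proof -
  have "inverse (real (Suc n)) > 0" for n by simp
  from mass_transport_level[OF assms this]
  have "(SUP n. \<integral>\<^sup>+\<omega>. (\<integral>\<^sup>+s. indicator {inverse (real (Suc n))<..} (nv \<omega> 0) *
      (indicator {inverse (real (Suc n))<..} (nv \<omega> s) * g (shift s \<omega>, - s)) \<partial>lam) \<partial>m) =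
    (SUP n. \<integral>\<^sup>+\<omega>. (\<integral>\<^sup>+s. indicator {inverse (real (Suc n))<..} (nv \<omega> 0) *
      (indicator {inverse (real (Suc n))<..} (nv \<omega> s) * g (\<omega>, s)) \<partial>lam) \<partial>m)"
    by (rule SUP_cong[OF refl])
  then show ?thesis
    using nn_integral_level_SUP[of "\<lambda>(\<omega>, s). g (shift s \<omega>, - s)"] nn_integral_level_SUP[of g] by simp
qed

section \<open>The normalized process and its law\<close>

definition normalize :: "('g \<Rightarrow> 'h) \<Rightarrow> 'g \<Rightarrow> 'h" where
  "normalize \<omega> = sc (inverse (nv \<omega> 0)) \<omega>"

text \<open>\<open>normalize\<close> replaces \<open>W\<close> because the constant path
  \<open>x0\<close> can lie outside the function space. Where the modulus at 0 vanishes,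
  \<open>inverse 0 = 0\<close> is read by \<open>sc\<close> as the factor 1, so
  \<open>normalize\<close> returns the path itself.\<close>

lemma Wproc_eq: "0 < nv \<omega> 0 \<Longrightarrow> Wproc scal nrm x0 \<omega> = normalize \<omega>"
  by (simp add: Wproc_def normalize_def sc_pos scale_def nv_def)

lemma measurable_normalize [measurable]: "normalize \<in> measurable F F"
  unfolding normalize_def[abs_def] by measurable

text \<open>Normalizing undoes the multiplication by \<open>u\<close>, and the remaining integral
  over \<open>1 < u\<close> has mass 1.\<close>

lemma distr_normalize: "distr Q F normalize = Q'"
proof (rule measure_eqI)
  fix A assume "A \<in> sets (distr Q F normalize)"
  then have [measurable]: "A \<in> sets F" by simp
  have "emeasure (distr Q F normalize) A = (\<integral>\<^sup>+\<omega>. indicator A (normalize \<omega>) \<partial>Q)"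
    by (subst nn_integral_indicator[symmetric]) (simp_all add: nn_integral_distr del: nn_integral_indicator)
  also have "\<dots> = (\<integral>\<^sup>+\<omega>. (\<integral>\<^sup>+u. indicator {1<..} (nv (sc u \<omega>) 0) * indicator A (normalize (sc u \<omega>)) \<partial>rho) \<partial>Q')"
    by (subst nn_integral_Q, measurable, subst nn_integral_m) auto
  also have "\<dots> = (\<integral>\<^sup>+\<omega>. indicator A \<omega> \<partial>Q')"
  proof (rule nn_integral_cong_AE, rule AE_Q')
    fix \<omega> assume "\<omega> \<in> space F" and 1: "nv \<omega> 0 = 1"
    have "(\<integral>\<^sup>+u. indicator {1<..} (nv (sc u \<omega>) 0) * indicator A (normalize (sc u \<omega>)) \<partial>rho) =
        (\<integral>\<^sup>+u. indicator A \<omega> * indicator {1<..} u \<partial>rho)"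
      using AE_rho by (intro nn_integral_cong_AE, eventually_elim)
        (simp add: nv_sc 1 normalize_def sc_sc mult.commute)
    then show "(\<integral>\<^sup>+u. indicator {1<..} (nv (sc u \<omega>) 0) * indicator A (normalize (sc u \<omega>)) \<partial>rho) = indicator A \<omega>"
      by (simp add: nn_integral_cmult_indicator emeasure_rho_greater_one)
  qed
  finally show "emeasure (distr Q F normalize) A = emeasure Q' A" by simp
qed simp

lemma nn_integral_normalize:
  assumes [measurable]: "f \<in> borel_measurable F"
  shows "(\<integral>\<^sup>+\<omega>. f (normalize \<omega>) \<partial>Q) = (\<integral>\<^sup>+\<omega>. f \<omega> \<partial>Q')"
  unfolding distr_normalize[symmetric] by (simp add: nn_integral_distr)

lemma AE_normalize:
  assumes [measurable]: "Measurable.pred F P"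
  shows "(AE \<omega> in Q. P (normalize \<omega>)) \<longleftrightarrow> (AE \<omega> in Q'. P \<omega>)"
proof -
  have "{\<omega> \<in> space F. P \<omega>} \<in> sets F" by measurable
  then show ?thesis unfolding distr_normalize[symmetric] by (subst AE_distr_iff) auto
qed

lemma AE_Q_pos: "AE \<omega> in Q. 0 < nv \<omega> 0"
  by (subst Q_eq_density, subst AE_density, measurable) (auto simp: indicator_def)

text \<open>As \<open>Wproc\<close> may leave the function space, the passage to \<open>Q'\<close>
  goes through \<open>normalize\<close>, which agrees with it \<open>Q\<close>-almost
  surely.\<close>

lemma nn_integral_Wproc:
  assumes "f \<in> borel_measurable F"
  shows "(\<integral>\<^sup>+\<omega>. f (Wproc scal nrm x0 \<omega>) \<partial>Q) = (\<integral>\<^sup>+\<omega>. f \<omega> \<partial>Q')"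
proof -
  have "(\<integral>\<^sup>+\<omega>. f (Wproc scal nrm x0 \<omega>) \<partial>Q) = (\<integral>\<^sup>+\<omega>. f (normalize \<omega>) \<partial>Q)"
    using AE_Q_pos by (intro nn_integral_cong_AE, eventually_elim) (simp add: Wproc_eq)
  then show ?thesis by (simp add: nn_integral_normalize assms)
qed

lemma AE_Wproc:
  assumes "Measurable.pred F P"
  shows "(AE \<omega> in Q. P (Wproc scal nrm x0 \<omega>)) \<longleftrightarrow> (AE \<omega> in Q'. P \<omega>)"
proof -
  have "(AE \<omega> in Q. P (Wproc scal nrm x0 \<omega>)) \<longleftrightarrow> (AE \<omega> in Q. P (normalize \<omega>))"
  proof
    assume "AE \<omega> in Q. P (Wproc scal nrm x0 \<omega>)"
    with AE_Q_pos show "AE \<omega> in Q. P (normalize \<omega>)" by eventually_elim (simp add: Wproc_eq)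
  next
    assume "AE \<omega> in Q. P (normalize \<omega>)"
    with AE_Q_pos show "AE \<omega> in Q. P (Wproc scal nrm x0 \<omega>)" by eventually_elim (simp add: Wproc_eq)
  qed
  then show ?thesis by (simp add: AE_normalize assms)
qed

end

subsection \<open>Existence\<close>

lemma ennreal_inverse_self: "0 < d \<Longrightarrow> d < \<infinity> \<Longrightarrow> inverse d * d = (1::ennreal)"
  using ennreal_divide_self[of d] by (simp add: divide_ennreal_def mult.commute)

context tail_spectral
begin

definition full :: "('g \<Rightarrow> 'h) \<Rightarrow> bool" where
  "full \<omega> \<longleftrightarrow> 0 < (\<integral>\<^sup>+s. indicator {0<..} (nv \<omega> s) \<partial>lam)"

lemma measurable_full [measurable]: "Measurable.pred F full"
  unfolding full_def[abs_def] by measurable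

lemma emeasure_xi':
  assumes [measurable]: "\<omega> \<in> space F"
  shows "emeasure (xi' lam nrm \<omega>) UNIV = (\<integral>\<^sup>+s. indicator {0<..} (nv \<omega> s) \<partial>lam)"
proof -
  have *: "indicator {s. 0 < nrm (\<omega> s)} = (\<lambda>s. indicator {0<..} (nv \<omega> s) :: ennreal)"
    by (auto simp: indicator_def nv_def)
  have [measurable]: "(\<lambda>s. indicator {0<..} (nv \<omega> s) :: ennreal) \<in> borel_measurable lam" by measurable
  show ?thesis unfolding xi'_def * by (subst emeasure_density) auto
qed

lemma full_shift:
  assumes [measurable]: "\<omega> \<in> space F"
  shows "full (shift t \<omega>) \<longleftrightarrow> full \<omega>"
proof -
  have "(\<integral>\<^sup>+s. indicator {0<..} (nv \<omega> (s + t)) \<partial>lam) = (\<integral>\<^sup>+s. indicator {0<..} (nv \<omega> s) \<partial>lam)"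
    by (rule haar.nn_integral_add) measurable
  then show ?thesis by (simp add: full_def nv_shift)
qed

lemma full_sc: "0 < u \<Longrightarrow> full (sc u \<omega>) \<longleftrightarrow> full \<omega>"
  by (simp add: full_def nv_sc indicator_def zero_less_mult_iff)

lemma AE_Q_full: "AE \<omega> in Q. full \<omega>"
proof (rule Q.AE_I_eq_1)
  have "{\<omega> \<in> space F. full \<omega>} = {\<omega> \<in> space F. 0 < emeasure (xi' lam nrm \<omega>) UNIV}"
    by (auto simp: emeasure_xi' full_def)
  then show "emeasure Q {\<omega> \<in> space Q. full \<omega>} = 1" using nonzero by simp
qed measurable

lemma AE_Q'_full: "AE \<omega> in Q'. full \<omega>"
proof (subst AE_normalize[symmetric])
  show "AE \<omega> in Q. full (normalize \<omega>)"
    using AE_Q_full AE_Q_pos by eventually_elim (simp add: normalize_def full_sc)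
qed measurable

lemma AE_m_full: "AE \<omega> in m. full \<omega>"
proof (rule AE_m)
  show "AE \<omega> in Q'. AE u in rho. full (sc u \<omega>)"
    using AE_Q'_full
  proof eventually_elim
    case (elim \<omega>)
    show ?case using AE_rho by eventually_elim (simp add: full_sc elim)
  qed
qed measurable

section \<open>Weights on the group\<close>

definition weight :: "('g \<Rightarrow> ennreal) \<Rightarrow> bool" where
  "weight k \<longleftrightarrow> k \<in> borel_measurable borel \<and> (\<forall>s. 0 < k s) \<and> (\<integral>\<^sup>+s. k s \<partial>lam) < \<infinity>"

text \<open>The joint measurability serves the comparison of two weights, where group integrals are
  exchanged. Arguments in which \<open>k\<close> is evaluated at a single variable work with
  \<open>weight\<close> alone.\<close>

definition add_weight :: "('g \<Rightarrow> ennreal) \<Rightarrow> bool" where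
  "add_weight k \<longleftrightarrow> weight k \<and> (\<lambda>p. k (fst p + snd p)) \<in> borel_measurable (borel \<Otimes>\<^sub>M borel)"

lemma weight_measurable: "weight k \<Longrightarrow> k \<in> borel_measurable borel"
  by (simp add: weight_def)

lemma ex_add_weight: "\<exists>k. add_weight k"
  using haar.positive_integrable_add_measurable unfolding add_weight_def weight_def by metis

text \<open>A name for \<open>k (s + t)\<close> keeps it one function of two variables in
  measurability proofs; split into \<open>k\<close> and addition it would lead to the joint
  measurability of addition.\<close>

definition kadd :: "('g \<Rightarrow> ennreal) \<Rightarrow> 'g \<Rightarrow> 'g \<Rightarrow> ennreal" where
  "kadd k s t = k (s + t)"

lemma measurable_kadd:
  assumes k: "add_weight k" and [measurable]: "f \<in> measurable M borel" "g \<in> measurable M borel"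
  shows "(\<lambda>x. kadd k (f x) (g x)) \<in> borel_measurable M"
proof -
  have *: "(\<lambda>p. k (fst p + snd p)) \<in> borel_measurable (borel \<Otimes>\<^sub>M borel)"
    using k by (simp add: add_weight_def)
  have "(\<lambda>x. (f x, g x)) \<in> measurable M (borel \<Otimes>\<^sub>M borel)" by measurable
  from measurable_compose[OF this *] show ?thesis by (simp add: kadd_def)
qed

text \<open>Shifting the tail measure amounts to translating its weight, so the class of weights
  must be closed under translations.\<close>

lemma add_weight_translate:
  assumes k: "add_weight k"
  shows "add_weight (\<lambda>s. k (s + t))"
proof -
  have w: "weight k" using k by (simp add: add_weight_def)
  note [measurable] = weight_measurable[OF w]
  have "(\<lambda>p::'g \<times> 'g. kadd k (fst p) (snd p + t)) \<in> borel_measurable (borel \<Otimes>\<^sub>M borel)"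
    by (rule measurable_kadd[OF k]) measurable
  then show ?thesis
    using w haar.nn_integral_add[of k t] by (simp add: add_weight_def weight_def kadd_def add.assoc)
qed

definition pk :: "('g \<Rightarrow> ennreal) \<Rightarrow> ('g \<Rightarrow> 'h) \<Rightarrow> ennreal" where
  "pk k \<omega> = (\<integral>\<^sup>+s. k s * indicator {0<..} (nv \<omega> s) \<partial>lam)"

lemma measurable_pk:
  assumes "weight k" and [measurable]: "f \<in> measurable M F"
  shows "(\<lambda>x. pk k (f x)) \<in> borel_measurable M"
proof -
  note [measurable] = weight_measurable[OF assms(1)]
  show ?thesis unfolding pk_def by measurable
qed

lemma pk_pos:
  assumes k: "weight k" and [measurable]: "\<omega> \<in> space F" and "full \<omega>"
  shows "0 < pk k \<omega>"
proof (rule ccontr)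
  note [measurable] = weight_measurable[OF k]
  have "0 < k s" for s using k by (simp add: weight_def)
  then have k0: "k s \<noteq> 0" for s using less_numeral_extra(3) by metis
  assume "\<not> 0 < pk k \<omega>"
  then have "(\<integral>\<^sup>+s. k s * indicator {0<..} (nv \<omega> s) \<partial>lam) = 0" by (simp add: pk_def)
  then have "AE s in lam. k s * indicator {0<..} (nv \<omega> s) = 0"
    by (subst (asm) nn_integral_0_iff_AE) auto
  then have "AE s in lam. indicator {0<..} (nv \<omega> s) = (0::ennreal)" by (simp add: k0)
  then have "(\<integral>\<^sup>+s. indicator {0<..} (nv \<omega> s) \<partial>lam) = 0"
    by (subst nn_integral_0_iff_AE) auto
  then show False using assms(3) by (simp add: full_def)
qed

lemma pk_finite:
  assumes "weight k"
  shows "pk k \<omega> < \<infinity>"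
proof -
  have "pk k \<omega> \<le> (\<integral>\<^sup>+s. k s \<partial>lam)" unfolding pk_def
    by (intro nn_integral_mono) (auto simp: indicator_def)
  then show ?thesis using assms by (auto simp: weight_def intro: le_less_trans)
qed

lemma pk_sc: "0 < u \<Longrightarrow> pk k (sc u \<omega>) = pk k \<omega>"
  by (simp add: pk_def nv_sc indicator_def zero_less_mult_iff)

lemma pk_shift:
  assumes k: "weight k" and [measurable]: "\<omega> \<in> space F"
  shows "pk k (shift (- t) \<omega>) = pk (\<lambda>s. k (s + t)) \<omega>"
proof -
  note [measurable] = weight_measurable[OF k]
  have "(\<integral>\<^sup>+s. k (s + t) * indicator {0<..} (nv \<omega> (s + t + - t)) \<partial>lam) =
      (\<integral>\<^sup>+s. k s * indicator {0<..} (nv \<omega> (s + - t)) \<partial>lam)"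
    by (rule haar.nn_integral_add) measurable
  then show ?thesis by (simp add: pk_def nv_shift)
qed

section \<open>Integration against the candidate measure\<close>

definition nu_int :: "('g \<Rightarrow> ennreal) \<Rightarrow> (('g \<Rightarrow> 'h) \<Rightarrow> ennreal) \<Rightarrow> ennreal" where
  "nu_int k f = (\<integral>\<^sup>+\<omega>. (\<integral>\<^sup>+s. f (shift (- s) \<omega>) * (k s / pk k (shift (- s) \<omega>)) \<partial>lam) \<partial>m)"

text \<open>
  Inserting \<open>pk k' / pk k' = 1\<close> and expanding the numerator gives an expression which the mass
  transport formula turns into its mirror image with \<open>k\<close> and \<open>k'\<close> exchanged.
\<close>

lemma nu_int_symmetric_form:
  assumes k: "add_weight k" and k': "add_weight k'" and [measurable]: "f \<in> borel_measurable F"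
  shows "nu_int k f = (\<integral>\<^sup>+\<omega>. (\<integral>\<^sup>+q. indicator {0<..} (nv \<omega> q) *
    (\<integral>\<^sup>+s. f (shift (- s) \<omega>) * inverse (pk k (shift (- s) \<omega>)) * inverse (pk k' (shift (- s) \<omega>)) *
      (k s * kadd k' q s) \<partial>lam) \<partial>lam) \<partial>m)"
  unfolding nu_int_def
proof (rule nn_integral_cong_AE)
  have w: "weight k" "weight k'" using k k' by (auto simp: add_weight_def)
  note [measurable] = weight_measurable[OF w(1)] weight_measurable[OF w(2)]
  note [measurable (raw)] = measurable_kadd[OF k'] measurable_pk[OF w(1)] measurable_pk[OF w(2)]
  define H where "H \<omega> = f \<omega> * inverse (pk k \<omega>) * inverse (pk k' \<omega>)" for \<omega>
  have [measurable]: "H \<in> borel_measurable F" unfolding H_def by measurable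
  interpret L: pair_sigma_finite lam lam by unfold_locales
  show "AE \<omega> in m. (\<integral>\<^sup>+s. f (shift (- s) \<omega>) * (k s / pk k (shift (- s) \<omega>)) \<partial>lam) =
    (\<integral>\<^sup>+q. indicator {0<..} (nv \<omega> q) *
    (\<integral>\<^sup>+s. f (shift (- s) \<omega>) * inverse (pk k (shift (- s) \<omega>)) * inverse (pk k' (shift (- s) \<omega>)) *
      (k s * kadd k' q s) \<partial>lam) \<partial>lam)"
    using AE_m_full AE_space
  proof eventually_elim
    case (elim \<omega>)
    then have [measurable]: "\<omega> \<in> space F" by simp
    have "(\<integral>\<^sup>+s. f (shift (- s) \<omega>) * (k s / pk k (shift (- s) \<omega>)) \<partial>lam) =
      (\<integral>\<^sup>+s. (\<integral>\<^sup>+q. indicator {0<..} (nv \<omega> q) * (H (shift (- s) \<omega>) * (k s * kadd k' q s)) \<partial>lam) \<partial>lam)"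
    proof (rule nn_integral_cong)
      fix s
      let ?\<omega> = "shift (- s) \<omega>"
      have p: "0 < pk k' ?\<omega>" "pk k' ?\<omega> < \<infinity>"
        using pk_pos[OF w(2)] pk_finite[OF w(2)] elim by (auto simp: full_shift)
      have "(\<integral>\<^sup>+q. indicator {0<..} (nv \<omega> q) * (H ?\<omega> * (k s * kadd k' q s)) \<partial>lam) =
          (\<integral>\<^sup>+q. (H ?\<omega> * k s) * (k' (q + s) * indicator {0<..} (nv \<omega> q)) \<partial>lam)"
        by (simp add: kadd_def mult_ac)
      also have "\<dots> = (H ?\<omega> * k s) * (\<integral>\<^sup>+q. k' (q + s) * indicator {0<..} (nv \<omega> q) \<partial>lam)"
        by (rule nn_integral_cmult) measurable
      \<comment> \<open>The inserted numerator \<open>pk k'\<close> at the shifted path is an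
        integral which, by translation invariance, weights the unshifted path by
        \<open>k' (q + s)\<close>.\<close>
      also have "(\<integral>\<^sup>+q. k' (q + s) * indicator {0<..} (nv \<omega> q) \<partial>lam) = pk k' ?\<omega>"
        using elim(2) by (subst pk_shift[OF w(2)]) (simp_all add: pk_def)
      also have "(H ?\<omega> * k s) * pk k' ?\<omega> = f ?\<omega> * (k s * inverse (pk k ?\<omega>)) * (inverse (pk k' ?\<omega>) * pk k' ?\<omega>)"
        by (simp add: H_def mult_ac)
      also have "\<dots> = f ?\<omega> * (k s / pk k ?\<omega>)"
        by (subst ennreal_inverse_self[OF p]) (simp add: divide_ennreal_def)
      finally show "f ?\<omega> * (k s / pk k ?\<omega>) =
          (\<integral>\<^sup>+q. indicator {0<..} (nv \<omega> q) * (H ?\<omega> * (k s * kadd k' q s)) \<partial>lam)" ..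
    qed
    \<comment> \<open>The exchange needs \<open>k' (q + s)\<close> to be measurable for the product
      sigma-field in \<open>(q, s)\<close>.\<close>
    also have "\<dots> = (\<integral>\<^sup>+q. (\<integral>\<^sup>+s. indicator {0<..} (nv \<omega> q) * (H (shift (- s) \<omega>) * (k s * kadd k' q s)) \<partial>lam) \<partial>lam)"
      by (rule L.Fubini'[symmetric]) measurable
    also have "\<dots> = (\<integral>\<^sup>+q. indicator {0<..} (nv \<omega> q) * (\<integral>\<^sup>+s. H (shift (- s) \<omega>) * (k s * kadd k' q s) \<partial>lam) \<partial>lam)"
      by (intro nn_integral_cong nn_integral_cmult) measurable
    finally show ?case by (simp add: H_def)
  qed
qed

lemma nu_int_independent:
  assumes k: "add_weight k" and k': "add_weight k'" and [measurable]: "f \<in> borel_measurable F"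
  shows "nu_int k f = nu_int k' f"
proof -
  have w: "weight k" "weight k'" using k k' by (auto simp: add_weight_def)
  note [measurable] = weight_measurable[OF w(1)] weight_measurable[OF w(2)]
  note [measurable (raw)] = measurable_kadd[OF k] measurable_kadd[OF k'] measurable_pk[OF w(1)] measurable_pk[OF w(2)]
  define H where "H \<omega> = f \<omega> * inverse (pk k \<omega>) * inverse (pk k' \<omega>)" for \<omega>
  have [measurable]: "H \<in> borel_measurable F" unfolding H_def by measurable
  define g where "g = (\<lambda>(\<omega>, q). \<integral>\<^sup>+s. H (shift (- s) \<omega>) * (k s * kadd k' q s) \<partial>lam)"
  have [measurable]: "g \<in> borel_measurable (F \<Otimes>\<^sub>M borel)" unfolding g_def by measurable
  have "nu_int k f = (\<integral>\<^sup>+\<omega>. (\<integral>\<^sup>+q. indicator {0<..} (nv \<omega> q) * g (\<omega>, q) \<partial>lam) \<partial>m)"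
    by (subst nu_int_symmetric_form[OF k k']) (simp_all add: g_def H_def)
  also have "\<dots> = (\<integral>\<^sup>+\<omega>. (\<integral>\<^sup>+q. indicator {0<..} (nv \<omega> q) * g (shift q \<omega>, - q) \<partial>lam) \<partial>m)"
    by (rule mass_transport[symmetric]) measurable
  also have "\<dots> = (\<integral>\<^sup>+\<omega>. (\<integral>\<^sup>+q. indicator {0<..} (nv \<omega> q) *
      (\<integral>\<^sup>+s. H (shift (- s) \<omega>) * (k' s * kadd k q s) \<partial>lam) \<partial>lam) \<partial>m)"
  proof (intro nn_integral_cong arg_cong2[where f = "(*)"] refl)
    fix \<omega> q assume "\<omega> \<in> space m"
    then have [measurable]: "\<omega> \<in> space F" by simp
    \<comment> \<open>After mass transport the weights are \<open>k s * k' (s - q)\<close> and the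
      path is shifted by \<open>q - s\<close>. Replacing \<open>s\<close> by \<open>s + q\<close>
      restores the shift by \<open>- s\<close> and gives \<open>k (s + q) * k' s\<close>: the
      weights have exchanged roles.\<close>
    have "(\<integral>\<^sup>+s. H (shift (- (s + q) + q) \<omega>) * (k (s + q) * kadd k' (- q) (s + q)) \<partial>lam) =
        (\<integral>\<^sup>+s. H (shift (- s + q) \<omega>) * (k s * kadd k' (- q) s) \<partial>lam)"
    proof (rule haar.nn_integral_add)
      have "(\<lambda>s. H (shift (- s) (shift q \<omega>)) * (k s * kadd k' (- q) s)) \<in> borel_measurable borel"
        by measurable
      then show "(\<lambda>s. H (shift (- s + q) \<omega>) * (k s * kadd k' (- q) s)) \<in> borel_measurable borel"
        by (simp only: shift_shift)
    qed
    then show "g (shift q \<omega>, - q) = (\<integral>\<^sup>+s. H (shift (- s) \<omega>) * (k' s * kadd k q s) \<partial>lam)"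
      by (simp add: g_def shift_shift kadd_def mult_ac add.commute)
  qed
  also have "\<dots> = nu_int k' f"
    by (subst nu_int_symmetric_form[OF k' k]) (simp_all add: H_def mult_ac)
  finally show ?thesis .
qed

text \<open>A shift of the argument is absorbed by the substitution \<open>s + t\<close>, whose only
  effect is to translate \<open>k\<close>; independence of the weight removes the
  translation.\<close>

lemma nu_int_shift:
  assumes k: "add_weight k" and [measurable]: "f \<in> borel_measurable F"
  shows "nu_int k (\<lambda>\<omega>. f (shift t \<omega>)) = nu_int k f"
proof -
  have w: "weight k" using k by (auto simp: add_weight_def)
  note [measurable] = weight_measurable[OF w]
  note [measurable (raw)] = measurable_pk[OF w]
  have "nu_int k (\<lambda>\<omega>. f (shift t \<omega>)) = nu_int (\<lambda>s. k (s + t)) f"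
    unfolding nu_int_def
  proof (rule nn_integral_cong)
    fix \<omega> assume "\<omega> \<in> space m"
    then have [measurable]: "\<omega> \<in> space F" by simp
    have "(\<integral>\<^sup>+s. f (shift t (shift (- s) \<omega>)) * (k s / pk k (shift (- s) \<omega>)) \<partial>lam) =
      (\<integral>\<^sup>+s. f (shift t (shift (- (s + t)) \<omega>)) * (k (s + t) / pk k (shift (- (s + t)) \<omega>)) \<partial>lam)"
      by (rule haar.nn_integral_add[symmetric]) measurable
    also have "\<dots> = (\<integral>\<^sup>+s. f (shift (- s) \<omega>) * (k (s + t) / pk (\<lambda>s. k (s + t)) (shift (- s) \<omega>)) \<partial>lam)"
      using \<open>\<omega> \<in> space F\<close> by (intro nn_integral_cong, subst pk_shift[OF w, symmetric])
        (simp_all add: shift_shift add.commute)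
    finally show "(\<integral>\<^sup>+s. f (shift t (shift (- s) \<omega>)) * (k s / pk k (shift (- s) \<omega>)) \<partial>lam) =
      (\<integral>\<^sup>+s. f (shift (- s) \<omega>) * (k (s + t) / pk (\<lambda>s. k (s + t)) (shift (- s) \<omega>)) \<partial>lam)" .
  qed
  also have "\<dots> = nu_int k f"
    by (rule nu_int_independent[OF add_weight_translate[OF k] k]) measurable
  finally show ?thesis .
qed

text \<open>Replacing \<open>s\<close> by \<open>- s\<close>, which preserves \<open>lam\<close>,
  brings the integrand into the form of the mass transport formula. On the other side of that
  formula the path is unshifted, and \<open>k s / pk k \<omega>\<close> integrates to 1 over the
  positions of positive modulus.\<close>

lemma nu_int_pos:
  assumes w: "weight k" and [measurable]: "f \<in> borel_measurable F"
  shows "nu_int k (\<lambda>\<omega>. indicator {0<..} (nv \<omega> 0) * f \<omega>) = (\<integral>\<^sup>+\<omega>. f \<omega> \<partial>m)"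
proof -
  note [measurable] = weight_measurable[OF w]
  note [measurable (raw)] = measurable_pk[OF w]
  define g where "g = (\<lambda>(\<omega>, s). f \<omega> * (k s / pk k \<omega>))"
  have [measurable]: "g \<in> borel_measurable (F \<Otimes>\<^sub>M borel)" unfolding g_def by measurable
  have "nu_int k (\<lambda>\<omega>. indicator {0<..} (nv \<omega> 0) * f \<omega>) =
      (\<integral>\<^sup>+\<omega>. (\<integral>\<^sup>+s. indicator {0<..} (nv \<omega> s) * g (shift s \<omega>, - s) \<partial>lam) \<partial>m)"
    unfolding nu_int_def
  proof (rule nn_integral_cong)
    fix \<omega> assume "\<omega> \<in> space m"
    then have [measurable]: "\<omega> \<in> space F" by simp
    have "(\<integral>\<^sup>+s. indicator {0<..} (nv \<omega> s) * g (shift s \<omega>, - s) \<partial>lam) =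
        (\<integral>\<^sup>+s. indicator {0<..} (nv \<omega> (- s)) * g (shift (- s) \<omega>, - (- s)) \<partial>lam)"
      by (rule haar.nn_integral_uminus[symmetric]) measurable
    then show "(\<integral>\<^sup>+s. indicator {0<..} (nv (shift (- s) \<omega>) 0) * f (shift (- s) \<omega>) * (k s / pk k (shift (- s) \<omega>)) \<partial>lam) =
        (\<integral>\<^sup>+s. indicator {0<..} (nv \<omega> s) * g (shift s \<omega>, - s) \<partial>lam)"
      by (simp add: g_def nv_shift mult_ac)
  qed
  also have "\<dots> = (\<integral>\<^sup>+\<omega>. (\<integral>\<^sup>+s. indicator {0<..} (nv \<omega> s) * g (\<omega>, s) \<partial>lam) \<partial>m)"
    by (rule mass_transport) measurable
  also have "\<dots> = (\<integral>\<^sup>+\<omega>. f \<omega> \<partial>m)"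
  proof (rule nn_integral_cong_AE)
    show "AE \<omega> in m. (\<integral>\<^sup>+s. indicator {0<..} (nv \<omega> s) * g (\<omega>, s) \<partial>lam) = f \<omega>"
      using AE_m_full AE_space
    proof eventually_elim
      case (elim \<omega>)
      then have [measurable]: "\<omega> \<in> space F" by simp
      have "(\<integral>\<^sup>+s. indicator {0<..} (nv \<omega> s) * g (\<omega>, s) \<partial>lam) =
        (\<integral>\<^sup>+s. (f \<omega> * inverse (pk k \<omega>)) * (k s * indicator {0<..} (nv \<omega> s)) \<partial>lam)"
        by (simp add: g_def divide_ennreal_def mult_ac)
      also have "\<dots> = (f \<omega> * inverse (pk k \<omega>)) * pk k \<omega>"
        unfolding pk_def by (rule nn_integral_cmult) measurable
      also have "\<dots> = f \<omega>"
        using ennreal_inverse_self[of "pk k \<omega>"] pk_pos[OF w, of \<omega>] pk_finite[OF w, of \<omega>] elim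
        by (simp add: mult.assoc)
      finally show ?case .
    qed
  qed
  finally show ?thesis .
qed

text \<open>The factor \<open>k s / pk k\<close> depends on the path only through the set where its
  modulus is positive, hence is insensitive to scaling; the power of \<open>u\<close> is that of
  \<open>m\<close>.\<close>

lemma nu_int_sc:
  assumes w: "weight k" and [measurable]: "f \<in> borel_measurable F" and u: "0 < u"
  shows "nu_int k (\<lambda>\<omega>. f (sc u \<omega>)) = ennreal (u powr \<alpha>) * nu_int k f"
proof -
  note [measurable] = weight_measurable[OF w]
  note [measurable (raw)] = measurable_pk[OF w]
  have "nu_int k (\<lambda>\<omega>. f (sc u \<omega>)) =
      (\<integral>\<^sup>+\<omega>. (\<integral>\<^sup>+s. f (shift (- s) (sc u \<omega>)) * (k s / pk k (shift (- s) (sc u \<omega>))) \<partial>lam) \<partial>m)"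
    using u by (simp add: nu_int_def shift_sc pk_sc)
  also have "\<dots> = ennreal (u powr \<alpha>) * nu_int k f"
    unfolding nu_int_def by (rule nn_integral_m_sc[OF _ u]) measurable
  finally show ?thesis .
qed

section \<open>The candidate as a stationary tail measure with the prescribed Palm measure\<close>

definition nu :: "('g \<Rightarrow> ennreal) \<Rightarrow> ('g \<Rightarrow> 'h) measure" where
  "nu k = distr (density (m \<Otimes>\<^sub>M lam) (\<lambda>p. k (snd p) / pk k (shift (- snd p) (fst p)))) F
    (\<lambda>p. shift (- snd p) (fst p))"

lemma sets_nu [measurable_cong, simp]: "sets (nu k) = sets F"
  by (simp add: nu_def)

lemma space_nu [simp]: "space (nu k) = space F"
  by (simp add: nu_def)

lemma nn_integral_nu_pair:
  assumes w: "weight k" and [measurable]: "f \<in> borel_measurable F"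
  shows "(\<integral>\<^sup>+\<omega>. f \<omega> \<partial>nu k) =
    (\<integral>\<^sup>+p. k (snd p) / pk k (shift (- snd p) (fst p)) * f (shift (- snd p) (fst p)) \<partial>(m \<Otimes>\<^sub>M lam))"
proof -
  note [measurable] = weight_measurable[OF w]
  note [measurable (raw)] = measurable_pk[OF w]
  show ?thesis unfolding nu_def
    by (subst nn_integral_distr, measurable, subst nn_integral_density) simp_all
qed

lemma nn_integral_nu:
  assumes w: "weight k" and [measurable]: "f \<in> borel_measurable F"
  shows "(\<integral>\<^sup>+\<omega>. f \<omega> \<partial>nu k) = nu_int k f"
proof -
  note [measurable] = weight_measurable[OF w]
  note [measurable (raw)] = measurable_pk[OF w]
  show ?thesis unfolding nn_integral_nu_pair[OF assms] nu_int_def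
    by (subst haar.nn_integral_fst[symmetric]) (measurable, simp add: mult.commute)
qed

text \<open>The exchange is carried out on the product of \<open>m\<close> and \<open>lam\<close>,
  of which \<open>nu k\<close> is a weighted image and where sigma-finiteness is available.\<close>

lemma nn_integral_nu_swap:
  assumes w: "weight k" and [measurable]: "f \<in> borel_measurable (F \<Otimes>\<^sub>M borel)"
  shows "(\<integral>\<^sup>+\<omega>. (\<integral>\<^sup>+s. f (\<omega>, s) \<partial>lam) \<partial>nu k) = (\<integral>\<^sup>+s. (\<integral>\<^sup>+\<omega>. f (\<omega>, s) \<partial>nu k) \<partial>lam)"
proof -
  note [measurable] = weight_measurable[OF w]
  note [measurable (raw)] = measurable_pk[OF w]
  interpret mlam: pair_sigma_finite m lam by unfold_locales
  interpret mlamlam: pair_sigma_finite "m \<Otimes>\<^sub>M lam" lam by unfold_locales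
  define h where "h p s = k (snd p) / pk k (shift (- snd p) (fst p)) * f (shift (- snd p) (fst p), s)" for p s
  have [measurable]: "(\<lambda>(p, s). h p s) \<in> borel_measurable ((F \<Otimes>\<^sub>M borel) \<Otimes>\<^sub>M borel)"
    unfolding h_def by measurable
  have "(\<integral>\<^sup>+\<omega>. (\<integral>\<^sup>+s. f (\<omega>, s) \<partial>lam) \<partial>nu k) = (\<integral>\<^sup>+p. (\<integral>\<^sup>+s. h p s \<partial>lam) \<partial>(m \<Otimes>\<^sub>M lam))"
    unfolding h_def by (subst nn_integral_nu_pair[OF w], measurable)
      (intro nn_integral_cong nn_integral_cmult[symmetric], auto simp: space_pair_measure)
  also have "\<dots> = (\<integral>\<^sup>+s. (\<integral>\<^sup>+p. h p s \<partial>(m \<Otimes>\<^sub>M lam)) \<partial>lam)"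
    by (rule mlamlam.Fubini'[symmetric]) measurable
  also have "\<dots> = (\<integral>\<^sup>+s. (\<integral>\<^sup>+\<omega>. f (\<omega>, s) \<partial>nu k) \<partial>lam)"
    unfolding h_def by (intro nn_integral_cong, subst nn_integral_nu_pair[OF w]) auto
  finally show ?thesis .
qed

lemma nn_integral_nu_level:
  assumes w: "weight k" and [measurable]: "f \<in> borel_measurable F"
  shows "(\<integral>\<^sup>+\<omega>. indicator {1<..} (nv \<omega> 0) * f \<omega> \<partial>nu k) = (\<integral>\<^sup>+\<omega>. f \<omega> \<partial>Q)"
proof -
  have "(\<integral>\<^sup>+\<omega>. indicator {1<..} (nv \<omega> 0) * f \<omega> \<partial>nu k) =
      nu_int k (\<lambda>\<omega>. indicator {0<..} (nv \<omega> 0) * (indicator {1<..} (nv \<omega> 0) * f \<omega>))"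
    by (subst nn_integral_nu[OF w], measurable) (auto intro!: arg_cong[where f = "nu_int k"] simp: indicator_def)
  also have "\<dots> = (\<integral>\<^sup>+\<omega>. indicator {1<..} (nv \<omega> 0) * f \<omega> \<partial>m)"
    by (rule nu_int_pos[OF w]) measurable
  finally show ?thesis by (simp add: nn_integral_Q)
qed

text \<open>Campbell's formula: by stationarity every \<open>s\<close> in \<open>B\<close>
  contributes the same amount, the integral over \<open>{1 < |Y_0|}\<close>, which is that of
  \<open>Q\<close>. An indicator for \<open>f\<close> gives the Palm property, \<open>f = 1\<close>
  the intensity of \<open>xi\<close>.\<close>

lemma nn_integral_nu_xi:
  assumes k: "add_weight k" and [measurable]: "f \<in> borel_measurable F" "B \<in> sets borel"
  shows "(\<integral>\<^sup>+\<omega>. (\<integral>\<^sup>+s. f (shift s \<omega>) * indicator B s \<partial>xi lam nrm \<omega>) \<partial>nu k) =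
    emeasure lam B * (\<integral>\<^sup>+\<omega>. f \<omega> \<partial>Q)"
proof -
  have w: "weight k" using k by (auto simp: add_weight_def)
  have "(\<integral>\<^sup>+\<omega>. (\<integral>\<^sup>+s. f (shift s \<omega>) * indicator B s \<partial>xi lam nrm \<omega>) \<partial>nu k) =
      (\<integral>\<^sup>+\<omega>. (\<integral>\<^sup>+s. indicator {1<..} (nv \<omega> s) * (f (shift s \<omega>) * indicator B s) \<partial>lam) \<partial>nu k)"
    by (intro nn_integral_cong, subst nn_integral_xi) auto
  also have "\<dots> = (\<integral>\<^sup>+s. (\<integral>\<^sup>+\<omega>. indicator {1<..} (nv \<omega> s) * (f (shift s \<omega>) * indicator B s) \<partial>nu k) \<partial>lam)"
    using nn_integral_nu_swap[OF w, of "\<lambda>(\<omega>, s). indicator {1<..} (nv \<omega> s) * (f (shift s \<omega>) * indicator B s)"]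
    by simp
  also have "\<dots> = (\<integral>\<^sup>+s. (\<integral>\<^sup>+\<omega>. f \<omega> \<partial>Q) * indicator B s \<partial>lam)"
  proof (rule nn_integral_cong)
    fix s
    have "(\<integral>\<^sup>+\<omega>. indicator {1<..} (nv \<omega> s) * (f (shift s \<omega>) * indicator B s) \<partial>nu k) =
        (\<integral>\<^sup>+\<omega>. (indicator {1<..} (nv (shift s \<omega>) 0) * f (shift s \<omega>)) * indicator B s \<partial>nu k)"
      by (simp add: nv_shift mult.assoc)
    also have "\<dots> = (\<integral>\<^sup>+\<omega>. indicator {1<..} (nv (shift s \<omega>) 0) * f (shift s \<omega>) \<partial>nu k) * indicator B s"
      by (rule nn_integral_multc) measurable
    also have "(\<integral>\<^sup>+\<omega>. indicator {1<..} (nv (shift s \<omega>) 0) * f (shift s \<omega>) \<partial>nu k) =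
        (\<integral>\<^sup>+\<omega>. indicator {1<..} (nv \<omega> 0) * f \<omega> \<partial>nu k)"
      using nu_int_shift[OF k, of "\<lambda>\<omega>. indicator {1<..} (nv \<omega> 0) * f \<omega>" s]
      by (simp add: nn_integral_nu[OF w])
    also have "\<dots> = (\<integral>\<^sup>+\<omega>. f \<omega> \<partial>Q)" by (rule nn_integral_nu_level[OF w]) measurable
    finally show "(\<integral>\<^sup>+\<omega>. indicator {1<..} (nv \<omega> s) * (f (shift s \<omega>) * indicator B s) \<partial>nu k) =
        (\<integral>\<^sup>+\<omega>. f \<omega> \<partial>Q) * indicator B s" .
  qed
  also have "\<dots> = emeasure lam B * (\<integral>\<^sup>+\<omega>. f \<omega> \<partial>Q)"
    by (subst nn_integral_cmult_indicator) (simp_all add: mult.commute)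
  finally show ?thesis .
qed

lemma is_palm_measure_nu:
  assumes k: "add_weight k"
  shows "is_palm_measure lam F nrm (nu k) Q"
  unfolding is_palm_measure_def
proof (intro conjI ballI impI)
  fix A B assume [measurable]: "B \<in> sets borel" "A \<in> sets F" and B: "0 < emeasure lam B \<and> emeasure lam B < \<infinity>"
  have "(\<integral>\<^sup>+\<omega>. (\<integral>\<^sup>+s. indicator A (shift s \<omega>) * indicator B s \<partial>xi lam nrm \<omega>) \<partial>nu k) =
    emeasure lam B * emeasure Q A"
    by (subst nn_integral_nu_xi[OF k]) auto
  then show "emeasure Q A = (\<integral>\<^sup>+\<omega>. (\<integral>\<^sup>+s. indicator A (shift s \<omega>) * indicator B s \<partial>xi lam nrm \<omega>) \<partial>nu k) / emeasure lam B"
    using B by (auto simp: mult.commute[of "emeasure lam B"] ennreal_mult_divide_eq)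
qed simp

lemma emeasure_nu:
  assumes w: "weight k" and "Measurable.pred F P"
  shows "emeasure (nu k) {\<omega> \<in> space F. P \<omega>} = nu_int k (indicator {\<omega> \<in> space F. P \<omega>})"
  using assms(2) by (subst nn_integral_indicator[symmetric], simp, subst nn_integral_nu[OF w]) simp_all

lemma nu_int_cong: "(\<And>\<omega>. \<omega> \<in> space F \<Longrightarrow> f \<omega> = g \<omega>) \<Longrightarrow> nu_int k f = nu_int k g"
  unfolding nu_int_def by (intro nn_integral_cong) simp

lemma stationary_tail_measure_nu:
  assumes k: "add_weight k"
  shows "stationary_tail_measure lam F scal nrm \<alpha> (nu k)"
  unfolding stationary_tail_measure_def tail_measure_def stationary_def
proof (intro conjI ballI allI impI)
  have w: "weight k" using k by (auto simp: add_weight_def)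
  note [measurable] = weight_measurable[OF w]
  note [measurable (raw)] = measurable_pk[OF w]
  have "emeasure (nu k) {\<omega> \<in> space F. \<not> full \<omega>} = nu_int k (indicator {\<omega> \<in> space F. \<not> full \<omega>})"
    by (rule emeasure_nu[OF w]) measurable
  also have "\<dots> = (\<integral>\<^sup>+\<omega>. 0 \<partial>m)" unfolding nu_int_def
    using AE_m_full AE_space by (intro nn_integral_cong_AE, eventually_elim) (simp add: full_shift)
  finally have *: "emeasure (nu k) {\<omega> \<in> space F. \<not> full \<omega>} = 0" by simp
  have "AE \<omega> in nu k. full \<omega>"
    using * by (intro AE_I[of _ _ "{\<omega> \<in> space F. \<not> full \<omega>}"]) auto
  then show "AE \<omega> in nu k. 0 < emeasure (xi' lam nrm \<omega>) UNIV"
    using AE_space by eventually_elim (simp add: full_def emeasure_xi')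
  fix B :: "'g set" assume B: "compact B \<and> B \<in> sets borel"
  then have [measurable]: "B \<in> sets borel" by simp
  have "(\<integral>\<^sup>+\<omega>. emeasure (xi lam nrm \<omega>) B \<partial>nu k) = (\<integral>\<^sup>+\<omega>. (\<integral>\<^sup>+s. 1 * indicator B s \<partial>xi lam nrm \<omega>) \<partial>nu k)"
    by (intro nn_integral_cong) (simp add: xi_def)
  also have "\<dots> = emeasure lam B * (\<integral>\<^sup>+\<omega>. 1 \<partial>Q)"
    by (rule nn_integral_nu_xi[OF k]) measurable
  also have "\<dots> < \<infinity>" using haar.compact_finite[of B] B Q.emeasure_space_1 by simp
  finally show "(\<integral>\<^sup>+\<omega>. emeasure (xi lam nrm \<omega>) B \<partial>nu k) < \<infinity>" .
next
  have w: "weight k" using k by (auto simp: add_weight_def)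
  fix u :: real and A assume u: "0 < u" and [measurable]: "A \<in> sets F"
  have "{\<omega> \<in> space F. scale scal u \<omega> \<in> A} = {\<omega> \<in> space F. sc u \<omega> \<in> A}" using u by (simp add: sc_pos)
  then have "emeasure (nu k) {\<omega> \<in> space F. scale scal u \<omega> \<in> A} = nu_int k (indicator {\<omega> \<in> space F. sc u \<omega> \<in> A})"
    by (simp add: emeasure_nu[OF w])
  also have "\<dots> = nu_int k (\<lambda>\<omega>. indicator A (sc u \<omega>))"
    by (rule nu_int_cong) (simp add: indicator_def)
  also have "\<dots> = ennreal (u powr \<alpha>) * nu_int k (indicator A)" by (rule nu_int_sc[OF w _ u]) measurable
  also have "nu_int k (indicator A) = emeasure (nu k) A" by (subst nn_integral_nu[OF w, symmetric]) auto
  finally show "emeasure (nu k) {\<omega> \<in> space F. scale scal u \<omega> \<in> A} = ennreal (u powr \<alpha>) * emeasure (nu k) A" .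
next
  have w: "weight k" using k by (auto simp: add_weight_def)
  fix s A assume [measurable]: "A \<in> sets F"
  have "emeasure (nu k) {\<omega> \<in> space F. shift s \<omega> \<in> A} = nu_int k (indicator {\<omega> \<in> space F. shift s \<omega> \<in> A})"
    by (simp add: emeasure_nu[OF w])
  also have "\<dots> = nu_int k (\<lambda>\<omega>. indicator A (shift s \<omega>))"
    by (rule nu_int_cong) (simp add: indicator_def)
  also have "\<dots> = nu_int k (indicator A)" by (rule nu_int_shift[OF k]) measurable
  also have "nu_int k (indicator A) = emeasure (nu k) A" by (subst nn_integral_nu[OF w, symmetric]) auto
  finally show "emeasure (nu k) {\<omega> \<in> space F. shift s \<omega> \<in> A} = emeasure (nu k) A" .
next
  have w: "weight k" using k by (auto simp: add_weight_def)
  have "{\<omega> \<in> space F. 1 < nrm (\<omega> 0)} = {\<omega> \<in> space F. 1 < nv \<omega> 0}" by (simp add: nv_def)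
  then have "emeasure (nu k) {\<omega> \<in> space F. 1 < nrm (\<omega> 0)} = (\<integral>\<^sup>+\<omega>. indicator {\<omega> \<in> space F. 1 < nv \<omega> 0} \<omega> \<partial>nu k)"
    by (subst nn_integral_indicator) simp_all
  also have "\<dots> = (\<integral>\<^sup>+\<omega>. indicator {1<..} (nv \<omega> 0) * 1 \<partial>nu k)"
    by (intro nn_integral_cong) (simp add: indicator_def)
  also have "\<dots> = 1" using Q.emeasure_space_1 by (subst nn_integral_nu_level[OF w]) auto
  finally show "emeasure (nu k) {\<omega> \<in> space F. 1 < nrm (\<omega> 0)} = 1" .
qed simp_all

end

subsection \<open>Uniqueness and the explicit formulas\<close>

lemma ennreal_divide_times_self: "0 < b \<Longrightarrow> b < \<infinity> \<Longrightarrow> a / b * b = (a::ennreal)"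
  using ennreal_inverse_self[of b] by (simp add: divide_ennreal_def mult.assoc)

text \<open>By Markov's inequality the sets where \<open>1 \<le> n * h i x\<close> have finite
  measure, and over all \<open>n\<close> they exhaust the set where \<open>h i\<close> is positive.
  Multiplying by \<open>n\<close> rather than dividing also handles the value
  \<open>top\<close>.\<close>

lemma sigma_finite_measure_countable_integrable:
  fixes h :: "nat \<Rightarrow> 'a \<Rightarrow> ennreal"
  assumes [measurable]: "\<And>i. h i \<in> borel_measurable M"
    and fin: "\<And>i. (\<integral>\<^sup>+x. h i x \<partial>M) < \<infinity>" and ae: "AE x in M. \<exists>i. 0 < h i x"
  shows "sigma_finite_measure M"
proof
  define E where "E p = {x \<in> space M. 1 \<le> of_nat (snd p) * h (fst p) x}" for p :: "nat \<times> nat"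
  define Z where "Z = {x \<in> space M. \<not> (\<exists>i. 0 < h i x)}"
  have [measurable]: "E p \<in> sets M" "Z \<in> sets M" for p by (simp_all add: E_def Z_def)
  have E_fin: "emeasure M (E p) \<noteq> \<infinity>" for p
  proof -
    have "emeasure M (E p) \<le> of_nat (snd p) * (\<integral>\<^sup>+x. h (fst p) x * indicator (space M) x \<partial>M)"
      unfolding E_def by (rule nn_integral_Markov_inequality) simp_all
    also have "(\<integral>\<^sup>+x. h (fst p) x * indicator (space M) x \<partial>M) = (\<integral>\<^sup>+x. h (fst p) x \<partial>M)"
      by (rule nn_integral_cong) simp
    also have "of_nat (snd p) * (\<integral>\<^sup>+x. h (fst p) x \<partial>M) < \<infinity>"
      using fin[of "fst p"] by (simp add: ennreal_mult_less_top of_nat_less_top)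
    finally show ?thesis by simp
  qed
  have Z0: "emeasure M Z = 0"
    using ae AE_iff_measurable[of Z M "\<lambda>x. \<exists>i. 0 < h i x"] by (auto simp: Z_def)
  have cover: "x \<in> Z \<union> (\<Union>p. E p)" if x: "x \<in> space M" for x
  proof (cases "\<exists>i. 0 < h i x")
    case True
    then obtain i where i: "0 < h i x" by blast
    then have "inverse (h i x) < top" by (simp add: less_top[symmetric])
    then obtain n where n: "inverse (h i x) < of_nat n" by (auto dest: ennreal_Ex_less_of_nat)
    have "1 \<le> of_nat n * h i x"
    proof (cases "h i x = top")
      case True
      have "n \<noteq> 0" using n by (cases n) auto
      then show ?thesis by (simp add: True ennreal_mult_top)
    next
      case False
      then have "inverse (h i x) * h i x = 1" using i by (intro ennreal_inverse_self) (simp_all add: less_top)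
      then show ?thesis using mult_right_mono[OF less_imp_le[OF n], of "h i x"] by simp
    qed
    then have "x \<in> E (i, n)" using x by (simp add: E_def)
    then show ?thesis by blast
  qed (use x in \<open>simp add: Z_def\<close>)
  have "\<Union> (insert Z (range E)) = space M"
  proof
    show "\<Union> (insert Z (range E)) \<subseteq> space M" by (auto simp: Z_def E_def)
  qed (use cover in auto)
  then show "\<exists>C. countable C \<and> C \<subseteq> sets M \<and> \<Union>C = space M \<and> (\<forall>a\<in>C. emeasure M a \<noteq> \<infinity>)"
    using E_fin Z0 by (intro exI[of _ "insert Z (range E)"]) auto
qed

locale palm_inverse = tail_spectral +
  fixes N :: "('a \<Rightarrow> 'b) measure"
  assumes stm: "stationary_tail_measure lam F scal nrm \<alpha> N"
    and palm: "is_palm_measure lam F nrm N Q"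
begin

lemma sets_N [measurable_cong, simp]: "sets N = sets F"
  using stm by (simp add: stationary_tail_measure_def tail_measure_def)

lemma space_N [simp]: "space N = space F"
  by (rule sets_eq_imp_space_eq) simp

lemma AE_N_full: "AE \<omega> in N. full \<omega>"
proof -
  have "AE \<omega> in N. 0 < emeasure (xi' lam nrm \<omega>) UNIV"
    using stm by (simp add: stationary_tail_measure_def tail_measure_def)
  then show ?thesis using AE_space by eventually_elim (simp add: full_def emeasure_xi')
qed

lemma nn_integral_N_shift:
  assumes [measurable]: "f \<in> borel_measurable F"
  shows "(\<integral>\<^sup>+\<omega>. f (shift t \<omega>) \<partial>N) = (\<integral>\<^sup>+\<omega>. f \<omega> \<partial>N)"
proof -
  have "distr N F (shift t) = N"
  proof (rule measure_eqI)
    fix A assume "A \<in> sets (distr N F (shift t))"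
    then have [measurable]: "A \<in> sets F" by simp
    have "emeasure (distr N F (shift t)) A = emeasure N (shift t -` A \<inter> space N)"
      by (rule emeasure_distr) measurable
    also have "shift t -` A \<inter> space N = {\<omega> \<in> space F. shift t \<omega> \<in> A}" by auto
    also have "emeasure N \<dots> = emeasure N A"
      using stm by (simp add: stationary_tail_measure_def stationary_def)
    finally show "emeasure (distr N F (shift t)) A = emeasure N A" .
  qed simp
  moreover have "(\<integral>\<^sup>+\<omega>. f \<omega> \<partial>distr N F (shift t)) = (\<integral>\<^sup>+\<omega>. f (shift t \<omega>) \<partial>N)"
    by (rule nn_integral_distr) measurable
  ultimately show ?thesis by simp
qed

lemma nn_integral_N_sc:
  assumes [measurable]: "f \<in> borel_measurable F" and u: "0 < u"
  shows "(\<integral>\<^sup>+\<omega>. f (sc u \<omega>) \<partial>N) = ennreal (u powr \<alpha>) * (\<integral>\<^sup>+\<omega>. f \<omega> \<partial>N)"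
proof -
  have "distr N F (sc u) = scale_measure (ennreal (u powr \<alpha>)) N"
  proof (rule measure_eqI)
    fix A assume "A \<in> sets (distr N F (sc u))"
    then have [measurable]: "A \<in> sets F" by simp
    have "emeasure (distr N F (sc u)) A = emeasure N (sc u -` A \<inter> space N)"
      by (rule emeasure_distr) measurable
    also have "sc u -` A \<inter> space N = {\<omega> \<in> space F. scale scal u \<omega> \<in> A}" using u by (auto simp: sc_pos)
    also have "emeasure N \<dots> = ennreal (u powr \<alpha>) * emeasure N A"
      using stm u by (simp add: stationary_tail_measure_def tail_measure_def)
    finally show "emeasure (distr N F (sc u)) A = emeasure (scale_measure (ennreal (u powr \<alpha>)) N) A"
      by simp
  qed simp
  moreover have "(\<integral>\<^sup>+\<omega>. f \<omega> \<partial>distr N F (sc u)) = (\<integral>\<^sup>+\<omega>. f (sc u \<omega>) \<partial>N)"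
    by (rule nn_integral_distr) measurable
  ultimately show ?thesis by (simp add: nn_integral_scale_measure)
qed

lemma palm_eq:
  assumes [measurable]: "B \<in> sets borel" "A \<in> sets F" and B: "0 < emeasure lam B" "emeasure lam B < \<infinity>"
  shows "(\<integral>\<^sup>+\<omega>. (\<integral>\<^sup>+s. indicator {1<..} (nv \<omega> s) * (indicator A (shift s \<omega>) * indicator B s) \<partial>lam) \<partial>N) =
    emeasure Q A * emeasure lam B"
proof -
  have "(\<integral>\<^sup>+\<omega>. (\<integral>\<^sup>+s. indicator {1<..} (nv \<omega> s) * (indicator A (shift s \<omega>) * indicator B s) \<partial>lam) \<partial>N) =
    (\<integral>\<^sup>+\<omega>. (\<integral>\<^sup>+s. indicator A (shift s \<omega>) * indicator B s \<partial>xi lam nrm \<omega>) \<partial>N)"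
    by (intro nn_integral_cong, subst nn_integral_xi) auto
  also have "\<dots> = (\<integral>\<^sup>+\<omega>. (\<integral>\<^sup>+s. indicator A (shift s \<omega>) * indicator B s \<partial>xi lam nrm \<omega>) \<partial>N) / emeasure lam B * emeasure lam B"
    using B by (rule ennreal_divide_times_self[symmetric])
  also have "(\<integral>\<^sup>+\<omega>. (\<integral>\<^sup>+s. indicator A (shift s \<omega>) * indicator B s \<partial>xi lam nrm \<omega>) \<partial>N) / emeasure lam B = emeasure Q A"
    using palm[unfolded is_palm_measure_def, THEN conjunct2, rule_format, OF assms(1) conjI[OF B] assms(2)]
    by (rule sym)
  finally show ?thesis .
qed

text \<open>The functions \<open>h\<close> measure, within sets \<open>C j\<close> of finite Haar
  measure, the positions where the modulus exceeds \<open>1 / (n + 1)\<close>. At level 1 the Palm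
  equation gives their \<open>N\<close>-integral, scaling treats the other levels, and on a full
  path one of them is positive.\<close>

lemma sigma_finite_N: "sigma_finite_measure N"
proof -
  obtain C :: "nat \<Rightarrow> 'a set" where C: "range C \<subseteq> sets lam" "(\<Union>i. C i) = space lam"
      "\<And>i. emeasure lam (C i) \<noteq> \<infinity>" by (rule haar.sigma_finite) blast
  have [measurable]: "C j \<in> sets borel" for j using C(1) by auto
  define h where "h i \<omega> = (\<integral>\<^sup>+s. indicator {inverse (real (Suc (fst (prod_decode i))))<..} (nv \<omega> s) *
    indicator (C (snd (prod_decode i))) s \<partial>lam)" for i \<omega>
  show ?thesis
  proof (rule sigma_finite_measure_countable_integrable[of h])
    show "h i \<in> borel_measurable N" for i unfolding h_def by measurable
    show "(\<integral>\<^sup>+\<omega>. h i \<omega> \<partial>N) < \<infinity>" for i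
    proof -
      define r where "r = inverse (real (Suc (fst (prod_decode i))))"
      define B where "B = C (snd (prod_decode i))"
      have r: "0 < r" by (simp add: r_def)
      have [measurable]: "B \<in> sets borel" by (simp add: B_def)
      have lB: "emeasure lam B < \<infinity>" using C(3) by (simp add: B_def less_top)
      have "(\<integral>\<^sup>+\<omega>. (\<integral>\<^sup>+s. indicator {1<..} (nv \<omega> s) * indicator B s \<partial>lam) \<partial>N) < \<infinity>"
      \<comment> \<open>The Palm equation is available only for sets of positive Haar
        measure.\<close>
      proof (cases "emeasure lam B = 0")
        case True
        then have "AE s in lam. s \<notin> B" by (intro AE_not_in null_setsI) simp_all
        then have "(\<integral>\<^sup>+s. indicator {1<..} (nv \<omega> s) * indicator B s \<partial>lam) = (\<integral>\<^sup>+s. 0 \<partial>lam)" for \<omega>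
          by (intro nn_integral_cong_AE, eventually_elim) simp
        then show ?thesis by simp
      next
        case False
        then have "0 < emeasure lam B" by (simp add: zero_less_iff_neq_zero)
        from palm_eq[OF _ sets.top this lB]
        have "(\<integral>\<^sup>+\<omega>. (\<integral>\<^sup>+s. indicator {1<..} (nv \<omega> s) * (indicator (space F) (shift s \<omega>) * indicator B s) \<partial>lam) \<partial>N) =
          emeasure Q (space F) * emeasure lam B" by simp
        also have "(\<integral>\<^sup>+\<omega>. (\<integral>\<^sup>+s. indicator {1<..} (nv \<omega> s) * (indicator (space F) (shift s \<omega>) * indicator B s) \<partial>lam) \<partial>N) =
          (\<integral>\<^sup>+\<omega>. (\<integral>\<^sup>+s. indicator {1<..} (nv \<omega> s) * indicator B s \<partial>lam) \<partial>N)"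
          by (intro nn_integral_cong) simp
        finally show ?thesis using lB Q.emeasure_space_1 by simp
      qed
      also have "(\<integral>\<^sup>+\<omega>. (\<integral>\<^sup>+s. indicator {1<..} (nv \<omega> s) * indicator B s \<partial>lam) \<partial>N) =
          (\<integral>\<^sup>+\<omega>. (\<integral>\<^sup>+s. indicator {r<..} (nv (sc r \<omega>) s) * indicator B s \<partial>lam) \<partial>N)"
        using r by (simp add: nv_sc indicator_def)
      also have "\<dots> = ennreal (r powr \<alpha>) * (\<integral>\<^sup>+\<omega>. (\<integral>\<^sup>+s. indicator {r<..} (nv \<omega> s) * indicator B s \<partial>lam) \<partial>N)"
        by (rule nn_integral_N_sc[OF _ r]) measurable
      finally have "ennreal (r powr \<alpha>) * (\<integral>\<^sup>+\<omega>. h i \<omega> \<partial>N) < \<infinity>" unfolding h_def r_def B_def .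
      then show ?thesis using r by (auto simp: ennreal_mult_less_top)
    qed
    show "AE \<omega> in N. \<exists>i. 0 < h i \<omega>"
      using AE_N_full AE_space
    proof eventually_elim
      case (elim \<omega>)
      then have [measurable]: "\<omega> \<in> space F" by simp
      show ?case
      proof (rule ccontr)
        assume "\<not> (\<exists>i. 0 < h i \<omega>)"
        then have h0: "h i \<omega> = 0" for i by (simp add: zero_less_iff_neq_zero)
        have "AE s in lam. indicator {inverse (real (Suc n))<..} (nv \<omega> s) * indicator (C j) s = (0::ennreal)" for n j
          using h0[of "prod_encode (n, j)"] unfolding h_def by (subst (asm) nn_integral_0_iff_AE) auto
        then have "AE s in lam. \<forall>n j. indicator {inverse (real (Suc n))<..} (nv \<omega> s) * indicator (C j) s = (0::ennreal)"
          unfolding AE_all_countable by (intro allI)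
        then have "AE s in lam. indicator {0<..} (nv \<omega> s) = (0::ennreal)"
        proof eventually_elim
          case (elim s)
          show ?case
          proof (rule ccontr)
            assume "indicator {0<..} (nv \<omega> s) \<noteq> (0::ennreal)"
            then have "0 < nv \<omega> s" by (auto simp: indicator_def split: if_splits)
            then obtain n where n: "inverse (real (Suc n)) < nv \<omega> s" using reals_Archimedean by blast
            have "s \<in> (\<Union>j. C j)" using C(2) by simp
            then obtain j where "s \<in> C j" by blast
            then show False using elim[rule_format, of n j] n by simp
          qed
        qed
        then have "(\<integral>\<^sup>+s. indicator {0<..} (nv \<omega> s) \<partial>lam) = 0"
          by (subst nn_integral_0_iff_AE) auto
        then show False using elim(1) by (simp add: full_def)
      qed
    qed
  qed
qed

section \<open>Comparison of a given tail measure with \<open>m\<close>\<close>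

sublocale N: sigma_finite_measure N by (rule sigma_finite_N)
sublocale Nlam: pair_sigma_finite N lam by unfold_locales
sublocale mlam: pair_sigma_finite m lam by unfold_locales

text \<open>The Palm equation is used for a compact neighbourhood \<open>C\<close> of 0. After
  exchanging integrals, stationarity makes the integral over \<open>N\<close> constant in
  \<open>s \<in> C\<close>, and the Haar measure of \<open>C\<close>, being positive and finite,
  cancels.\<close>

lemma Q_eq_density_N: "Q = density N (\<lambda>\<omega>. indicator {1<..} (nv \<omega> 0))"
proof (rule measure_eqI)
  fix A assume "A \<in> sets Q"
  then have [measurable]: "A \<in> sets F" by simp
  obtain U C :: "'a set" where UC: "open U" "compact C" "0 \<in> U" "U \<subseteq> C"
    by (rule haar.compact_zero_neighbourhood)
  have C [measurable]: "C \<in> sets borel" using UC(2) by (intro borel_closed compact_imp_closed)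
  have "0 < emeasure lam U" using UC by (intro haar.open_positive) auto
  also have "\<dots> \<le> emeasure lam C" using UC(4) by (intro emeasure_mono) simp_all
  finally have lC: "0 < emeasure lam C" "emeasure lam C < \<infinity>" using haar.compact_finite[OF UC(2)] by auto
  have "emeasure Q A * emeasure lam C =
      (\<integral>\<^sup>+\<omega>. (\<integral>\<^sup>+s. indicator {1<..} (nv \<omega> s) * (indicator A (shift s \<omega>) * indicator C s) \<partial>lam) \<partial>N)"
    by (rule palm_eq[symmetric]) (use lC in simp_all)
  also have "\<dots> = (\<integral>\<^sup>+s. (\<integral>\<^sup>+\<omega>. indicator {1<..} (nv \<omega> s) * (indicator A (shift s \<omega>) * indicator C s) \<partial>N) \<partial>lam)"
    by (rule Nlam.Fubini'[symmetric]) measurable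
  also have "\<dots> = (\<integral>\<^sup>+s. (\<integral>\<^sup>+\<omega>. indicator {1<..} (nv \<omega> 0) * indicator A \<omega> \<partial>N) * indicator C s \<partial>lam)"
  proof (rule nn_integral_cong)
    fix s
    have "(\<integral>\<^sup>+\<omega>. indicator {1<..} (nv \<omega> s) * (indicator A (shift s \<omega>) * indicator C s) \<partial>N) =
        (\<integral>\<^sup>+\<omega>. (indicator {1<..} (nv (shift s \<omega>) 0) * indicator A (shift s \<omega>)) * indicator C s \<partial>N)"
      by (simp add: nv_shift mult.assoc)
    also have "\<dots> = (\<integral>\<^sup>+\<omega>. indicator {1<..} (nv (shift s \<omega>) 0) * indicator A (shift s \<omega>) \<partial>N) * indicator C s"
      by (rule nn_integral_multc) measurable
    also have "(\<integral>\<^sup>+\<omega>. indicator {1<..} (nv (shift s \<omega>) 0) * indicator A (shift s \<omega>) \<partial>N) =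
        (\<integral>\<^sup>+\<omega>. indicator {1<..} (nv \<omega> 0) * indicator A \<omega> \<partial>N)"
      by (rule nn_integral_N_shift) measurable
    finally show "(\<integral>\<^sup>+\<omega>. indicator {1<..} (nv \<omega> s) * (indicator A (shift s \<omega>) * indicator C s) \<partial>N) =
      (\<integral>\<^sup>+\<omega>. indicator {1<..} (nv \<omega> 0) * indicator A \<omega> \<partial>N) * indicator C s" .
  qed
  also have "\<dots> = (\<integral>\<^sup>+\<omega>. indicator {1<..} (nv \<omega> 0) * indicator A \<omega> \<partial>N) * emeasure lam C"
    by (subst nn_integral_cmult_indicator) simp_all
  also have "(\<integral>\<^sup>+\<omega>. indicator {1<..} (nv \<omega> 0) * indicator A \<omega> \<partial>N) =
      emeasure (density N (\<lambda>\<omega>. indicator {1<..} (nv \<omega> 0))) A"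
    by (rule emeasure_density[symmetric]) measurable
  finally show "emeasure Q A = emeasure (density N (\<lambda>\<omega>. indicator {1<..} (nv \<omega> 0))) A"
    using lC by (auto simp: mult.commute[of _ "emeasure lam C"] ennreal_mult_cancel_left)
qed simp

lemma nn_integral_Q_N:
  assumes [measurable]: "f \<in> borel_measurable F"
  shows "(\<integral>\<^sup>+\<omega>. indicator {1<..} (nv \<omega> 0) * f \<omega> \<partial>N) = (\<integral>\<^sup>+\<omega>. f \<omega> \<partial>Q)"
proof -
  have "(\<integral>\<^sup>+\<omega>. f \<omega> \<partial>density N (\<lambda>\<omega>. indicator {1<..} (nv \<omega> 0))) = (\<integral>\<^sup>+\<omega>. indicator {1<..} (nv \<omega> 0) * f \<omega> \<partial>N)"
    by (rule nn_integral_density) measurable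
  then show ?thesis unfolding Q_eq_density_N[symmetric] by (rule sym)
qed

text \<open>At level 1 both measures restrict to \<open>Q\<close>, and both scale by the same
  factor.\<close>

lemma nn_integral_m_level:
  assumes [measurable]: "f \<in> borel_measurable F" and r: "0 < r"
  shows "(\<integral>\<^sup>+\<omega>. indicator {r<..} (nv \<omega> 0) * f \<omega> \<partial>N) = (\<integral>\<^sup>+\<omega>. indicator {r<..} (nv \<omega> 0) * f \<omega> \<partial>m)"
proof -
  have ind: "indicator {r<..} (nv (sc r \<omega>) 0) = (indicator {1<..} (nv \<omega> 0) :: ennreal)" for \<omega>
    using r by (simp add: nv_sc indicator_def)
  have "ennreal (r powr \<alpha>) * (\<integral>\<^sup>+\<omega>. indicator {r<..} (nv \<omega> 0) * f \<omega> \<partial>N) =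
    (\<integral>\<^sup>+\<omega>. indicator {r<..} (nv (sc r \<omega>) 0) * f (sc r \<omega>) \<partial>N)"
    by (rule nn_integral_N_sc[symmetric, OF _ r]) measurable
  also have "\<dots> = (\<integral>\<^sup>+\<omega>. f (sc r \<omega>) \<partial>Q)"
    unfolding ind by (rule nn_integral_Q_N) measurable
  also have "\<dots> = (\<integral>\<^sup>+\<omega>. indicator {r<..} (nv (sc r \<omega>) 0) * f (sc r \<omega>) \<partial>m)"
    unfolding ind by (rule nn_integral_Q) measurable
  also have "\<dots> = ennreal (r powr \<alpha>) * (\<integral>\<^sup>+\<omega>. indicator {r<..} (nv \<omega> 0) * f \<omega> \<partial>m)"
    by (rule nn_integral_m_sc[OF _ r]) measurable
  finally show ?thesis using r by (auto simp: ennreal_mult_cancel_left)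
qed

lemma nn_integral_N_pos:
  assumes [measurable]: "f \<in> borel_measurable F"
  shows "(\<integral>\<^sup>+\<omega>. indicator {0<..} (nv \<omega> 0) * f \<omega> \<partial>N) = (\<integral>\<^sup>+\<omega>. f \<omega> \<partial>m)"
proof -
  let ?r = "\<lambda>n. inverse (real (Suc n))"
  have lim: "(SUP n. \<integral>\<^sup>+\<omega>. indicator {?r n<..} (nv \<omega> 0) * f \<omega> \<partial>M) = (\<integral>\<^sup>+\<omega>. indicator {0<..} (nv \<omega> 0) * f \<omega> \<partial>M)"
    if [measurable_cong]: "sets M = sets F" for M
  proof -
    have "?r (Suc n) \<le> ?r n" for n by simp
    then have "incseq (\<lambda>n \<omega>. indicator {?r n<..} (nv \<omega> 0) * f \<omega>)"
      by (intro incseq_SucI le_funI mult_mono indicator_greater_mono order_refl) simp_all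
    then have "(\<integral>\<^sup>+\<omega>. (SUP n. indicator {?r n<..} (nv \<omega> 0) * f \<omega>) \<partial>M) =
      (SUP n. \<integral>\<^sup>+\<omega>. indicator {?r n<..} (nv \<omega> 0) * f \<omega> \<partial>M)"
      by (rule nn_integral_monotone_convergence_SUP) measurable
    moreover have "(SUP n. indicator {?r n<..} (nv \<omega> 0) * f \<omega>) = indicator {0<..} (nv \<omega> 0) * f \<omega>" for \<omega>
    proof -
      have idem: "indicator {r<..} a * (indicator {r<..} a * c) = indicator {r<..} a * c" for r a :: real and c :: ennreal
        by (simp add: indicator_def)
      show ?thesis using SUP_indicator_greater[of "nv \<omega> 0" "nv \<omega> 0" "f \<omega>"] unfolding idem .
    qed
    ultimately show ?thesis by simp
  qed
  have "(SUP n. \<integral>\<^sup>+\<omega>. indicator {?r n<..} (nv \<omega> 0) * f \<omega> \<partial>N) = (SUP n. \<integral>\<^sup>+\<omega>. indicator {?r n<..} (nv \<omega> 0) * f \<omega> \<partial>m)"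
    by (intro SUP_cong refl nn_integral_m_level) simp_all
  then have "(\<integral>\<^sup>+\<omega>. indicator {0<..} (nv \<omega> 0) * f \<omega> \<partial>N) = (\<integral>\<^sup>+\<omega>. indicator {0<..} (nv \<omega> 0) * f \<omega> \<partial>m)"
    unfolding lim[OF sets_N] lim[OF sets_m] .
  also have "\<dots> = (\<integral>\<^sup>+\<omega>. f \<omega> \<partial>m)"
    using AE_m_pos by (intro nn_integral_cong_AE, eventually_elim) simp
  finally show ?thesis .
qed

text \<open>For fixed \<open>s\<close>, the shift by \<open>- s\<close> maps \<open>m\<close> to the
  restriction of \<open>N\<close> to \<open>{0 < |Y_s|}\<close>: \<open>m\<close> is
  \<open>N\<close> restricted to \<open>{0 < |Y_0|}\<close>, \<open>N\<close> is stationary, and the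
  shifted path at \<open>s\<close> is the original path at 0.\<close>

lemma transfer_N:
  assumes [measurable]: "f \<in> borel_measurable (F \<Otimes>\<^sub>M borel)"
  shows "(\<integral>\<^sup>+\<omega>. (\<integral>\<^sup>+s. f (shift (- s) \<omega>, s) \<partial>lam) \<partial>m) =
    (\<integral>\<^sup>+\<omega>. (\<integral>\<^sup>+s. f (\<omega>, s) * indicator {0<..} (nv \<omega> s) \<partial>lam) \<partial>N)"
proof -
  have "(\<integral>\<^sup>+\<omega>. (\<integral>\<^sup>+s. f (shift (- s) \<omega>, s) \<partial>lam) \<partial>m) = (\<integral>\<^sup>+s. (\<integral>\<^sup>+\<omega>. f (shift (- s) \<omega>, s) \<partial>m) \<partial>lam)"
    by (rule mlam.Fubini'[symmetric]) measurable
  also have "\<dots> = (\<integral>\<^sup>+s. (\<integral>\<^sup>+\<omega>. f (\<omega>, s) * indicator {0<..} (nv \<omega> s) \<partial>N) \<partial>lam)"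
  proof (rule nn_integral_cong)
    fix s
    have "(\<integral>\<^sup>+\<omega>. f (shift (- s) \<omega>, s) \<partial>m) = (\<integral>\<^sup>+\<omega>. indicator {0<..} (nv \<omega> 0) * f (shift (- s) \<omega>, s) \<partial>N)"
      by (rule nn_integral_N_pos[symmetric]) measurable
    also have "\<dots> = (\<integral>\<^sup>+\<omega>. f (shift (- s) \<omega>, s) * indicator {0<..} (nv (shift (- s) \<omega>) s) \<partial>N)"
      by (simp add: nv_shift mult.commute)
    also have "\<dots> = (\<integral>\<^sup>+\<omega>. f (\<omega>, s) * indicator {0<..} (nv \<omega> s) \<partial>N)"
      by (rule nn_integral_N_shift) measurable
    finally show "(\<integral>\<^sup>+\<omega>. f (shift (- s) \<omega>, s) \<partial>m) = (\<integral>\<^sup>+\<omega>. f (\<omega>, s) * indicator {0<..} (nv \<omega> s) \<partial>N)" .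
  qed
  also have "\<dots> = (\<integral>\<^sup>+\<omega>. (\<integral>\<^sup>+s. f (\<omega>, s) * indicator {0<..} (nv \<omega> s) \<partial>lam) \<partial>N)"
    by (rule Nlam.Fubini') measurable
  finally show ?thesis .
qed

text \<open>Normalization conditions are stated along shifts by \<open>t\<close>, whereas the
  transfer from \<open>m\<close> shifts by \<open>- s\<close>; inversion invariance reconciles the
  two.\<close>

lemma AE_shift_uminus:
  assumes [measurable]: "Measurable.pred F P" "\<omega> \<in> space F" and "AE t in lam. P (shift t \<omega>)"
  shows "AE t in lam. P (shift (- t) \<omega>)"
proof -
  have "(AE t in distr lam borel uminus. P (shift t \<omega>)) \<longleftrightarrow> (AE t in lam. P (shift (- t) \<omega>))"
    by (rule AE_distr_iff) measurable
  then show ?thesis using assms(3) unfolding haar.distr_uminus by simp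
qed

text \<open>Homogeneity removes the scaling variable, so the exceptional set has no mass under the
  shifts of \<open>m\<close>. By \<open>transfer_N\<close>, almost every exceptional path has
  positive modulus on a null set of positions only, while \<open>N\<close>-almost every path is
  full.\<close>

lemma AE_N_transfer:
  assumes [measurable]: "Measurable.pred F P"
    and hom: "\<And>\<omega> u. \<omega> \<in> space F \<Longrightarrow> 0 < u \<Longrightarrow> P (sc u \<omega>) \<longleftrightarrow> P \<omega>"
    and ae: "AE \<omega> in Q'. AE t in lam. P (shift t \<omega>)"
  shows "AE \<omega> in N. P \<omega>"
proof -
  let ?Z = "{\<omega> \<in> space F. \<not> P \<omega>}"
  have "(\<integral>\<^sup>+\<omega>. (\<integral>\<^sup>+s. indicator ?Z (shift (- s) \<omega>) \<partial>lam) \<partial>m) =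
      (\<integral>\<^sup>+\<omega>. (\<integral>\<^sup>+u. (\<integral>\<^sup>+s. indicator ?Z (shift (- s) (sc u \<omega>)) \<partial>lam) \<partial>rho) \<partial>Q')"
    by (rule nn_integral_m) measurable
  also have "\<dots> = (\<integral>\<^sup>+\<omega>. 0 \<partial>Q')"
  proof (rule nn_integral_cong_AE)
    show "AE \<omega> in Q'. (\<integral>\<^sup>+u. (\<integral>\<^sup>+s. indicator ?Z (shift (- s) (sc u \<omega>)) \<partial>lam) \<partial>rho) = 0"
      using ae AE_space
    proof eventually_elim
      case (elim \<omega>)
      then have \<omega>: "\<omega> \<in> space F" by simp
      from AE_shift_uminus[OF assms(1) this elim(1)]
      have s: "AE s in lam. P (shift (- s) \<omega>)" .
      have z: "(\<integral>\<^sup>+s. indicator ?Z (shift (- s) (sc u \<omega>)) \<partial>lam) = 0" if "0 < u" for u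
      proof -
        have "(\<integral>\<^sup>+s. indicator ?Z (shift (- s) (sc u \<omega>)) \<partial>lam) = (\<integral>\<^sup>+s. 0 \<partial>lam)"
          using s by (intro nn_integral_cong_AE, eventually_elim) (simp add: shift_sc hom \<omega> that)
        then show ?thesis by simp
      qed
      have "(\<integral>\<^sup>+u. (\<integral>\<^sup>+s. indicator ?Z (shift (- s) (sc u \<omega>)) \<partial>lam) \<partial>rho) = (\<integral>\<^sup>+u. 0 \<partial>rho)"
        using AE_rho by (intro nn_integral_cong_AE, eventually_elim) (rule z)
      then show ?case by simp
    qed
  qed
  finally have "(\<integral>\<^sup>+\<omega>. (\<integral>\<^sup>+s. indicator ?Z \<omega> * indicator {0<..} (nv \<omega> s) \<partial>lam) \<partial>N) = 0"
    using transfer_N[of "\<lambda>(\<omega>, s). indicator ?Z \<omega>"] by simp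
  then have "AE \<omega> in N. (\<integral>\<^sup>+s. indicator ?Z \<omega> * indicator {0<..} (nv \<omega> s) \<partial>lam) = 0"
    by (subst (asm) nn_integral_0_iff_AE) simp_all
  then show ?thesis using AE_N_full AE_space
  proof eventually_elim
    case (elim \<omega>)
    then have [measurable]: "\<omega> \<in> space F" by simp
    have "indicator ?Z \<omega> * (\<integral>\<^sup>+s. indicator {0<..} (nv \<omega> s) \<partial>lam) = 0"
      using elim(1) by (subst (asm) nn_integral_cmult) simp_all
    then have "indicator ?Z \<omega> = (0::ennreal)" using elim(2) by (auto simp: full_def)
    then show ?case using \<open>\<omega> \<in> space F\<close> by (auto simp: indicator_def split: if_splits)
  qed
qed

definition phi :: "(('a \<Rightarrow> 'b) \<times> 'a \<Rightarrow> ennreal) \<Rightarrow> ('a \<Rightarrow> 'b) \<Rightarrow> ennreal" where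
  "phi H \<omega> = (\<integral>\<^sup>+s. H (\<omega>, s) * indicator {0<..} (nv \<omega> s) \<partial>lam)"

lemma measurable_phi:
  assumes [measurable]: "H \<in> borel_measurable (F \<Otimes>\<^sub>M borel)"
  shows "phi H \<in> borel_measurable F"
  unfolding phi_def[abs_def] by measurable

text \<open>Inserting \<open>phi H = 1\<close> and transferring to \<open>m\<close> moves the shift
  into the integrand; after splitting \<open>m\<close> into \<open>Q'\<close> and
  \<open>rho\<close>, homogeneity leaves \<open>u\<close> only in the indicator. Both explicit
  formulas and uniqueness arise from special choices of \<open>H\<close>.\<close>

lemma emeasure_N_formula:
  assumes H [measurable]: "H \<in> borel_measurable (F \<Otimes>\<^sub>M borel)"
    and hom: "\<And>\<omega> u s. \<omega> \<in> space F \<Longrightarrow> 0 < u \<Longrightarrow> H (sc u \<omega>, s) = H (\<omega>, s)"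
    and ae: "AE \<omega> in N. phi H \<omega> = 1"
    and [measurable]: "A \<in> sets F"
  shows "emeasure N A = (\<integral>\<^sup>+\<omega>. (\<integral>\<^sup>+s. (\<integral>\<^sup>+u. indicator A (sc u (shift (- s) \<omega>)) * H (shift (- s) \<omega>, s) \<partial>rho) \<partial>lam) \<partial>Q')"
proof -
  interpret lr: pair_sigma_finite lam rho by unfold_locales
  note [measurable] = measurable_phi[OF H]
  have "emeasure N A = (\<integral>\<^sup>+\<omega>. indicator A \<omega> * phi H \<omega> \<partial>N)"
    using ae by (subst nn_integral_indicator[symmetric], simp, intro nn_integral_cong_AE, eventually_elim) simp
  also have "\<dots> = (\<integral>\<^sup>+\<omega>. (\<integral>\<^sup>+s. (indicator A \<omega> * H (\<omega>, s)) * indicator {0<..} (nv \<omega> s) \<partial>lam) \<partial>N)"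
    unfolding phi_def mult.assoc by (intro nn_integral_cong nn_integral_cmult[symmetric]) simp
  also have "\<dots> = (\<integral>\<^sup>+\<omega>. (\<integral>\<^sup>+s. indicator A (shift (- s) \<omega>) * H (shift (- s) \<omega>, s) \<partial>lam) \<partial>m)"
    using transfer_N[of "\<lambda>(\<omega>, s). indicator A \<omega> * H (\<omega>, s)"] by simp
  also have "\<dots> = (\<integral>\<^sup>+\<omega>. (\<integral>\<^sup>+u. (\<integral>\<^sup>+s. indicator A (shift (- s) (sc u \<omega>)) * H (shift (- s) (sc u \<omega>), s) \<partial>lam) \<partial>rho) \<partial>Q')"
    by (rule nn_integral_m) measurable
  also have "\<dots> = (\<integral>\<^sup>+\<omega>. (\<integral>\<^sup>+u. (\<integral>\<^sup>+s. indicator A (sc u (shift (- s) \<omega>)) * H (shift (- s) \<omega>, s) \<partial>lam) \<partial>rho) \<partial>Q')"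
  proof (rule nn_integral_cong)
    fix \<omega> assume "\<omega> \<in> space Q'"
    then have z: "(\<integral>\<^sup>+s. indicator A (shift (- s) (sc u \<omega>)) * H (shift (- s) (sc u \<omega>), s) \<partial>lam) =
      (\<integral>\<^sup>+s. indicator A (sc u (shift (- s) \<omega>)) * H (shift (- s) \<omega>, s) \<partial>lam)" if "0 < u" for u
      using that by (simp add: shift_sc hom)
    show "(\<integral>\<^sup>+u. (\<integral>\<^sup>+s. indicator A (shift (- s) (sc u \<omega>)) * H (shift (- s) (sc u \<omega>), s) \<partial>lam) \<partial>rho) =
      (\<integral>\<^sup>+u. (\<integral>\<^sup>+s. indicator A (sc u (shift (- s) \<omega>)) * H (shift (- s) \<omega>, s) \<partial>lam) \<partial>rho)"
      using AE_rho by (intro nn_integral_cong_AE, eventually_elim) (rule z)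
  qed
  also have "\<dots> = (\<integral>\<^sup>+\<omega>. (\<integral>\<^sup>+s. (\<integral>\<^sup>+u. indicator A (sc u (shift (- s) \<omega>)) * H (shift (- s) \<omega>, s) \<partial>rho) \<partial>lam) \<partial>Q')"
    by (intro nn_integral_cong lr.Fubini') simp
  finally show ?thesis .
qed

end

section \<open>The formula for homogeneous \<open>H\<close>, uniqueness and a moment bound\<close>

context palm_inverse
begin

lemma nn_integral_rho_scale_form:
  assumes [measurable]: "\<omega> \<in> space F" "A \<in> sets F"
  shows "(\<integral>\<^sup>+u\<in>{0<..}. indicator A (scale scal u \<omega>) * c * ennreal (\<alpha> * u powr (- \<alpha> - 1)) \<partial>lborel) =
    (\<integral>\<^sup>+u. indicator A (sc u \<omega>) * c \<partial>rho)"
proof -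
  have "(\<integral>\<^sup>+u. indicator A (sc u \<omega>) * c \<partial>rho) =
      (\<integral>\<^sup>+u\<in>{0<..}. indicator A (sc u \<omega>) * c * ennreal (\<alpha> * u powr (- \<alpha> - 1)) \<partial>lborel)"
    by (rule nn_integral_rho) measurable
  also have "\<dots> = (\<integral>\<^sup>+u\<in>{0<..}. indicator A (scale scal u \<omega>) * c * ennreal (\<alpha> * u powr (- \<alpha> - 1)) \<partial>lborel)"
    by (intro nn_integral_cong) (auto simp: indicator_def sc_pos)
  finally show ?thesis ..
qed

text \<open>The left side is the integral in the normalization condition of formula (b), so that
  condition says \<open>phi H = 1\<close> along the shifts of \<open>W\<close>.\<close>

lemma phi_shift:
  assumes [measurable]: "H \<in> borel_measurable (F \<Otimes>\<^sub>M borel)" "\<omega> \<in> space F"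
  shows "(\<integral>\<^sup>+s. H (shift t \<omega>, s - t) * indicator {s. 0 < nrm (\<omega> s)} s \<partial>lam) = phi H (shift t \<omega>)"
proof -
  have "(\<integral>\<^sup>+s. H (shift t \<omega>, s + t + - t) * indicator {0<..} (nv \<omega> (s + t)) \<partial>lam) =
      (\<integral>\<^sup>+s. H (shift t \<omega>, s + - t) * indicator {0<..} (nv \<omega> s) \<partial>lam)"
    by (rule haar.nn_integral_add) measurable
  moreover have "(\<integral>\<^sup>+s. H (shift t \<omega>, s - t) * indicator {s. 0 < nrm (\<omega> s)} s \<partial>lam) =
      (\<integral>\<^sup>+s. H (shift t \<omega>, s + - t) * indicator {0<..} (nv \<omega> s) \<partial>lam)"
    by (intro nn_integral_cong) (simp add: indicator_def nv_def)
  ultimately show ?thesis by (simp add: phi_def nv_shift)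
qed

lemma AE_Wproc_space: "AE \<omega> in Q. Wproc scal nrm x0 \<omega> \<in> space F"
  using AE_Q_pos AE_space by eventually_elim (simp add: Wproc_eq normalize_def)

text \<open>The inner almost-everywhere statement is encoded as the vanishing of a measurable
  function \<open>b\<close> of the path, to which the transfer for measurable predicates applies.
  The encoding is valid on the function space, where \<open>Wproc\<close> lies almost
  surely.\<close>

lemma AE_Wproc_lam:
  assumes [measurable]: "Measurable.pred (F \<Otimes>\<^sub>M borel) (\<lambda>(\<omega>, t). P \<omega> t)"
  shows "(AE \<omega> in Q. AE t in lam. P (Wproc scal nrm x0 \<omega>) t) \<longleftrightarrow> (AE \<omega> in Q'. AE t in lam. P \<omega> t)"
proof -
  define b where "b \<omega> = (\<integral>\<^sup>+t. indicator {p \<in> space (F \<Otimes>\<^sub>M borel). \<not> (\<lambda>(\<omega>, t). P \<omega> t) p} (\<omega>, t) \<partial>lam)" for \<omega>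
  have [measurable]: "b \<in> borel_measurable F" unfolding b_def by measurable
  have b: "(AE t in lam. P \<omega> t) \<longleftrightarrow> b \<omega> = 0" if sp [measurable]: "\<omega> \<in> space F" for \<omega>
    unfolding b_def by (subst nn_integral_0_iff_AE) (simp_all add: indicator_def space_pair_measure sp)
  have "(AE \<omega> in Q. AE t in lam. P (Wproc scal nrm x0 \<omega>) t) \<longleftrightarrow> (AE \<omega> in Q. b (Wproc scal nrm x0 \<omega>) = 0)"
  proof
    assume "AE \<omega> in Q. AE t in lam. P (Wproc scal nrm x0 \<omega>) t"
    with AE_Wproc_space show "AE \<omega> in Q. b (Wproc scal nrm x0 \<omega>) = 0"
      by eventually_elim (simp add: b)
  next
    assume "AE \<omega> in Q. b (Wproc scal nrm x0 \<omega>) = 0"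
    with AE_Wproc_space show "AE \<omega> in Q. AE t in lam. P (Wproc scal nrm x0 \<omega>) t"
      by eventually_elim (simp add: b)
  qed
  also have "\<dots> \<longleftrightarrow> (AE \<omega> in Q'. b \<omega> = 0)" by (rule AE_Wproc) measurable
  also have "\<dots> \<longleftrightarrow> (AE \<omega> in Q'. AE t in lam. P \<omega> t)"
    by (intro AE_cong) (simp add: b)
  finally show ?thesis .
qed

lemma formula_H:
  assumes H [measurable]: "H \<in> borel_measurable (F \<Otimes>\<^sub>M borel)"
    and hom: "\<forall>\<omega>\<in>space F. \<forall>u>0. \<forall>s. H (scale scal u \<omega>, s) = H (\<omega>, s)"
    and ae: "AE \<omega> in Q. AE t in lam.
      (\<integral>\<^sup>+s. H (shift t (Wproc scal nrm x0 \<omega>), s - t) * indicator {s. 0 < nrm (Wproc scal nrm x0 \<omega> s)} s \<partial>lam) = 1"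
    and [measurable]: "A \<in> sets F"
  shows "emeasure N A = (\<integral>\<^sup>+\<omega>. (\<integral>\<^sup>+s. (\<integral>\<^sup>+u\<in>{0<..}.
      indicator A (scale scal u (shift (- s) (Wproc scal nrm x0 \<omega>)))
      * H (shift (- s) (Wproc scal nrm x0 \<omega>), s)
      * ennreal (\<alpha> * u powr (- \<alpha> - 1)) \<partial>lborel) \<partial>lam) \<partial>Q)"
proof -
  note [measurable] = measurable_phi[OF H]
  have hom': "H (sc u \<omega>, s) = H (\<omega>, s)" if "\<omega> \<in> space F" "0 < u" for \<omega> u s
    using hom that by (simp add: sc_pos)
  have phi_sc: "phi H (sc u \<omega>) = phi H \<omega>" if "\<omega> \<in> space F" "0 < u" for \<omega> u
    using that by (simp add: phi_def hom' nv_sc indicator_def zero_less_mult_iff)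
  have "AE \<omega> in Q. AE t in lam. phi H (shift t (Wproc scal nrm x0 \<omega>)) = 1"
    using ae AE_Wproc_space by eventually_elim (simp add: phi_shift)
  then have "AE \<omega> in Q'. AE t in lam. phi H (shift t \<omega>) = 1"
    by (subst (asm) AE_Wproc_lam) simp_all
  \<comment> \<open>Homogeneity of \<open>phi H\<close> lets the normalization pass from the
    normalized paths to \<open>N\<close>.\<close>
  then have "AE \<omega> in N. phi H \<omega> = 1"
    by (intro AE_N_transfer) (simp_all add: phi_sc)
  then have "emeasure N A =
      (\<integral>\<^sup>+\<omega>. (\<integral>\<^sup>+s. (\<integral>\<^sup>+u. indicator A (sc u (shift (- s) \<omega>)) * H (shift (- s) \<omega>, s) \<partial>rho) \<partial>lam) \<partial>Q')"
    by (intro emeasure_N_formula) (simp_all add: hom')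
  also have "\<dots> = (\<integral>\<^sup>+\<omega>. (\<integral>\<^sup>+s. (\<integral>\<^sup>+u. indicator A (sc u (shift (- s) (Wproc scal nrm x0 \<omega>))) *
      H (shift (- s) (Wproc scal nrm x0 \<omega>), s) \<partial>rho) \<partial>lam) \<partial>Q)"
    by (rule nn_integral_Wproc[symmetric]) measurable
  also have "\<dots> = (\<integral>\<^sup>+\<omega>. (\<integral>\<^sup>+s. (\<integral>\<^sup>+u\<in>{0<..}.
      indicator A (scale scal u (shift (- s) (Wproc scal nrm x0 \<omega>)))
      * H (shift (- s) (Wproc scal nrm x0 \<omega>), s)
      * ennreal (\<alpha> * u powr (- \<alpha> - 1)) \<partial>lborel) \<partial>lam) \<partial>Q)"
    using AE_Wproc_space by (intro nn_integral_cong_AE, eventually_elim)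
      (simp add: nn_integral_rho_scale_form)
  finally show ?thesis .
qed

text \<open>The choice \<open>H (\<omega>, s) = k s / pk k \<omega>\<close>. As the right side does
  not mention \<open>N\<close>, it determines \<open>N\<close>.\<close>

lemma weight_formula:
  assumes k: "weight k" and [measurable]: "A \<in> sets F"
  shows "emeasure N A = (\<integral>\<^sup>+\<omega>. (\<integral>\<^sup>+s. (\<integral>\<^sup>+u. indicator A (sc u (shift (- s) \<omega>)) *
    (k s / pk k (shift (- s) \<omega>)) \<partial>rho) \<partial>lam) \<partial>Q')"
proof -
  note [measurable] = weight_measurable[OF k]
  note [measurable (raw)] = measurable_pk[OF k]
  define H where "H = (\<lambda>(\<omega>, s). k s / pk k \<omega>)"
  have [measurable]: "H \<in> borel_measurable (F \<Otimes>\<^sub>M borel)" unfolding H_def by measurable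
  have "AE \<omega> in N. phi H \<omega> = 1"
    using AE_N_full AE_space
  proof eventually_elim
    case (elim \<omega>)
    then have [measurable]: "\<omega> \<in> space F" by simp
    have "phi H \<omega> = (\<integral>\<^sup>+s. inverse (pk k \<omega>) * (k s * indicator {0<..} (nv \<omega> s)) \<partial>lam)"
      by (simp add: phi_def H_def divide_ennreal_def mult_ac)
    also have "\<dots> = inverse (pk k \<omega>) * pk k \<omega>"
      unfolding pk_def by (rule nn_integral_cmult) measurable
    also have "\<dots> = 1"
      using pk_pos[OF k] pk_finite[OF k] elim by (intro ennreal_inverse_self) auto
    finally show ?case .
  qed
  then show ?thesis
    using emeasure_N_formula[of H A] by (simp add: H_def pk_sc)
qed

lemma nn_integral_rho_indicator:
  assumes "0 \<le> c"
  shows "(\<integral>\<^sup>+u. indicator {1<..} (c * u) \<partial>rho) = ennreal (c powr \<alpha>)"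
proof (cases "c = 0")
  case False
  then show ?thesis
    using assms by (subst nn_integral_rho_scale) (simp_all add: emeasure_rho_greater_one)
qed simp

text \<open>The \<open>\<alpha>\<close>-th power of \<open>|Y_r|\<close> is the
  \<open>rho\<close>-mass of \<open>{u. 1 < u * |Y_r|}\<close>, so its expectation is the
  \<open>m\<close>-mass of \<open>{1 < |Y_r|}\<close>. This is at most the \<open>N\<close>-mass of
  the same event, which is 1 by stationarity.\<close>

lemma moment_le_one: "(\<integral>\<^sup>+\<omega>. ennreal (nv \<omega> r powr \<alpha>) \<partial>Q') \<le> 1"
proof -
  have "(\<integral>\<^sup>+\<omega>. ennreal (nv \<omega> r powr \<alpha>) \<partial>Q') = (\<integral>\<^sup>+\<omega>. (\<integral>\<^sup>+u. indicator {1<..} (nv (sc u \<omega>) r) \<partial>rho) \<partial>Q')"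
  proof (rule nn_integral_cong)
    fix \<omega>
    have "ennreal (nv \<omega> r powr \<alpha>) = (\<integral>\<^sup>+u. indicator {1<..} (nv \<omega> r * u) \<partial>rho)"
      by (simp add: nn_integral_rho_indicator)
    also have "\<dots> = (\<integral>\<^sup>+u. indicator {1<..} (nv (sc u \<omega>) r) \<partial>rho)"
      using AE_rho by (intro nn_integral_cong_AE, eventually_elim) (simp add: nv_sc mult.commute)
    finally show "ennreal (nv \<omega> r powr \<alpha>) = (\<integral>\<^sup>+u. indicator {1<..} (nv (sc u \<omega>) r) \<partial>rho)" .
  qed
  also have "\<dots> = (\<integral>\<^sup>+\<omega>. indicator {1<..} (nv \<omega> r) \<partial>m)"
    by (rule nn_integral_m[symmetric]) measurable
  also have "\<dots> = (\<integral>\<^sup>+\<omega>. indicator {0<..} (nv \<omega> 0) * indicator {1<..} (nv \<omega> r) \<partial>N)"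
    by (rule nn_integral_N_pos[symmetric]) measurable
  also have "\<dots> \<le> (\<integral>\<^sup>+\<omega>. indicator {1<..} (nv (shift r \<omega>) 0) \<partial>N)"
    by (intro nn_integral_mono) (simp add: nv_shift indicator_def)
  also have "\<dots> = (\<integral>\<^sup>+\<omega>. indicator {1<..} (nv \<omega> 0) * 1 \<partial>N)"
    using nn_integral_N_shift[of "\<lambda>\<omega>. indicator {1<..} (nv \<omega> 0)" r] by simp
  also have "\<dots> = (\<integral>\<^sup>+\<omega>. 1 \<partial>Q)" by (rule nn_integral_Q_N) measurable
  also have "\<dots> = 1" using Q.emeasure_space_1 by simp
  finally show ?thesis .
qed

end

section \<open>The formula for a probability density \<open>G\<close>\<close>

locale palm_inverse_weighted = palm_inverse +
  fixes G :: "'a \<Rightarrow> real"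
  assumes G_measurable [measurable]: "G \<in> borel_measurable borel"
    and G_pos: "\<And>s. 0 < G s"
    and G_int: "(\<integral>\<^sup>+s. ennreal (G s) \<partial>lam) = 1"
begin

definition J :: "('a \<Rightarrow> 'b) \<Rightarrow> ennreal" where
  "J \<omega> = (\<integral>\<^sup>+s. ennreal (nv \<omega> s powr \<alpha>) * ennreal (G s) \<partial>lam)"

lemma JG_eq: "JG lam nrm \<alpha> G \<omega> = J \<omega>"
  by (simp add: JG_def J_def nv_def ennreal_mult')

lemma measurable_J [measurable]: "J \<in> borel_measurable F"
  unfolding J_def[abs_def] by measurable

lemma J_sc:
  assumes [measurable]: "\<omega> \<in> space F" and u: "0 < u"
  shows "J (sc u \<omega>) = ennreal (u powr \<alpha>) * J \<omega>"
proof -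
  have "J (sc u \<omega>) = (\<integral>\<^sup>+s. ennreal (u powr \<alpha>) * (ennreal (nv \<omega> s powr \<alpha>) * ennreal (G s)) \<partial>lam)"
    unfolding J_def using u by (simp add: nv_sc powr_mult ennreal_mult mult.assoc)
  also have "\<dots> = ennreal (u powr \<alpha>) * J \<omega>"
    unfolding J_def by (rule nn_integral_cmult) measurable
  finally show ?thesis .
qed

lemma J_pos:
  assumes [measurable]: "\<omega> \<in> space F" and "full \<omega>"
  shows "0 < J \<omega>"
proof (rule ccontr)
  assume "\<not> 0 < J \<omega>"
  then have "(\<integral>\<^sup>+s. ennreal (nv \<omega> s powr \<alpha>) * ennreal (G s) \<partial>lam) = 0" by (simp add: J_def)
  then have "AE s in lam. ennreal (nv \<omega> s powr \<alpha>) * ennreal (G s) = 0"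
    by (subst (asm) nn_integral_0_iff_AE) auto
  then have "AE s in lam. indicator {0<..} (nv \<omega> s) = (0::ennreal)"
  proof eventually_elim
    case (elim s)
    then have "nv \<omega> s powr \<alpha> = 0"
      using G_pos[of s] by (auto simp: ennreal_eq_0_iff)
    then show ?case by simp
  qed
  then have "(\<integral>\<^sup>+s. indicator {0<..} (nv \<omega> s) \<partial>lam) = 0"
    by (subst nn_integral_0_iff_AE) auto
  then show False using assms(2) by (simp add: full_def)
qed

lemma J_shift_le_one: "(\<integral>\<^sup>+\<omega>. J (shift t \<omega>) \<partial>Q') \<le> 1"
proof -
  interpret lQ': pair_sigma_finite lam Q' by unfold_locales
  have "(\<integral>\<^sup>+\<omega>. J (shift t \<omega>) \<partial>Q') = (\<integral>\<^sup>+\<omega>. (\<integral>\<^sup>+s. ennreal (nv (shift t \<omega>) s powr \<alpha>) * ennreal (G s) \<partial>lam) \<partial>Q')"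
    by (simp add: J_def)
  also have "\<dots> = (\<integral>\<^sup>+s. (\<integral>\<^sup>+\<omega>. ennreal (nv (shift t \<omega>) s powr \<alpha>) * ennreal (G s) \<partial>Q') \<partial>lam)"
    by (rule lQ'.Fubini') measurable
  also have "\<dots> = (\<integral>\<^sup>+s. (\<integral>\<^sup>+\<omega>. ennreal (nv (shift t \<omega>) s powr \<alpha>) \<partial>Q') * ennreal (G s) \<partial>lam)"
    by (intro nn_integral_cong nn_integral_multc) measurable
  also have "\<dots> \<le> (\<integral>\<^sup>+s. 1 * ennreal (G s) \<partial>lam)"
    by (intro nn_integral_mono mult_right_mono) (simp_all add: nv_shift moment_le_one)
  also have "\<dots> = 1" by (simp add: G_int)
  finally show ?thesis .
qed

text \<open>For each \<open>t\<close> the bound on the mean gives finiteness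
  \<open>Q'\<close>-almost surely; Fubini exchanges the two almost-everywhere quantifiers.\<close>

lemma AE_J_finite: "AE \<omega> in Q'. AE t in lam. J (shift t \<omega>) < \<infinity>"
proof -
  interpret Q'l: pair_sigma_finite Q' lam by unfold_locales
  have "AE \<omega> in Q'. J (shift t \<omega>) < \<infinity>" for t
  proof -
    have "(\<integral>\<^sup>+\<omega>. J (shift t \<omega>) \<partial>Q') \<noteq> \<infinity>" using J_shift_le_one[of t] by (auto simp: top_unique)
    from nn_integral_PInf_AE[OF _ this] show ?thesis by (simp add: less_top)
  qed
  then have ae: "AE t in lam. AE \<omega> in Q'. J (shift t \<omega>) < \<infinity>" by simp
  have "{p \<in> space (Q' \<Otimes>\<^sub>M lam). J (shift (snd p) (fst p)) < \<infinity>} \<in> sets (Q' \<Otimes>\<^sub>M lam)"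
    by measurable
  from Q'l.AE_commute[OF this] ae show ?thesis by blast
qed

lemma AE_N_J_finite: "AE \<omega> in N. J \<omega> < \<infinity>"
  by (rule AE_N_transfer[OF _ _ AE_J_finite]) (auto simp: J_sc ennreal_mult_less_top)

lemma AE_J_uminus: "AE \<omega> in Q'. AE s in lam. 0 < J (shift (- s) \<omega>) \<and> J (shift (- s) \<omega>) < \<infinity>"
  using AE_J_finite AE_Q'_full AE_space
proof eventually_elim
  case (elim \<omega>)
  have "AE s in lam. J (shift (- s) \<omega>) < \<infinity>"
    by (rule AE_shift_uminus[OF _ _ elim(1)]) (use elim in simp_all)
  then show ?case by eventually_elim (use elim(2,3) in \<open>simp add: J_pos full_shift\<close>)
qed

text \<open>The rescaling that achieves \<open>J (T \<omega>) = 1\<close> when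
  \<open>0 < J \<omega> < \<infinity>\<close>. Otherwise the factor is 0, which \<open>sc\<close>
  replaces by 1, so \<open>T\<close> is measurable on the whole function space.\<close>

definition T :: "('a \<Rightarrow> 'b) \<Rightarrow> 'a \<Rightarrow> 'b" where
  "T \<omega> = sc (enn2real (J \<omega>) powr (- 1 / \<alpha>)) \<omega>"

lemma measurable_T [measurable]: "T \<in> measurable F F"
  unfolding T_def[abs_def] by measurable

lemma T_eq:
  assumes "0 < J \<omega>" "J \<omega> < \<infinity>"
  shows "scale scal (enn2real (JG lam nrm \<alpha> G \<omega>) powr (- 1 / \<alpha>)) \<omega> = T \<omega>"
proof -
  have "0 < enn2real (J \<omega>)" using assms by (simp add: enn2real_positive_iff)
  then have "0 < enn2real (J \<omega>) powr (- 1 / \<alpha>)" by simp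
  then show ?thesis by (simp only: JG_eq T_def sc_pos)
qed

definition D :: "('a \<Rightarrow> 'b) measure" where
  "D = distr (density (Q' \<Otimes>\<^sub>M lam) (\<lambda>p. ennreal (G (snd p)))) F (\<lambda>p. T (shift (- snd p) (fst p)))"

lemma sets_D [simp, measurable_cong]: "sets D = sets F"
  by (simp add: D_def)

lemma space_D [simp]: "space D = space F"
  by (simp add: D_def)

lemma nn_integral_D:
  assumes [measurable]: "f \<in> borel_measurable F"
  shows "(\<integral>\<^sup>+\<omega>. f \<omega> \<partial>D) = (\<integral>\<^sup>+\<omega>. (\<integral>\<^sup>+s. f (T (shift (- s) \<omega>)) * ennreal (G s) \<partial>lam) \<partial>Q')"
proof -
  have "(\<integral>\<^sup>+\<omega>. f \<omega> \<partial>D) = (\<integral>\<^sup>+p. ennreal (G (snd p)) * f (T (shift (- snd p) (fst p))) \<partial>(Q' \<Otimes>\<^sub>M lam))"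
    unfolding D_def by (subst nn_integral_distr, measurable, subst nn_integral_density) simp_all
  also have "\<dots> = (\<integral>\<^sup>+\<omega>. (\<integral>\<^sup>+s. ennreal (G s) * f (T (shift (- s) \<omega>)) \<partial>lam) \<partial>Q')"
    by (subst haar.nn_integral_fst[symmetric]) simp_all
  finally show ?thesis by (simp add: mult.commute)
qed

text \<open>\<open>measure_of\<close> returns the prescribed set function only if that function is
  countably additive. Here it coincides with the image measure \<open>D\<close>, since the default
  values of the scaling factor occur on a null set.\<close>

lemma QG_eq: "QG lam F scal nrm x0 \<alpha> Q G = D"
proof -
  have "QG lam F scal nrm x0 \<alpha> Q G = measure_of (space F) (sets F) (emeasure D)"
    unfolding QG_def
  proof (rule measure_of_eq)
    show "sets F \<subseteq> Pow (space F)" by (rule sets.space_closed)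
    fix A assume "A \<in> sigma_sets (space F) (sets F)"
    then have [measurable]: "A \<in> sets F" by (simp add: sets.sigma_sets_eq)
    have ae: "AE \<omega> in Q. AE s in lam. 0 < J (shift (- s) (Wproc scal nrm x0 \<omega>)) \<and> J (shift (- s) (Wproc scal nrm x0 \<omega>)) < \<infinity>"
      using AE_J_uminus by (subst AE_Wproc_lam) simp_all
    have "(\<integral>\<^sup>+\<omega>. (\<integral>\<^sup>+s. (let w = shift (- s) (Wproc scal nrm x0 \<omega>) in
           indicator A (scale scal (enn2real (JG lam nrm \<alpha> G w) powr (- 1 / \<alpha>)) w)) * ennreal (G s) \<partial>lam) \<partial>Q) =
        (\<integral>\<^sup>+\<omega>. (\<integral>\<^sup>+s. indicator A (T (shift (- s) (Wproc scal nrm x0 \<omega>))) * ennreal (G s) \<partial>lam) \<partial>Q)"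
    proof (rule nn_integral_cong_AE, goal_cases)
      case 1
      from ae show ?case
      proof eventually_elim
        case (elim \<omega>)
        show ?case
        proof (rule nn_integral_cong_AE, goal_cases)
          case 1
          from elim show ?case by eventually_elim (simp only: Let_def T_eq)
        qed
      qed
    qed
    also have "\<dots> = (\<integral>\<^sup>+\<omega>. (\<integral>\<^sup>+s. indicator A (T (shift (- s) \<omega>)) * ennreal (G s) \<partial>lam) \<partial>Q')"
      by (rule nn_integral_Wproc) measurable
    also have "\<dots> = emeasure D A"
      by (subst nn_integral_D[symmetric]) simp_all
    finally show "(\<integral>\<^sup>+\<omega>. (\<integral>\<^sup>+s. (let w = shift (- s) (Wproc scal nrm x0 \<omega>) in
           indicator A (scale scal (enn2real (JG lam nrm \<alpha> G w) powr (- 1 / \<alpha>)) w)) * ennreal (G s) \<partial>lam) \<partial>Q) =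
        emeasure D A" .
  qed
  also have "\<dots> = D" using measure_of_of_measure[of D] by simp
  finally show ?thesis .
qed

text \<open>The path is scaled by \<open>J \<omega> powr (- 1 / \<alpha>)\<close>, and integration
  over \<open>rho\<close> turns this into its \<open>\<alpha>\<close>-th power, the inverse of
  \<open>J \<omega>\<close>.\<close>

lemma nn_integral_T:
  assumes [measurable]: "\<omega> \<in> space F" "A \<in> sets F" and J: "0 < J \<omega>" "J \<omega> < \<infinity>"
  shows "(\<integral>\<^sup>+u. indicator A (sc u (T \<omega>)) \<partial>rho) = inverse (J \<omega>) * (\<integral>\<^sup>+u. indicator A (sc u \<omega>) \<partial>rho)"
proof -
  define j where "j = enn2real (J \<omega>)"
  define c where "c = j powr (- 1 / \<alpha>)"
  have j: "0 < j" "J \<omega> = ennreal j" using J by (simp_all add: j_def enn2real_positive_iff less_top)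
  then have c: "0 < c" by (simp add: c_def)
  have T: "T \<omega> = sc c \<omega>" by (simp add: T_def c_def j_def)
  have "(\<integral>\<^sup>+u. indicator A (sc u (T \<omega>)) \<partial>rho) = (\<integral>\<^sup>+u. indicator A (sc (c * u) \<omega>) \<partial>rho)"
    using AE_rho by (intro nn_integral_cong_AE, eventually_elim) (simp add: T sc_sc c mult.commute)
  also have "\<dots> = ennreal (c powr \<alpha>) * (\<integral>\<^sup>+u. indicator A (sc u \<omega>) \<partial>rho)"
    by (rule nn_integral_rho_scale[OF _ c]) measurable
  also have "c powr \<alpha> = j powr (- 1 / \<alpha> * \<alpha>)" by (simp only: c_def powr_powr)
  also have "\<dots> = inverse j" using alpha j by (simp add: powr_minus)
  also have "ennreal (inverse j) = inverse (J \<omega>)" using j by (simp add: inverse_ennreal)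
  finally show ?thesis .
qed

lemma formula_G:
  assumes [measurable]: "A \<in> sets F"
  shows "emeasure N A = (\<integral>\<^sup>+\<omega>. (\<integral>\<^sup>+u\<in>{0<..}. indicator A (scale scal u \<omega>) *
    ennreal (\<alpha> * u powr (- \<alpha> - 1)) \<partial>lborel) \<partial>QG lam F scal nrm x0 \<alpha> Q G)"
proof -
  define H where "H = (\<lambda>(\<omega>, s). ennreal (nv \<omega> s powr \<alpha>) * ennreal (G s) * inverse (J \<omega>))"
  have [measurable]: "H \<in> borel_measurable (F \<Otimes>\<^sub>M borel)" unfolding H_def by measurable
  have hom: "H (sc u \<omega>, s) = H (\<omega>, s)" if "\<omega> \<in> space F" "0 < u" for \<omega> u s
  proof -
    have "H (sc u \<omega>, s) = (inverse (ennreal (u powr \<alpha>)) * ennreal (u powr \<alpha>)) * H (\<omega>, s)"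
      using that by (simp add: H_def J_sc nv_sc powr_mult ennreal_mult ennreal_inverse_mult' mult_ac)
    then show ?thesis using that by (simp add: ennreal_inverse_self)
  qed
  have "AE \<omega> in N. phi H \<omega> = 1"
    using AE_N_full AE_N_J_finite AE_space
  proof eventually_elim
    case (elim \<omega>)
    then have [measurable]: "\<omega> \<in> space F" by simp
    have "phi H \<omega> = (\<integral>\<^sup>+s. inverse (J \<omega>) * (ennreal (nv \<omega> s powr \<alpha>) * ennreal (G s)) \<partial>lam)"
      unfolding phi_def
    proof (rule nn_integral_cong)
      fix s
      show "H (\<omega>, s) * indicator {0<..} (nv \<omega> s) = inverse (J \<omega>) * (ennreal (nv \<omega> s powr \<alpha>) * ennreal (G s))"
      \<comment> \<open>Where the modulus is 0, \<open>0 powr \<alpha> = 0\<close> already supplies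
        the indicator.\<close>
      proof (cases "0 < nv \<omega> s")
        case False
        then have "nv \<omega> s = 0" using nv_nonneg[of \<omega> s] by linarith
        then show ?thesis by (simp add: H_def)
      qed (simp add: H_def mult.commute)
    qed
    also have "\<dots> = inverse (J \<omega>) * J \<omega>"
      unfolding J_def by (rule nn_integral_cmult) measurable
    also have "\<dots> = 1" using elim by (intro ennreal_inverse_self J_pos) simp_all
    finally show ?case .
  qed
  then have "emeasure N A =
      (\<integral>\<^sup>+\<omega>. (\<integral>\<^sup>+s. (\<integral>\<^sup>+u. indicator A (sc u (shift (- s) \<omega>)) * H (shift (- s) \<omega>, s) \<partial>rho) \<partial>lam) \<partial>Q')"
    by (intro emeasure_N_formula) (simp_all add: hom)
  also have "\<dots> = (\<integral>\<^sup>+\<omega>. (\<integral>\<^sup>+s. (\<integral>\<^sup>+u. indicator A (sc u (T (shift (- s) \<omega>))) \<partial>rho) * ennreal (G s) \<partial>lam) \<partial>Q')"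
  proof (rule nn_integral_cong_AE)
    show "AE \<omega> in Q'. (\<integral>\<^sup>+s. (\<integral>\<^sup>+u. indicator A (sc u (shift (- s) \<omega>)) * H (shift (- s) \<omega>, s) \<partial>rho) \<partial>lam) =
      (\<integral>\<^sup>+s. (\<integral>\<^sup>+u. indicator A (sc u (T (shift (- s) \<omega>))) \<partial>rho) * ennreal (G s) \<partial>lam)"
      using AE_J_uminus AE_Q'_one AE_space
    proof eventually_elim
      case (elim \<omega>)
      have one: "nv \<omega> 0 = 1" and sp: "\<omega> \<in> space F" using elim by simp_all
      from elim(1) show ?case
      proof (intro nn_integral_cong_AE, eventually_elim)
        case (elim s)
        let ?w = "shift (- s) \<omega>"
        have [measurable]: "?w \<in> space F" using sp by simp
        have "(\<integral>\<^sup>+u. indicator A (sc u ?w) * H (?w, s) \<partial>rho) = (\<integral>\<^sup>+u. indicator A (sc u ?w) \<partial>rho) * H (?w, s)"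
          by (rule nn_integral_multc) measurable
        \<comment> \<open>The shifted path at \<open>s\<close> is the original path at 0, of modulus
          1 under \<open>Q'\<close>; hence only \<open>G s\<close> and the inverse of
          \<open>J\<close> survive in \<open>H\<close>.\<close>
        also have "\<dots> = (\<integral>\<^sup>+u. indicator A (sc u ?w) \<partial>rho) * (ennreal (G s) * inverse (J ?w))"
          by (simp add: H_def nv_shift one)
        also have "\<dots> = (\<integral>\<^sup>+u. indicator A (sc u (T ?w)) \<partial>rho) * ennreal (G s)"
          using elim sp by (subst nn_integral_T) (simp_all add: mult_ac)
        finally show ?case .
      qed
    qed
  qed
  also have "\<dots> = (\<integral>\<^sup>+\<omega>. (\<integral>\<^sup>+u. indicator A (sc u \<omega>) \<partial>rho) \<partial>D)"
    by (rule nn_integral_D[symmetric]) measurable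
  also have "\<dots> = (\<integral>\<^sup>+\<omega>. (\<integral>\<^sup>+u\<in>{0<..}. indicator A (scale scal u \<omega>) *
    ennreal (\<alpha> * u powr (- \<alpha> - 1)) \<partial>lborel) \<partial>D)"
    using nn_integral_rho_scale_form[of _ A 1] by (intro nn_integral_cong) simp
  finally show ?thesis by (simp only: QG_eq)
qed

end

theorem corollary6p12:
  fixes lam :: "'g::{topological_ab_group_add, t2_space} measure"
    and F :: "('g \<Rightarrow> 'h::polish_space) measure"
    and scal :: "real \<Rightarrow> 'h \<Rightarrow> 'h"
    and nrm :: "'h \<Rightarrow> real"
    and x0 :: 'h
    and \<alpha> :: real
    and Q :: "('g \<Rightarrow> 'h) measure"
  assumes setting: "tail_setting lam F scal nrm x0"
    and \<alpha>: "0 < \<alpha>"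
    and Q: "prob_space Q"
    and spectral: "spectrally_decomposable F scal nrm \<alpha> Q"
    and nonzero: "emeasure Q {\<omega> \<in> space F. 0 < emeasure (xi' lam nrm \<omega>) UNIV} = 1"
    and mass_stat: "mass_stationary lam F nrm Q"
  shows "(\<exists>!nu. stationary_tail_measure lam F scal nrm \<alpha> nu \<and> is_palm_measure lam F nrm nu Q) \<and>
    (\<forall>nu. stationary_tail_measure lam F scal nrm \<alpha> nu \<and> is_palm_measure lam F nrm nu Q \<longrightarrow>
      (\<forall>G :: 'g \<Rightarrow> real.
          G \<in> borel_measurable borel \<and> (\<forall>s. 0 < G s) \<and> (\<integral>\<^sup>+s. ennreal (G s) \<partial>lam) = 1 \<longrightarrow>
          (\<forall>A\<in>sets F. emeasure nu A =
             (\<integral>\<^sup>+\<omega>. (\<integral>\<^sup>+u\<in>{0<..}. indicator A (scale scal u \<omega>) * ennreal (\<alpha> * u powr (- \<alpha> - 1)) \<partial>lborel)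
                \<partial>QG lam F scal nrm x0 \<alpha> Q G))) \<and>
      (\<forall>H :: ('g \<Rightarrow> 'h) \<times> 'g \<Rightarrow> ennreal.
          H \<in> borel_measurable (F \<Otimes>\<^sub>M borel) \<and>
          (\<forall>\<omega>\<in>space F. \<forall>u>0. \<forall>s. H (scale scal u \<omega>, s) = H (\<omega>, s)) \<and>
          (AE \<omega> in Q. AE t in lam.
             (\<integral>\<^sup>+s. H (shift t (Wproc scal nrm x0 \<omega>), s - t)
                * indicator {s. 0 < nrm (Wproc scal nrm x0 \<omega> s)} s \<partial>lam) = 1) \<longrightarrow>
          (\<forall>A\<in>sets F. emeasure nu A =
             (\<integral>\<^sup>+\<omega>. (\<integral>\<^sup>+s. (\<integral>\<^sup>+u\<in>{0<..}.
                  indicator A (scale scal u (shift (- s) (Wproc scal nrm x0 \<omega>)))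
                  * H (shift (- s) (Wproc scal nrm x0 \<omega>), s)
                  * ennreal (\<alpha> * u powr (- \<alpha> - 1)) \<partial>lborel) \<partial>lam) \<partial>Q))))"
proof -
  obtain Q' where Q': "prob_space Q'" "sets Q' = sets F" "emeasure Q' {\<omega> \<in> space F. nrm (\<omega> 0) = 1} = 1"
    "\<forall>A\<in>sets F. emeasure Q A =
       (\<integral>\<^sup>+\<omega>. (\<integral>\<^sup>+u\<in>{1<..}. indicator A (scale scal u \<omega>) * ennreal (\<alpha> * u powr (- \<alpha> - 1)) \<partial>lborel) \<partial>Q')"
    using spectral unfolding spectrally_decomposable_def by (elim conjE exE) (rule that)
  have sets_Q: "sets Q = sets F"
    using spectral unfolding spectrally_decomposable_def by (rule conjunct1)
  interpret tail_spectral lam F scal nrm x0 \<alpha> Q Q'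
    by (intro tail_spectral.intro tail_spectral_axioms.intro setting \<alpha> Q sets_Q Q'(1-3)
      Q'(4)[rule_format] nonzero mass_stat)
  have inv: "palm_inverse lam F scal nrm x0 \<alpha> Q Q' nu"
    if "stationary_tail_measure lam F scal nrm \<alpha> nu \<and> is_palm_measure lam F nrm nu Q" for nu
    using that by (intro palm_inverse.intro palm_inverse_axioms.intro tail_spectral_axioms) simp_all
  obtain k where k: "add_weight k" using ex_add_weight by blast
  then have w: "weight k" by (simp add: add_weight_def)
  have nu: "stationary_tail_measure lam F scal nrm \<alpha> (nu k) \<and> is_palm_measure lam F nrm (nu k) Q"
    using stationary_tail_measure_nu[OF k] is_palm_measure_nu[OF k] by simp
  show ?thesis
  proof (intro conjI allI impI ballI)
    show "\<exists>!nu. stationary_tail_measure lam F scal nrm \<alpha> nu \<and> is_palm_measure lam F nrm nu Q"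
    proof (rule ex1I[where a = "nu k"])
      show "stationary_tail_measure lam F scal nrm \<alpha> (nu k) \<and> is_palm_measure lam F nrm (nu k) Q" by (rule nu)
    next
      fix N assume N: "stationary_tail_measure lam F scal nrm \<alpha> N \<and> is_palm_measure lam F nrm N Q"
      show "N = nu k"
      proof (rule measure_eqI)
        show "sets N = sets (nu k)" using palm_inverse.sets_N[OF inv[OF N]] by simp
        fix A assume "A \<in> sets N"
        then have A: "A \<in> sets F" using palm_inverse.sets_N[OF inv[OF N]] by simp
        \<comment> \<open>Both measures are given by \<open>weight_formula\<close> with the same
          \<open>k\<close>, whose right side is free of the measure.\<close>
        show "emeasure N A = emeasure (nu k) A"
          using palm_inverse.weight_formula[OF inv[OF N] w A] palm_inverse.weight_formula[OF inv[OF nu] w A]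
          by simp
      qed
    qed
  next
    fix nu G A
    assume nu: "stationary_tail_measure lam F scal nrm \<alpha> nu \<and> is_palm_measure lam F nrm nu Q"
      and G: "G \<in> borel_measurable borel \<and> (\<forall>s. 0 < G s) \<and> (\<integral>\<^sup>+s. ennreal (G s) \<partial>lam) = 1"
      and A: "A \<in> sets F"
    have "palm_inverse_weighted lam F scal nrm x0 \<alpha> Q Q' nu G"
      using G by (intro palm_inverse_weighted.intro palm_inverse_weighted_axioms.intro inv[OF nu]) simp_all
    then show "emeasure nu A =
       (\<integral>\<^sup>+\<omega>. (\<integral>\<^sup>+u\<in>{0<..}. indicator A (scale scal u \<omega>) * ennreal (\<alpha> * u powr (- \<alpha> - 1)) \<partial>lborel)
          \<partial>QG lam F scal nrm x0 \<alpha> Q G)"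
      using A by (rule palm_inverse_weighted.formula_G)
  next
    fix nu A and H :: "('g \<Rightarrow> 'h) \<times> 'g \<Rightarrow> ennreal"
    assume nu: "stationary_tail_measure lam F scal nrm \<alpha> nu \<and> is_palm_measure lam F nrm nu Q"
      and H: "H \<in> borel_measurable (F \<Otimes>\<^sub>M borel) \<and>
          (\<forall>\<omega>\<in>space F. \<forall>u>0. \<forall>s. H (scale scal u \<omega>, s) = H (\<omega>, s)) \<and>
          (AE \<omega> in Q. AE t in lam.
             (\<integral>\<^sup>+s. H (shift t (Wproc scal nrm x0 \<omega>), s - t)
                * indicator {s. 0 < nrm (Wproc scal nrm x0 \<omega> s)} s \<partial>lam) = 1)"
      and A: "A \<in> sets F"
    show "emeasure nu A =
       (\<integral>\<^sup>+\<omega>. (\<integral>\<^sup>+s. (\<integral>\<^sup>+u\<in>{0<..}.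
            indicator A (scale scal u (shift (- s) (Wproc scal nrm x0 \<omega>)))
            * H (shift (- s) (Wproc scal nrm x0 \<omega>), s)
            * ennreal (\<alpha> * u powr (- \<alpha> - 1)) \<partial>lborel) \<partial>lam) \<partial>Q)"
      by (rule palm_inverse.formula_H[OF inv[OF nu]]) (use H A in simp_all)
  qed
qed

end
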